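(* Let $G$ be a group acting faithfully on a tree $T$ (by automorphisms, edge inversions being allowed). Then there exists a graph of group actions $\mathcal G$ such that the action of $G$ on $T$ is isomorphic to the action induced by the universal group $\mathcal U(\mathcal G)$ on the associated tree $T_{\mathcal G}$.
   Context: **Graphs.** A graph $\Gamma$ has a vertex set $V\Gamma$, an arc set $A\Gamma$, maps $o,t\colon A\Gamma\to V\Gamma$ (origin, terminus) and an involution $a\mapsto\bar a$ on arcs with $o(a)=t(\bar a)$; an arc with $\bar a=a$ is called self-reverse (loops with $\bar a\ne a$ are also allowed). Graph morphisms preserve $o$, $t$ and reversal. A tree is a connected graph without loops and without two arcs having the same origin and the same terminus, which has no simple cycles of length $\ge 3$. Two actions $(G,T)$, $(G',T')$ on trees are isomorphic if there are a group isomorphism $\varphi\colon G\to G'$ and a tree isomorphism $\Phi\colon T\to T'$ with $\varphi(g)\Phi=\Phi g$ for all $g\in G$. **Group actions.** A permutation group action $(G,X)$ is a faithful action of a group $G$ on a non-empty set $X$. For $Y\subseteq X$, $G^Y$ is the permutation group induced on $Y$ by the setwise stabiliser of $Y$ in $G$. An embedding $(H,Y)\hookrightarrow(G,X)$ of permutation group actions is given by an injection $\Phi\colon Y\to X$ such that $h\mapsto \Phi h\Phi^{-1}$ is an isomorphism from $H$ onto $G^{\Phi(Y)}$. **Graph of group actions (gga).** A gga $\mathcal G$ consists of: a connected graph $\Delta$ (base graph); for every $v\in V\Delta$ a permutation group action $(G(v),X(v))$; for every $a\in A\Delta$ a permutation group action $(H(a),Y(a))$ with $(H(\bar a),Y(\bar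 a))=(H(a),Y(a))$ and an embedding $\Phi_a\colon(H(a),Y(a))\hookrightarrow(G(t(a)),X(t(a)))$; and for every self-reverse arc $a$ a permutation $h_a$ of $Y(a)$ with $h_aH(a)h_a^{-1}=H(a)$ and $h_a^2\in H(a)$ (inversion agent). An $a$-adhesion map is a map $g\Phi_a\colon Y(a)\to X(t(a))$ with $g\in G(t(a))$; its image is called an $a$-adhesion set. If $a$ is self-reverse, a twisted $a$-adhesion map is a map $g\Phi_ah_a$ with $g\in G(t(a))$. **Scaffolding.** A scaffolding $(\Sigma,\sim,\pi,p)$ for $\mathcal G$ is a graph $\Sigma$ with an equivalence relation $\sim$ on $V\Sigma$, extended to $A\Sigma$ by $a\sim a'$ iff $o(a)\sim o(a')$ and $t(a)\sim t(a')$ (write $[x]$ for the class of $x$ as a set, called a vertex or arc bundle, and $\llbracket x\rrbracket$ for the class as a vertex or arc of $T_\Sigma:=\Sigma/\!\sim$), such that: (i) $T_\Sigma$ is a tree; (ii) no arc of $\Sigma$ has both ends in the same vertex bundle; (iii) $\pi\colon T_\Sigma\to\Delta$ is a graph morphism; (iv) $p$ (a legal colouring) is a map from $V\Sigma\cup A\Sigma$ to $\bigcup_v X(v)\cup\bigcup_a Y(a)$ such that: $p$ restricts to bijections $[v]\to X(\pi(\llbracket v\rrbracket))$ and $[a]\to Y(\pi(\llbracket a\rrbracket))$ for all vertices $v$ and arcs $a$ of $\Sigma$; $p(\bar b)=p(b)$ for every arc $b$; if $\Psi_{\llbracket a\rrbracket}\colon Y(\pi(\llbracket a\rrbracket))\to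 X(\pi(t(\llbracket a\rrbracket)))$ is the unique map with $\Psi_{\llbracket a\rrbracket}(p(b))=p(t(b))$ for all $b\in[a]$, then $\Psi_{\llbracket a\rrbracket}$ is a $\pi(\llbracket a\rrbracket)$-adhesion map when $\pi(\llbracket a\rrbracket)$ is not self-reverse, while when $\pi(\llbracket a\rrbracket)$ is self-reverse one of $\Psi_{\llbracket a\rrbracket},\Psi_{\llbracket\bar a\rrbracket}$ is a $\pi(\llbracket a\rrbracket)$-adhesion map and the other is a twisted $\pi(\llbracket a\rrbracket)$-adhesion map; and for every vertex $\llbracket v\rrbracket$ of $T_\Sigma$, every $b\in A\Delta$ with $t(b)=\pi(\llbracket v\rrbracket)$ and every $b$-adhesion set $S$, there is exactly one arc $\llbracket a\rrbracket$ of $T_\Sigma$ with $t(\llbracket a\rrbracket)=\llbracket v\rrbracket$, $\pi(\llbracket a\rrbracket)=b$ and $\Psi_{\llbracket a\rrbracket}(Y(b))=S$. **Universal group.** Fix a scaffolding $(\Sigma,\sim,\pi,p)$ for $\mathcal G$. The universal group $\mathcal U(\mathcal G)$ is the group of all graph automorphisms $g$ of $\Sigma$ which preserve $\sim$, satisfy $\pi(\llbracket g(x)\rrbracket)=\pi(\llbracket x\rrbracket)$ for all vertices and arcs $x$, and are acceptable: for every $\llbracket v\rrbracket\in VT_\Sigma$ the permutation $g_{\llbracket v\rrbracket}$ of $X(\pi(\llbracket v\rrbracket))$ determined by $g_{\llbracket v\rrbracket}(p(x))=p(g(x))$, $x\in[v]$, lies in $G(\pi(\llbracket v\rrbracket))$.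 The associated tree of $\mathcal G$ is $T_{\mathcal G}=T_\Sigma$, on which $\mathcal U(\mathcal G)$ acts naturally; the induced action is that of the image of $\mathcal U(\mathcal G)$ in $\mathrm{Aut}(T_{\mathcal G})$. *)

theory Defs
  imports "HOL-Algebra.Bij" "Graph_Theory.Graph_Theory"
begin

section \<open>Graphs with an arc involution\<close>

text \<open>
  The origin of an arc is its tail, the terminus is its head. Arcs which are their own
  reverse are allowed (hence \<open>bidirected_digraph\<close> is not applicable), and so are loops,
  multiple arcs and infinite graphs.
\<close>

record ('v, 'a) rgraph = "('v, 'a) pre_digraph" +
  arev :: "'a \<Rightarrow> 'a"

definition digraph_of :: "('v, 'a) rgraph \<Rightarrow> ('v, 'a) pre_digraph" where
  "digraph_of \<Gamma> = \<lparr>verts = verts \<Gamma>, arcs = arcs \<Gamma>, tail = tail \<Gamma>, head = head \<Gamma>\<rparr>"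

definition rev_graph :: "('v, 'a) rgraph \<Rightarrow> bool" where
  "rev_graph \<Gamma> \<longleftrightarrow>
     wf_digraph (digraph_of \<Gamma>) \<and>
     (\<forall>a\<in>arcs \<Gamma>. arev \<Gamma> a \<in> arcs \<Gamma> \<and> arev \<Gamma> (arev \<Gamma> a) = a \<and> tail \<Gamma> a = head \<Gamma> (arev \<Gamma> a))"

text \<open>\<open>connected\<close> includes non-emptiness of the vertex set.\<close>

definition connected_graph :: "('v, 'a) rgraph \<Rightarrow> bool" where
  "connected_graph \<Gamma> \<longleftrightarrow> rev_graph \<Gamma> \<and> connected (digraph_of \<Gamma>)"

text \<open>
  An arc followed by its reverse is a \<open>cycle\<close> of length 2 of the underlying digraph, so
  only cycles of length at least 3 are excluded.
\<close>

definition tree_graph :: "('v, 'a) rgraph \<Rightarrow> bool" where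
  "tree_graph \<Gamma> \<longleftrightarrow>
     connected_graph \<Gamma> \<and>
     loopfree_digraph (digraph_of \<Gamma>) \<and>
     nomulti_digraph (digraph_of \<Gamma>) \<and>
     \<not> (\<exists>c. pre_digraph.cycle (digraph_of \<Gamma>) c \<and> 3 \<le> length c)"

definition graph_hom ::
    "('v, 'a) rgraph \<Rightarrow> ('w, 'b) rgraph \<Rightarrow> (('v \<Rightarrow> 'w) \<times> ('a \<Rightarrow> 'b)) set" where
  "graph_hom \<Gamma> \<Delta> = {(f, h).
     f \<in> verts \<Gamma> \<rightarrow> verts \<Delta> \<and> h \<in> arcs \<Gamma> \<rightarrow> arcs \<Delta> \<and>
     (\<forall>a\<in>arcs \<Gamma>. tail \<Delta> (h a) = f (tail \<Gamma> a) \<and> head \<Delta> (h a) = f (head \<Gamma> a) \<and>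
                 arev \<Delta> (h a) = h (arev \<Gamma> a))}"

definition graph_iso ::
    "('v, 'a) rgraph \<Rightarrow> ('w, 'b) rgraph \<Rightarrow> (('v \<Rightarrow> 'w) \<times> ('a \<Rightarrow> 'b)) set" where
  "graph_iso \<Gamma> \<Delta> = {(f, h) \<in> graph_hom \<Gamma> \<Delta>.
     bij_betw f (verts \<Gamma>) (verts \<Delta>) \<and> bij_betw h (arcs \<Gamma>) (arcs \<Delta>)}"

definition graph_aut :: "('v, 'a) rgraph \<Rightarrow> (('v \<Rightarrow> 'v) \<times> ('a \<Rightarrow> 'a)) monoid" where
  "graph_aut \<Gamma> = (BijGroup (verts \<Gamma>) \<times>\<times> BijGroup (arcs \<Gamma>))
     \<lparr>carrier := (Bij (verts \<Gamma>) \<times> Bij (arcs \<Gamma>)) \<inter> graph_hom \<Gamma> \<Gamma>\<rparr>"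


section \<open>Actions on graphs\<close>

definition acts_on_graph ::
    "'g monoid \<Rightarrow> ('v, 'a) rgraph \<Rightarrow> ('g \<Rightarrow> ('v \<Rightarrow> 'v) \<times> ('a \<Rightarrow> 'a)) \<Rightarrow> bool" where
  "acts_on_graph G \<Gamma> \<rho> \<longleftrightarrow> group G \<and> rev_graph \<Gamma> \<and> \<rho> \<in> hom G (graph_aut \<Gamma>)"

definition acts_faithfully_on_graph ::
    "'g monoid \<Rightarrow> ('v, 'a) rgraph \<Rightarrow> ('g \<Rightarrow> ('v \<Rightarrow> 'v) \<times> ('a \<Rightarrow> 'a)) \<Rightarrow> bool" where
  "acts_faithfully_on_graph G \<Gamma> \<rho> \<longleftrightarrow> acts_on_graph G \<Gamma> \<rho> \<and> inj_on \<rho> (carrier G)"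

definition isomorphic_graph_actions ::
    "'g monoid \<Rightarrow> ('v, 'a) rgraph \<Rightarrow> ('g \<Rightarrow> ('v \<Rightarrow> 'v) \<times> ('a \<Rightarrow> 'a)) \<Rightarrow>
     'h monoid \<Rightarrow> ('w, 'b) rgraph \<Rightarrow> ('h \<Rightarrow> ('w \<Rightarrow> 'w) \<times> ('b \<Rightarrow> 'b)) \<Rightarrow> bool" where
  "isomorphic_graph_actions G \<Gamma> \<rho> G' \<Gamma>' \<rho>' \<longleftrightarrow>
     (\<exists>\<phi> f h. \<phi> \<in> iso G G' \<and> (f, h) \<in> graph_iso \<Gamma> \<Gamma>' \<and>
        (\<forall>g\<in>carrier G.
           (\<forall>v\<in>verts \<Gamma>. fst (\<rho>' (\<phi> g)) (f v) = f (fst (\<rho> g) v)) \<and>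
           (\<forall>a\<in>arcs \<Gamma>. snd (\<rho>' (\<phi> g)) (h a) = h (snd (\<rho> g) a))))"


section \<open>Permutation group actions\<close>

text \<open>
  A faithful action on \<open>X\<close> is identified with its image in the symmetric group of \<open>X\<close>.
\<close>

definition perm_group :: "('x \<Rightarrow> 'x) set \<Rightarrow> 'x set \<Rightarrow> bool" where
  "perm_group G X \<longleftrightarrow> X \<noteq> {} \<and> subgroup G (BijGroup X)"

definition induced_perms :: "('x \<Rightarrow> 'x) set \<Rightarrow> 'x set \<Rightarrow> ('x \<Rightarrow> 'x) set" where
  "induced_perms G Y = {restrict g Y | g. g \<in> G \<and> g ` Y = Y}"

definition conj_perm :: "('y \<Rightarrow> 'x) \<Rightarrow> 'y set \<Rightarrow> ('y \<Rightarrow> 'y) \<Rightarrow> 'x \<Rightarrow> 'x" where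
  "conj_perm \<Phi> Y h = (\<lambda>x\<in>\<Phi> ` Y. \<Phi> (h (inv_into Y \<Phi> x)))"

definition perm_embedding ::
    "('y \<Rightarrow> 'x) \<Rightarrow> ('y \<Rightarrow> 'y) set \<Rightarrow> 'y set \<Rightarrow> ('x \<Rightarrow> 'x) set \<Rightarrow> 'x set \<Rightarrow> bool" where
  "perm_embedding \<Phi> H Y G X \<longleftrightarrow>
     \<Phi> \<in> Y \<rightarrow> X \<and> inj_on \<Phi> Y \<and>
     conj_perm \<Phi> Y \<in> iso ((BijGroup Y)\<lparr>carrier := H\<rparr>)
                         ((BijGroup (\<Phi> ` Y))\<lparr>carrier := induced_perms G (\<Phi> ` Y)\<rparr>)"


section \<open>Graphs of group actions\<close>

record ('v, 'a, 'x, 'y) gga_data =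
  base :: "('v, 'a) rgraph"
  vset :: "'v \<Rightarrow> 'x set"
  vgrp :: "'v \<Rightarrow> ('x \<Rightarrow> 'x) set"
  aset :: "'a \<Rightarrow> 'y set"
  agrp :: "'a \<Rightarrow> ('y \<Rightarrow> 'y) set"
  aemb :: "'a \<Rightarrow> 'y \<Rightarrow> 'x"
  inv_agent :: "'a \<Rightarrow> 'y \<Rightarrow> 'y"

text \<open>\<open>inv_agent\<close> is relevant only at self-reverse arcs.\<close>

definition is_gga :: "('v, 'a, 'x, 'y) gga_data \<Rightarrow> bool" where
  "is_gga \<G> \<longleftrightarrow>
     connected_graph (base \<G>) \<and>
     (\<forall>v\<in>verts (base \<G>). perm_group (vgrp \<G> v) (vset \<G> v)) \<and>
     (\<forall>a\<in>arcs (base \<G>).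
        perm_group (agrp \<G> a) (aset \<G> a) \<and>
        agrp \<G> (arev (base \<G>) a) = agrp \<G> a \<and> aset \<G> (arev (base \<G>) a) = aset \<G> a \<and>
        perm_embedding (aemb \<G> a) (agrp \<G> a) (aset \<G> a)
          (vgrp \<G> (head (base \<G>) a)) (vset \<G> (head (base \<G>) a)) \<and>
        (arev (base \<G>) a = a \<longrightarrow>
           (let S = BijGroup (aset \<G> a); h = inv_agent \<G> a in
              h \<in> carrier S \<and>
              (\<lambda>k. h \<otimes>\<^bsub>S\<^esub> k \<otimes>\<^bsub>S\<^esub> inv\<^bsub>S\<^esub> h) ` agrp \<G> a = agrp \<G> a \<and>
              h \<otimes>\<^bsub>S\<^esub> h \<in> agrp \<G> a)))"

definition adhesion_maps :: "('v, 'a, 'x, 'y) gga_data \<Rightarrow> 'a \<Rightarrow> ('y \<Rightarrow> 'x) set" where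
  "adhesion_maps \<G> a =
     {compose (aset \<G> a) g (aemb \<G> a) | g. g \<in> vgrp \<G> (head (base \<G>) a)}"

definition twisted_adhesion_maps :: "('v, 'a, 'x, 'y) gga_data \<Rightarrow> 'a \<Rightarrow> ('y \<Rightarrow> 'x) set" where
  "twisted_adhesion_maps \<G> a =
     {compose (aset \<G> a) g (compose (aset \<G> a) (aemb \<G> a) (inv_agent \<G> a)) | g.
        g \<in> vgrp \<G> (head (base \<G>) a)}"

definition adhesion_sets :: "('v, 'a, 'x, 'y) gga_data \<Rightarrow> 'a \<Rightarrow> 'x set set" where
  "adhesion_sets \<G> a = (\<lambda>\<psi>. \<psi> ` aset \<G> a) ` adhesion_maps \<G> a"


section \<open>Scaffoldings\<close>

text \<open>
  The projection is defined on the quotient graph, whose vertices and arcs are the vertex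
  bundles and arc bundles. The legal colouring is given by its restrictions \<open>vcol\<close> to
  vertices and \<open>acol\<close> to arcs.
\<close>

record ('s, 't, 'v, 'a, 'x, 'y) scaff_data =
  sgraph :: "('s, 't) rgraph"
  srel :: "('s \<times> 's) set"
  vproj :: "'s set \<Rightarrow> 'v"
  aproj :: "'t set \<Rightarrow> 'a"
  vcol :: "'s \<Rightarrow> 'x"
  acol :: "'t \<Rightarrow> 'y"

definition arc_rel :: "('s, 't, 'v, 'a, 'x, 'y) scaff_data \<Rightarrow> ('t \<times> 't) set" where
  "arc_rel S = {(a, b). a \<in> arcs (sgraph S) \<and> b \<in> arcs (sgraph S) \<and>
     (tail (sgraph S) a, tail (sgraph S) b) \<in> srel S \<and>
     (head (sgraph S) a, head (sgraph S) b) \<in> srel S}"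

text \<open>
  The tails of the arcs in a bundle are equivalent, so their saturation is a single vertex
  bundle; likewise for heads. The reverses of the arcs in a bundle form an arc bundle.
\<close>

definition scaff_tree :: "('s, 't, 'v, 'a, 'x, 'y) scaff_data \<Rightarrow> ('s set, 't set) rgraph" where
  "scaff_tree S =
     \<lparr>verts = verts (sgraph S) // srel S,
      arcs = arcs (sgraph S) // arc_rel S,
      tail = (\<lambda>A. srel S `` (tail (sgraph S) ` A)),
      head = (\<lambda>A. srel S `` (head (sgraph S) ` A)),
      arev = (\<lambda>A. arev (sgraph S) ` A)\<rparr>"

text \<open>
  For an arc bundle \<open>A\<close>, the map sending the colour of \<open>b \<in> A\<close> to the colour of the
  terminus of \<open>b\<close>.
\<close>

definition bundle_map ::
    "('v, 'a, 'x, 'y) gga_data \<Rightarrow> ('s, 't, 'v, 'a, 'x, 'y) scaff_data \<Rightarrow> 't set \<Rightarrow> 'y \<Rightarrow> 'x" where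
  "bundle_map \<G> S A =
     (\<lambda>y\<in>aset \<G> (aproj S A). vcol S (head (sgraph S) (inv_into A (acol S) y)))"

definition legal_colouring ::
    "('v, 'a, 'x, 'y) gga_data \<Rightarrow> ('s, 't, 'v, 'a, 'x, 'y) scaff_data \<Rightarrow> bool" where
  "legal_colouring \<G> S \<longleftrightarrow>
     (\<forall>V\<in>verts (scaff_tree S). bij_betw (vcol S) V (vset \<G> (vproj S V))) \<and>
     (\<forall>A\<in>arcs (scaff_tree S). bij_betw (acol S) A (aset \<G> (aproj S A))) \<and>
     (\<forall>b\<in>arcs (sgraph S). acol S (arev (sgraph S) b) = acol S b) \<and>
     (\<forall>A\<in>arcs (scaff_tree S).
        let a = aproj S A;
            \<psi> = bundle_map \<G> S A;
            \<psi>' = bundle_map \<G> S (arev (scaff_tree S) A)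
        in if arev (base \<G>) a \<noteq> a then \<psi> \<in> adhesion_maps \<G> a
           else \<psi> \<in> adhesion_maps \<G> a \<and> \<psi>' \<in> twisted_adhesion_maps \<G> a \<or>
                \<psi>' \<in> adhesion_maps \<G> a \<and> \<psi> \<in> twisted_adhesion_maps \<G> a) \<and>
     (\<forall>V\<in>verts (scaff_tree S). \<forall>b\<in>arcs (base \<G>). head (base \<G>) b = vproj S V \<longrightarrow>
        (\<forall>Z\<in>adhesion_sets \<G> b.
           \<exists>!A. A \<in> arcs (scaff_tree S) \<and> head (scaff_tree S) A = V \<and> aproj S A = b \<and>
                bundle_map \<G> S A ` aset \<G> b = Z))"

definition is_scaffolding ::
    "('v, 'a, 'x, 'y) gga_data \<Rightarrow> ('s, 't, 'v, 'a, 'x, 'y) scaff_data \<Rightarrow> bool" where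
  "is_scaffolding \<G> S \<longleftrightarrow>
     rev_graph (sgraph S) \<and>
     equiv (verts (sgraph S)) (srel S) \<and>
     tree_graph (scaff_tree S) \<and>
     (\<forall>a\<in>arcs (sgraph S). (tail (sgraph S) a, head (sgraph S) a) \<notin> srel S) \<and>
     (vproj S, aproj S) \<in> graph_hom (scaff_tree S) (base \<G>) \<and>
     legal_colouring \<G> S"


section \<open>The universal group and its action on the associated tree\<close>

definition local_perm ::
    "('v, 'a, 'x, 'y) gga_data \<Rightarrow> ('s, 't, 'v, 'a, 'x, 'y) scaff_data \<Rightarrow>
     ('s \<Rightarrow> 's) \<Rightarrow> 's set \<Rightarrow> 'x \<Rightarrow> 'x" where
  "local_perm \<G> S f V = (\<lambda>c\<in>vset \<G> (vproj S V). vcol S (f (inv_into V (vcol S) c)))"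

definition universal_group ::
    "('v, 'a, 'x, 'y) gga_data \<Rightarrow> ('s, 't, 'v, 'a, 'x, 'y) scaff_data \<Rightarrow>
     (('s \<Rightarrow> 's) \<times> ('t \<Rightarrow> 't)) monoid" where
  "universal_group \<G> S = (graph_aut (sgraph S))\<lparr>carrier :=
     {(f, h) \<in> carrier (graph_aut (sgraph S)).
        (\<forall>x\<in>verts (sgraph S). \<forall>y\<in>verts (sgraph S).
           (f x, f y) \<in> srel S \<longleftrightarrow> (x, y) \<in> srel S) \<and>
        (\<forall>x\<in>verts (sgraph S). vproj S (srel S `` {f x}) = vproj S (srel S `` {x})) \<and>
        (\<forall>b\<in>arcs (sgraph S). aproj S (arc_rel S `` {h b}) = aproj S (arc_rel S `` {b})) \<and>
        (\<forall>V\<in>verts (scaff_tree S). local_perm \<G> S f V \<in> vgrp \<G> (vproj S V))}\<rparr>"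

definition tree_perm ::
    "('s, 't, 'v, 'a, 'x, 'y) scaff_data \<Rightarrow> ('s \<Rightarrow> 's) \<times> ('t \<Rightarrow> 't) \<Rightarrow>
     ('s set \<Rightarrow> 's set) \<times> ('t set \<Rightarrow> 't set)" where
  "tree_perm S u = ((\<lambda>V\<in>verts (scaff_tree S). fst u ` V), (\<lambda>A\<in>arcs (scaff_tree S). snd u ` A))"

definition tree_image ::
    "('v, 'a, 'x, 'y) gga_data \<Rightarrow> ('s, 't, 'v, 'a, 'x, 'y) scaff_data \<Rightarrow>
     (('s set \<Rightarrow> 's set) \<times> ('t set \<Rightarrow> 't set)) monoid" where
  "tree_image \<G> S =
     (graph_aut (scaff_tree S))\<lparr>carrier := tree_perm S ` carrier (universal_group \<G> S)\<rparr>"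

end

theory Submission
  imports Defs
begin

text \<open>
  The base graph is the quotient of \<open>T\<close> by \<open>G\<close>. The vertex stabilisers act by left translation on
  the whole of \<open>G\<close>, which serves as the colour set of every vertex; the colour set of an arc is
  the setwise stabiliser of the underlying edge, with the arc stabiliser acting by left
  translation and an element inverting the edge as inversion agent. Colours then determine group
  elements, so a local permutation at one vertex determines the automorphism everywhere.

  A scaffolding consists of copies of \<open>G\<close> glued along translations, and the translations
  form a cocycle on its tree with values in \<open>G\<close>. On a tree every cocycle is a coboundary; a
  potential identifies the scaffolding with \<open>T \<times> G\<close> and yields a local isomorphism
  from the associated tree to \<open>T\<close>, hence an isomorphism. In these coordinates an automorphism
  is acceptable exactly if it acts on the factor \<open>G\<close> as a left translation that is constant along
  arcs, hence constant, that is, if it comes from \<open>G\<close>.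
\<close>

section \<open>Graphs and trees\<close>

text \<open>The dictionary behind the construction: a left coset \<open>x E(a)\<close> of an edge
  stabiliser is the same datum as the translate by \<open>x\<close> of the representing edge. The
  adhesion sets at a vertex are such cosets, so they enumerate the incident edges of one orbit, and
  the axiom that each adhesion set is met by exactly one arc becomes bijectivity of the map to
  \<open>T\<close> on the arcs ending at a vertex.

  What shapes the colours is inversion. The arc colours have to include the elements reversing the
  edge, and these fix neither of its ends; taking all of \<open>G\<close> as vertex colours makes
  room for them. The group induced on the image of \<open>E(a)\<close> is nevertheless only the arc
  stabiliser, because an element fixing an end of an edge cannot reverse that edge.

  In an arbitrary scaffolding the colours of a bundle are known only up to a \<open>G\<close>-valued
  correction depending on the bundle. This correction is what the potential removes.\<close>

lemma digraph_of_simps [simp]: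
  "verts (digraph_of \<Gamma>) = verts \<Gamma>" "arcs (digraph_of \<Gamma>) = arcs \<Gamma>"
  "tail (digraph_of \<Gamma>) = tail \<Gamma>" "head (digraph_of \<Gamma>) = head \<Gamma>"
  by (auto simp: digraph_of_def)

lemma rev_graphI:
  assumes "\<And>a. a \<in> arcs \<Gamma> \<Longrightarrow> head \<Gamma> a \<in> verts \<Gamma> \<and> arev \<Gamma> a \<in> arcs \<Gamma> \<and>
             arev \<Gamma> (arev \<Gamma> a) = a \<and> tail \<Gamma> a = head \<Gamma> (arev \<Gamma> a)"
  shows "rev_graph \<Gamma>"
  unfolding rev_graph_def wf_digraph_def using assms by auto

lemma rev_graphD:
  assumes "rev_graph \<Gamma>" "a \<in> arcs \<Gamma>"
  shows "tail \<Gamma> a \<in> verts \<Gamma>" "head \<Gamma> a \<in> verts \<Gamma>" "arev \<Gamma> a \<in> arcs \<Gamma>"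
    "arev \<Gamma> (arev \<Gamma> a) = a" "head \<Gamma> (arev \<Gamma> a) = tail \<Gamma> a" "tail \<Gamma> (arev \<Gamma> a) = head \<Gamma> a"
  using assms wf_digraph.tail_in_verts[of "digraph_of \<Gamma>" a]
    wf_digraph.head_in_verts[of "digraph_of \<Gamma>" a]
  unfolding rev_graph_def by auto

text \<open>Turns connectedness into an induction principle: a set of vertices that meets the graph
  and is closed under passing from tail to head contains all vertices. Going forward along arcs
  suffices because the arc set is closed under reversal, so the symmetric closure in
  \<open>connected\<close> adds no new pair.\<close>

lemma connected_graph_iff:
  "connected_graph \<Gamma> \<longleftrightarrow> rev_graph \<Gamma> \<and> verts \<Gamma> \<noteq> {} \<and>
     (\<forall>C r. r \<in> verts \<Gamma> \<longrightarrow> r \<in> C \<longrightarrow> (\<forall>a\<in>arcs \<Gamma>. tail \<Gamma> a \<in> C \<longrightarrow> head \<Gamma> a \<in> C) \<longrightarrow> verts \<Gamma> \<subseteq> C)"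
  (is "?L \<longleftrightarrow> ?R")
proof (cases "rev_graph \<Gamma>")
  case True
  let ?E = "(arcs_ends (digraph_of \<Gamma>))\<^sup>s"
  have E: "?E = {(tail \<Gamma> a, head \<Gamma> a) | a. a \<in> arcs \<Gamma>}"
  proof (intro equalityI subsetI)
    fix x assume "x \<in> ?E"
    then obtain a where a: "a \<in> arcs \<Gamma>"
      and "x = (tail \<Gamma> a, head \<Gamma> a) \<or> x = (head \<Gamma> a, tail \<Gamma> a)"
      by (auto simp: arcs_ends_conv symcl_def)
    then show "x \<in> {(tail \<Gamma> a, head \<Gamma> a) | a. a \<in> arcs \<Gamma>}"
      using a rev_graphD(3,5,6)[OF True a] by force
  qed (auto simp: arcs_ends_conv symcl_def)
  show ?thesis
  proof
    assume ?L
    then have ne: "verts \<Gamma> \<noteq> {}"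
      and reach: "\<And>u v. u \<in> verts \<Gamma> \<Longrightarrow> v \<in> verts \<Gamma> \<Longrightarrow> (u, v) \<in> rtrancl_on (verts \<Gamma>) ?E"
      unfolding connected_graph_def connected_conv by auto
    have "v \<in> C" if "r \<in> verts \<Gamma>" "r \<in> C" "\<forall>a\<in>arcs \<Gamma>. tail \<Gamma> a \<in> C \<longrightarrow> head \<Gamma> a \<in> C" "v \<in> verts \<Gamma>"
      for C r v
      using reach[OF that(1,4)]
    proof (induction rule: rtrancl_on_induct)
      case base
      then show ?case using that by simp
    next
      case (step y z)
      then show ?case using that(3) unfolding E by auto
    qed
    then show ?R using ne True by (intro conjI allI impI subsetI) blast+
  next
    assume R: ?R
    have "(u, v) \<in> rtrancl_on (verts \<Gamma>) ?E" if u: "u \<in> verts \<Gamma>" and v: "v \<in> verts \<Gamma>" for u v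
    proof -
      let ?C = "{v. (u, v) \<in> rtrancl_on (verts \<Gamma>) ?E}"
      have "u \<in> ?C" using u by (auto intro: rtrancl_on_refl)
      moreover have "head \<Gamma> a \<in> ?C" if a: "a \<in> arcs \<Gamma>" and t: "tail \<Gamma> a \<in> ?C" for a
      proof -
        have "(tail \<Gamma> a, head \<Gamma> a) \<in> ?E" unfolding E using a by auto
        then show ?thesis using t rev_graphD(2)[OF True a]
          by (auto intro: rtrancl_on_into_rtrancl_on)
      qed
      ultimately show ?thesis using R u v by blast
    qed
    then show ?L using R unfolding connected_graph_def connected_conv by auto
  qed
next
  case False
  then show ?thesis by (auto simp: connected_graph_def)
qed

lemma connected_graph_induct:
  assumes "connected_graph \<Gamma>" "r \<in> verts \<Gamma>" "v \<in> verts \<Gamma>" "P r"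
    and "\<And>a. a \<in> arcs \<Gamma> \<Longrightarrow> P (tail \<Gamma> a) \<Longrightarrow> P (head \<Gamma> a)"
  shows "P v"
  using assms unfolding connected_graph_iff by (auto dest!: spec[of _ "{v. P v}"])

lemma tree_graph_rev: "tree_graph \<Gamma> \<Longrightarrow> rev_graph \<Gamma>"
  by (simp add: tree_graph_def connected_graph_def)

lemma tree_graph_loopfree: "tree_graph \<Gamma> \<Longrightarrow> a \<in> arcs \<Gamma> \<Longrightarrow> tail \<Gamma> a \<noteq> head \<Gamma> a"
  unfolding tree_graph_def by (metis loopfree_digraph.no_loops digraph_of_simps)

lemma tree_graph_nomulti:
  "tree_graph \<Gamma> \<Longrightarrow> a \<in> arcs \<Gamma> \<Longrightarrow> b \<in> arcs \<Gamma> \<Longrightarrow> tail \<Gamma> a = tail \<Gamma> b \<Longrightarrow>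
     head \<Gamma> a = head \<Gamma> b \<Longrightarrow> a = b"
  unfolding tree_graph_def by (metis nomulti_digraph.no_multi_arcs arc_to_ends_def digraph_of_simps)

section \<open>Reduced walks and rooted trees\<close>

definition reduced_walk :: "('v, 'a) rgraph \<Rightarrow> 'v \<Rightarrow> 'a list \<Rightarrow> 'v \<Rightarrow> bool" where
  "reduced_walk \<Gamma> u p v \<longleftrightarrow> pre_digraph.awalk (digraph_of \<Gamma>) u p v \<and>
     successively (\<lambda>a b. b \<noteq> arev \<Gamma> a) p"

text \<open>Being reduced is a local condition, so it passes to subwalks. If the heads along a
  nonempty closed reduced walk are distinct, the walk is a cycle; length at least 3 is excluded by
  hypothesis, length 1 would be a loop, and length 2 a backtrack since there are no multiple arcs. A
  repeated head cuts out a shorter nonempty closed reduced walk, against the induction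
  hypothesis.\<close>

lemma reduced_walk_closed:
  assumes tree: "tree_graph \<Gamma>" and "reduced_walk \<Gamma> u p u"
  shows "p = []"
  using assms(2)
proof (induction "length p" arbitrary: u p rule: less_induct)
  case less
  interpret D: wf_digraph "digraph_of \<Gamma>"
    using tree_graph_rev[OF tree] by (simp add: rev_graph_def)
  note rev = rev_graphD[OF tree_graph_rev[OF tree]]
  have walk: "D.awalk u p u" and red: "successively (\<lambda>a b. b \<noteq> arev \<Gamma> a) p"
    using less.prems by (auto simp: reduced_walk_def)
  have arcs: "set p \<subseteq> arcs \<Gamma>" using walk by (auto simp: D.awalk_def)
  show ?case
  proof (rule ccontr)
    assume ne: "p \<noteq> []"
    have tl: "tl (D.awalk_verts u p) = map (head \<Gamma>) p"
      using D.awalk_verts_conv'[of u p u] walk ne by (auto simp: D.awalk_def)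
    show False
    proof (cases "distinct (map (head \<Gamma>) p)")
      case True
      then have "D.cycle p" using walk ne tl by (auto simp: D.cycle_def)
      then have "\<not> 3 \<le> length p" using tree by (auto simp: tree_graph_def)
      \<comment> \<open>The rule \<open>remdups_adj.cases\<close> only provides the split into lists
        of length 0, 1 and at least 2.\<close>
      then consider a where "p = [a]" | a b where "p = [a, b]"
        using ne by (cases p rule: remdups_adj.cases; cases "tl (tl p)") auto
      then show False
      proof cases
        case 1
        then show False using walk tree_graph_loopfree[OF tree, of a]
          by (auto simp: D.awalk_def)
      next
        case 2
        then have ab: "a \<in> arcs \<Gamma>" "b \<in> arcs \<Gamma>" "tail \<Gamma> b = head \<Gamma> a" "head \<Gamma> b = tail \<Gamma> a"
          using walk by (auto simp: D.awalk_def)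
        then have "b = arev \<Gamma> a"
          using rev[of a] by (intro tree_graph_nomulti[OF tree]) auto
        then show False using red 2 by simp
      qed
    next
      case False
      then obtain xs ys zs c where *: "map (head \<Gamma>) p = xs @ c # ys @ c # zs"
        using not_distinct_decomp[of "map (head \<Gamma>) p"] by auto
      obtain xs' vs where 0: "p = xs' @ vs" "map (head \<Gamma>) vs = c # ys @ c # zs"
        using iffD1[OF map_eq_append_conv *] that by metis
      obtain a qs where 1: "vs = a # qs" "head \<Gamma> a = c" "map (head \<Gamma>) qs = ys @ c # zs"
        using iffD1[OF map_eq_Cons_conv 0(2)] that by metis
      obtain ys' ws where 2: "qs = ys' @ ws" "map (head \<Gamma>) ws = c # zs"
        using iffD1[OF map_eq_append_conv 1(3)] that by metis
      obtain b zs' where 3: "ws = b # zs'" "head \<Gamma> b = c"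
        using iffD1[OF map_eq_Cons_conv 2(2)] that by metis
      note p = 0(1)[unfolded 1(1) 2(1) 3(1)] and c = 1(2) 3(2)
      have "D.awalk c (ys' @ [b]) c"
        using walk c unfolding p by (auto simp: D.awalk_simps)
      moreover have "successively (\<lambda>a b. b \<noteq> arev \<Gamma> a) (ys' @ [b])"
        using red unfolding p by (auto simp: successively_append_iff successively_Cons)
      ultimately show False
        using less.hyps[of "ys' @ [b]" c] by (auto simp: reduced_walk_def p)
    qed
  qed
qed

text \<open>If the last arcs agree, both can be stripped. If they differ, one walk followed by the
  reverse of the other is still reduced at the junction, hence a nonempty closed reduced walk, which
  does not exist.\<close>

lemma reduced_walk_unique:
  assumes tree: "tree_graph \<Gamma>" and "reduced_walk \<Gamma> r p v" "reduced_walk \<Gamma> r q v"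
  shows "p = q"
  using assms(2,3)
proof (induction p arbitrary: q v rule: rev_induct)
  case Nil
  then have "v = r" by (auto simp: reduced_walk_def pre_digraph.awalk_def pre_digraph.cas.simps)
  then show ?case using reduced_walk_closed[OF tree] Nil by metis
next
  case (snoc a p)
  interpret D: wf_digraph "digraph_of \<Gamma>"
    using tree_graph_rev[OF tree] by (simp add: rev_graph_def)
  note rev = rev_graphD[OF tree_graph_rev[OF tree]]
  show ?case
  proof (cases q rule: rev_cases)
    case Nil
    then have "v = r" using snoc by (auto simp: reduced_walk_def D.awalk_def)
    then show ?thesis using reduced_walk_closed[OF tree] snoc by metis
  next
    case (snoc q' b)
    have wp: "D.awalk r (p @ [a]) v" and rp: "successively (\<lambda>a b. b \<noteq> arev \<Gamma> a) (p @ [a])"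
      using snoc.prems(1) by (auto simp: reduced_walk_def)
    have wq: "D.awalk r (q' @ [b]) v" and rq: "successively (\<lambda>a b. b \<noteq> arev \<Gamma> a) (q' @ [b])"
      using snoc.prems(2) snoc by (auto simp: reduced_walk_def)
    show ?thesis
    proof (cases "a = b")
      case True
      have "reduced_walk \<Gamma> r p (tail \<Gamma> a)"
        using wp rp by (auto simp: reduced_walk_def successively_append_iff)
      moreover have "reduced_walk \<Gamma> r q' (tail \<Gamma> a)"
        using wq rq True by (auto simp: reduced_walk_def successively_append_iff)
      ultimately show ?thesis using snoc.IH True snoc by metis
    next
      case False
      have walk_rev: "D.awalk v (map (arev \<Gamma>) (rev xs)) u" if "D.awalk u xs v" for u xs v
        using that
      proof (induction xs arbitrary: u)
        case Nil
        then show ?case by (auto simp: D.awalk_def)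
      next
        case (Cons x xs)
        have x: "x \<in> arcs \<Gamma>" "tail \<Gamma> x = u" "D.awalk (head \<Gamma> x) xs v"
          using Cons.prems by (auto simp: D.awalk_simps)
        have "D.awalk (head \<Gamma> x) [arev \<Gamma> x] u"
          using rev[OF x(1)] x(2) by (simp add: D.awalk_def)
        then show ?case using D.awalk_appendI[OF Cons.IH[OF x(3)]] by simp
      qed
      have red_rev: "successively (\<lambda>a b. b \<noteq> arev \<Gamma> a) (map (arev \<Gamma>) (rev xs))"
        if "successively (\<lambda>a b. b \<noteq> arev \<Gamma> a) xs" "set xs \<subseteq> arcs \<Gamma>" for xs
        using that
      proof (induction xs)
        case Nil
        then show ?case by simp
      next
        case (Cons x xs)
        then show ?case using rev
          by (cases xs) (auto simp: successively_append_iff successively_Cons)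
      qed
      let ?c = "(p @ [a]) @ map (arev \<Gamma>) (rev (q' @ [b]))"
      have ab: "a \<in> arcs \<Gamma>" "b \<in> arcs \<Gamma>" "set q' \<subseteq> arcs \<Gamma>" using wp wq by (auto simp: D.awalk_def)
      then have "arev \<Gamma> a \<noteq> arev \<Gamma> b" using False rev by metis
      then have "successively (\<lambda>a b. b \<noteq> arev \<Gamma> a) ?c"
        unfolding successively_append_iff[of _ "p @ [a]"] using rp red_rev[OF rq] ab by auto
      moreover have "D.awalk r ?c r"
        using wp walk_rev[OF wq] by (rule D.awalk_appendI)
      ultimately have "?c = []"
        by (intro reduced_walk_closed[OF tree, of r]) (simp only: reduced_walk_def simp_thms)
      then show ?thesis by blast
    qed
  qed
qed

lemma reduced_walk_snoc:
  assumes "rev_graph \<Gamma>" "a \<in> arcs \<Gamma>" "reduced_walk \<Gamma> r p (tail \<Gamma> a)" "p \<noteq> [] \<Longrightarrow> a \<noteq> arev \<Gamma> (last p)"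
  shows "reduced_walk \<Gamma> r (p @ [a]) (head \<Gamma> a)"
proof -
  interpret D: wf_digraph "digraph_of \<Gamma>" using assms(1) by (simp add: rev_graph_def)
  show ?thesis using assms rev_graphD(1,2)[OF assms(1,2)]
    by (auto simp: reduced_walk_def D.awalk_simps successively_append_iff)
qed

lemma reduced_walk_butlast:
  assumes "rev_graph \<Gamma>" "reduced_walk \<Gamma> r p v" "p \<noteq> []"
  shows "reduced_walk \<Gamma> r (butlast p) (tail \<Gamma> (last p))" "last p \<in> arcs \<Gamma>" "head \<Gamma> (last p) = v"
proof -
  interpret D: wf_digraph "digraph_of \<Gamma>" using assms(1) by (simp add: rev_graph_def)
  obtain q a where "p = q @ [a]" using assms(3) by (cases p rule: rev_cases) auto
  then show "reduced_walk \<Gamma> r (butlast p) (tail \<Gamma> (last p))" "last p \<in> arcs \<Gamma>" "head \<Gamma> (last p) = v"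
    using assms by (auto simp: reduced_walk_def D.awalk_simps successively_append_iff)
qed

text \<open>Here \<open>d v\<close> is the length of the reduced walk from \<open>r\<close> to
  \<open>v\<close>, and \<open>par v\<close> is its last arc. Appending an arc to the reduced walk
  to its tail either gives a reduced walk, so the arc is the parent of its head, or cancels the last
  arc, so its reverse is the parent of its tail. With these facts, recursion over a tree no longer
  has to mention walks.\<close>

lemma tree_parents:
  fixes \<Gamma> :: "('v, 'a) rgraph"
  assumes tree: "tree_graph \<Gamma>" and r: "r \<in> verts \<Gamma>"
  obtains d :: "'v \<Rightarrow> nat" and par :: "'v \<Rightarrow> 'a" where
    "d r = 0"
    "\<And>v. v \<in> verts \<Gamma> \<Longrightarrow> v \<noteq> r \<Longrightarrow>
       par v \<in> arcs \<Gamma> \<and> head \<Gamma> (par v) = v \<and> d v = Suc (d (tail \<Gamma> (par v)))"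
    "\<And>a. a \<in> arcs \<Gamma> \<Longrightarrow> head \<Gamma> a \<noteq> r \<and> a = par (head \<Gamma> a) \<or>
                          tail \<Gamma> a \<noteq> r \<and> arev \<Gamma> a = par (tail \<Gamma> a)"
proof -
  note rg = tree_graph_rev[OF tree]
  note rev = rev_graphD[OF rg]
  interpret D: wf_digraph "digraph_of \<Gamma>" using rg by (simp add: rev_graph_def)
  have nil: "reduced_walk \<Gamma> r [] r" using r by (auto simp: reduced_walk_def D.awalk_def)
  have step: "\<exists>q. reduced_walk \<Gamma> r q (head \<Gamma> a) \<and>
      (q = p @ [a] \<or> p \<noteq> [] \<and> last p = arev \<Gamma> a \<and> q = butlast p)"
    if "a \<in> arcs \<Gamma>" "reduced_walk \<Gamma> r p (tail \<Gamma> a)" for a p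
  proof (cases "p \<noteq> [] \<and> a = arev \<Gamma> (last p)")
    case True
    then show ?thesis using reduced_walk_butlast[OF rg that(2)] rev[of "last p"] by auto
  next
    case False
    then show ?thesis using reduced_walk_snoc[OF rg that] by auto
  qed
  have ex: "\<exists>p. reduced_walk \<Gamma> r p v" if "v \<in> verts \<Gamma>" for v
  proof (rule connected_graph_induct[where P="\<lambda>v. \<exists>p. reduced_walk \<Gamma> r p v", OF _ r that])
    show "connected_graph \<Gamma>" using tree by (simp add: tree_graph_def)
  qed (use nil step in blast)+
  define P where "P v = (THE p. reduced_walk \<Gamma> r p v)" for v
  have P_eq: "P v = p" if "reduced_walk \<Gamma> r p v" for v p
    unfolding P_def using that reduced_walk_unique[OF tree] by blast
  have P: "reduced_walk \<Gamma> r (P v) v" if "v \<in> verts \<Gamma>" for v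
    using ex[OF that] P_eq by blast
  show ?thesis
  proof
    show "length (P r) = 0" using P_eq[OF nil] by simp
  next
    fix v assume v: "v \<in> verts \<Gamma>" "v \<noteq> r"
    then have ne: "P v \<noteq> []" using P[OF v(1)] by (auto simp: reduced_walk_def D.awalk_def)
    note b = reduced_walk_butlast[OF rg P[OF v(1)] ne]
    show "last (P v) \<in> arcs \<Gamma> \<and> head \<Gamma> (last (P v)) = v \<and>
        length (P v) = Suc (length (P (tail \<Gamma> (last (P v)))))"
      using b P_eq[OF b(1)] ne by auto
  next
    fix a assume a: "a \<in> arcs \<Gamma>"
    obtain q where q: "reduced_walk \<Gamma> r q (head \<Gamma> a)"
      and c: "q = P (tail \<Gamma> a) @ [a] \<or>
        P (tail \<Gamma> a) \<noteq> [] \<and> last (P (tail \<Gamma> a)) = arev \<Gamma> a \<and> q = butlast (P (tail \<Gamma> a))"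
      using step[OF a P] rev[OF a] by blast
    show "head \<Gamma> a \<noteq> r \<and> a = last (P (head \<Gamma> a)) \<or> tail \<Gamma> a \<noteq> r \<and> arev \<Gamma> a = last (P (tail \<Gamma> a))"
      using c P_eq[OF q] P_eq[OF nil] by auto
  qed
qed

text \<open>Multiplying the values of \<open>\<delta>\<close> along the parent arcs leading from the
  root gives the potential. The required equation then holds on parent arcs by construction and on
  their reverses by the symmetry of \<open>\<delta>\<close>, and every arc is of one of these
  kinds.\<close>

lemma tree_potential:
  fixes \<Gamma> :: "('v, 'a) rgraph"
  assumes tree: "tree_graph \<Gamma>" and "group G"
    and \<delta>: "\<And>a. a \<in> arcs \<Gamma> \<Longrightarrow> \<delta> a \<in> carrier G"
      "\<And>a. a \<in> arcs \<Gamma> \<Longrightarrow> \<delta> (arev \<Gamma> a) = inv\<^bsub>G\<^esub> (\<delta> a)"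
  obtains \<gamma> where "\<And>v. v \<in> verts \<Gamma> \<Longrightarrow> \<gamma> v \<in> carrier G"
    "\<And>a. a \<in> arcs \<Gamma> \<Longrightarrow> \<gamma> (head \<Gamma> a) = \<delta> a \<otimes>\<^bsub>G\<^esub> \<gamma> (tail \<Gamma> a)"
proof -
  interpret group G by fact
  note rev = rev_graphD[OF tree_graph_rev[OF tree]]
  obtain r where r: "r \<in> verts \<Gamma>" using tree by (auto simp: tree_graph_def connected_graph_iff)
  obtain d :: "'v \<Rightarrow> nat" and par :: "'v \<Rightarrow> 'a" where
    d0: "d r = 0" and
    par: "\<And>v. v \<in> verts \<Gamma> \<Longrightarrow> v \<noteq> r \<Longrightarrow>
       par v \<in> arcs \<Gamma> \<and> head \<Gamma> (par v) = v \<and> d v = Suc (d (tail \<Gamma> (par v)))" and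
    arc: "\<And>a. a \<in> arcs \<Gamma> \<Longrightarrow> head \<Gamma> a \<noteq> r \<and> a = par (head \<Gamma> a) \<or>
                          tail \<Gamma> a \<noteq> r \<and> arev \<Gamma> a = par (tail \<Gamma> a)"
    using tree_parents[OF tree r] by blast
  \<comment> \<open>The recursion runs over the depth and carries the vertex as an argument;
    \<open>f i v\<close> is of interest only when \<open>i\<close> is the depth of
    \<open>v\<close>.\<close>
  define f where "f = rec_nat (\<lambda>v. \<one>\<^bsub>G\<^esub>) (\<lambda>_ g v. \<delta> (par v) \<otimes>\<^bsub>G\<^esub> g (tail \<Gamma> (par v)))"
  define \<gamma> where "\<gamma> v = f (d v) v" for v
  have \<gamma>: "\<gamma> v = \<delta> (par v) \<otimes>\<^bsub>G\<^esub> \<gamma> (tail \<Gamma> (par v))" if "v \<in> verts \<Gamma>" "v \<noteq> r" for v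
    using par[OF that] by (simp add: \<gamma>_def f_def)
  have \<gamma>r: "\<gamma> r = \<one>\<^bsub>G\<^esub>" by (simp add: \<gamma>_def f_def d0)
  have carr: "\<gamma> v \<in> carrier G" if "v \<in> verts \<Gamma>" for v
    using that
  proof (induction "d v" arbitrary: v)
    case 0
    then show ?case using par[of v] \<gamma>r by (cases "v = r") auto
  next
    case (Suc n)
    then have "v \<noteq> r" using d0 by auto
    then show ?case using Suc par[of v] \<gamma>[of v] \<delta> rev by auto
  qed
  have "\<gamma> (head \<Gamma> a) = \<delta> a \<otimes>\<^bsub>G\<^esub> \<gamma> (tail \<Gamma> a)" if a: "a \<in> arcs \<Gamma>" for a
    using arc[OF a]
  proof
    assume "head \<Gamma> a \<noteq> r \<and> a = par (head \<Gamma> a)"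
    then show ?thesis using \<gamma>[of "head \<Gamma> a"] rev[OF a] by metis
  next
    assume *: "tail \<Gamma> a \<noteq> r \<and> arev \<Gamma> a = par (tail \<Gamma> a)"
    then have "\<gamma> (tail \<Gamma> a) = \<delta> (arev \<Gamma> a) \<otimes>\<^bsub>G\<^esub> \<gamma> (tail \<Gamma> (arev \<Gamma> a))"
      using \<gamma>[of "tail \<Gamma> a"] rev[OF a] by metis
    then show ?thesis using \<delta>[OF a] rev[OF a] carr[of "head \<Gamma> a"] by (simp add: m_assoc[symmetric])
  qed
  with carr show ?thesis using that by blast
qed

section \<open>Isomorphisms of graphs\<close>

text \<open>Preservation of tails comes for free, a tail being the head of the reverse arc.\<close>

lemma graph_homI:
  assumes "\<And>v. v \<in> verts \<Gamma> \<Longrightarrow> f v \<in> verts \<Delta>"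
    and "rev_graph \<Gamma>" "rev_graph \<Delta>"
    and "\<And>a. a \<in> arcs \<Gamma> \<Longrightarrow> h a \<in> arcs \<Delta> \<and> head \<Delta> (h a) = f (head \<Gamma> a) \<and> arev \<Delta> (h a) = h (arev \<Gamma> a)"
  shows "(f, h) \<in> graph_hom \<Gamma> \<Delta>"
proof -
  have "tail \<Delta> (h a) = f (tail \<Gamma> a)" if "a \<in> arcs \<Gamma>" for a
    using assms(4)[OF that] assms(4)[of "arev \<Gamma> a"] rev_graphD[OF assms(2) that]
      rev_graphD[OF assms(3), of "h a"] by auto
  then show ?thesis using assms unfolding graph_hom_def by auto
qed

lemma graph_homD:
  assumes "(f, h) \<in> graph_hom \<Gamma> \<Delta>"
  shows "v \<in> verts \<Gamma> \<Longrightarrow> f v \<in> verts \<Delta>"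
    and "a \<in> arcs \<Gamma> \<Longrightarrow> h a \<in> arcs \<Delta>"
    and "a \<in> arcs \<Gamma> \<Longrightarrow> tail \<Delta> (h a) = f (tail \<Gamma> a)"
    and "a \<in> arcs \<Gamma> \<Longrightarrow> head \<Delta> (h a) = f (head \<Gamma> a)"
    and "a \<in> arcs \<Gamma> \<Longrightarrow> arev \<Delta> (h a) = h (arev \<Gamma> a)"
  using assms unfolding graph_hom_def by auto

lemma graph_isoD:
  assumes "(f, h) \<in> graph_iso \<Gamma> \<Delta>"
  shows "(f, h) \<in> graph_hom \<Gamma> \<Delta>" "bij_betw f (verts \<Gamma>) (verts \<Delta>)" "bij_betw h (arcs \<Gamma>) (arcs \<Delta>)"
  using assms unfolding graph_iso_def by auto

text \<open>Trees are simply connected, so a morphism that is bijective on the arcs into each vertex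
  has no room to identify anything. Concretely it sends parent arcs to parent arcs, and two vertices
  with the same image can be traced back to the root together. Surjectivity follows by lifting arcs
  one at a time.\<close>

lemma tree_covering_iso:
  assumes tree: "tree_graph \<Gamma>" "tree_graph \<Delta>" and hom: "(f, h) \<in> graph_hom \<Gamma> \<Delta>"
    and loc: "\<And>v e. v \<in> verts \<Gamma> \<Longrightarrow> e \<in> arcs \<Delta> \<Longrightarrow> head \<Delta> e = f v \<Longrightarrow>
                \<exists>!a. a \<in> arcs \<Gamma> \<and> head \<Gamma> a = v \<and> h a = e"
  shows "(f, h) \<in> graph_iso \<Gamma> \<Delta>"
proof -
  note rg = tree_graph_rev[OF tree(1)] tree_graph_rev[OF tree(2)]
  note rev = rev_graphD[OF rg(1)] and rev' = rev_graphD[OF rg(2)]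
  note hom = graph_homD[OF hom]
  \<comment> \<open>The hypothesis speaks of arcs with a given head; reversal turns it into
    injectivity on the arcs with a given tail.\<close>
  have loc_inj: "a = b" if "a \<in> arcs \<Gamma>" "b \<in> arcs \<Gamma>" "tail \<Gamma> a = tail \<Gamma> b" "h a = h b" for a b
  proof -
    have "head \<Delta> (h (arev \<Gamma> a)) = f (tail \<Gamma> a)" using hom that rev by metis
    then have "arev \<Gamma> a = arev \<Gamma> b"
      using loc[of "tail \<Gamma> a" "h (arev \<Gamma> a)"] that rev hom by (metis (no_types, lifting))
    then show ?thesis using that rev by metis
  qed
  obtain r where r: "r \<in> verts \<Gamma>" using tree by (auto simp: tree_graph_def connected_graph_iff)
  obtain d par where
    d0: "d r = (0::nat)" and
    par: "\<And>v. v \<in> verts \<Gamma> \<Longrightarrow> v \<noteq> r \<Longrightarrow>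
       par v \<in> arcs \<Gamma> \<and> head \<Gamma> (par v) = v \<and> d v = Suc (d (tail \<Gamma> (par v)))" and
    arc: "\<And>a. a \<in> arcs \<Gamma> \<Longrightarrow> head \<Gamma> a \<noteq> r \<and> a = par (head \<Gamma> a) \<or>
                          tail \<Gamma> a \<noteq> r \<and> arev \<Gamma> a = par (tail \<Gamma> a)"
    using tree_parents[OF tree(1) r] by blast
  obtain d' par' where
    d0': "d' (f r) = (0::nat)" and
    par': "\<And>v. v \<in> verts \<Delta> \<Longrightarrow> v \<noteq> f r \<Longrightarrow>
       par' v \<in> arcs \<Delta> \<and> head \<Delta> (par' v) = v \<and> d' v = Suc (d' (tail \<Delta> (par' v)))" and
    arc': "\<And>a. a \<in> arcs \<Delta> \<Longrightarrow> head \<Delta> a \<noteq> f r \<and> a = par' (head \<Delta> a) \<or>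
                          tail \<Delta> a \<noteq> f r \<and> arev \<Delta> a = par' (tail \<Delta> a)"
    using tree_parents[OF tree(2) hom(1)[OF r]] by blast
  \<comment> \<open>The image of \<open>par v\<close> is either a parent arc or the reverse of one.
    In the second case induction and local injectivity at the parent \<open>u\<close> of
    \<open>v\<close> make \<open>par v\<close> the reverse of \<open>par u\<close>; then
    \<open>u\<close> and \<open>v\<close> would be parents of each other, which their depths
    forbid.\<close>
  have level: "v \<noteq> r \<longrightarrow> f v \<noteq> f r \<and> h (par v) = par' (f v)" if "v \<in> verts \<Gamma>" for v
    using that
  proof (induction "d v" arbitrary: v rule: less_induct)
    case less
    show ?case
    proof
      assume "v \<noteq> r"
      note p = par[OF less.prems this]
      let ?a = "par v" and ?u = "tail \<Gamma> (par v)"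
      have u: "?u \<in> verts \<Gamma>" using p rev by auto
      have ha: "h ?a \<in> arcs \<Delta>" "head \<Delta> (h ?a) = f v" "tail \<Delta> (h ?a) = f ?u" using hom p by auto
      have False if *: "f ?u \<noteq> f r" "arev \<Delta> (h ?a) = par' (f ?u)"
      proof -
        have "?u \<noteq> r" using * by auto
        with less.hyps[OF _ u] p have "h (par ?u) = h (arev \<Gamma> ?a)" using * hom(5) by auto
        then have "h (arev \<Gamma> (par ?u)) = h ?a"
          using hom(5) rev(4) par[OF u \<open>?u \<noteq> r\<close>] p rev(3) by metis
        then have "arev \<Gamma> (par ?u) = ?a"
          using par[OF u \<open>?u \<noteq> r\<close>] p rev by (intro loc_inj) auto
        then have "tail \<Gamma> (par ?u) = v" using par[OF u \<open>?u \<noteq> r\<close>] p rev by metis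
        then show False using par[OF u \<open>?u \<noteq> r\<close>] p by auto
      qed
      then show "f v \<noteq> f r \<and> h (par v) = par' (f v)" using arc'[OF ha(1)] ha by auto
    qed
  qed
  have inj: "v = w" if "v \<in> verts \<Gamma>" "w \<in> verts \<Gamma>" "f v = f w" for v w
    using that
  proof (induction "d v" arbitrary: v w rule: less_induct)
    case less
    show ?case
    proof (cases "v = r \<or> w = r")
      case True
      then show ?thesis using level less.prems by metis
    next
      case False
      note pv = par[of v] and pw = par[of w]
      have h: "h (par v) = h (par w)" using level less.prems False by metis
      have "tail \<Gamma> (par v) = tail \<Gamma> (par w)"
        using h pv pw False less.prems rev hom(3) by (intro less.hyps) (auto, metis)
      then have "par v = par w" using h pv pw False less.prems by (intro loc_inj) auto
      then show ?thesis using pv pw False less.prems by metis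
    qed
  qed
  have surj: "w \<in> f ` verts \<Gamma>" if "w \<in> verts \<Delta>" for w
  proof (rule connected_graph_induct[where P="\<lambda>w. w \<in> f ` verts \<Gamma>", OF _ hom(1)[OF r] that])
    show "connected_graph \<Delta>" using tree(2) by (simp add: tree_graph_def)
    show "f r \<in> f ` verts \<Gamma>" using r by simp
  next
    fix e assume e: "e \<in> arcs \<Delta>" and "tail \<Delta> e \<in> f ` verts \<Gamma>"
    then obtain v where v: "v \<in> verts \<Gamma>" "head \<Delta> (arev \<Delta> e) = f v" using rev' by auto
    with loc[OF v(1) _ v(2)] e rev' obtain a where a: "a \<in> arcs \<Gamma>" "h a = arev \<Delta> e" by metis
    then have "f (tail \<Gamma> a) = head \<Delta> e" using hom(3)[OF a(1)] e rev' by auto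
    then show "head \<Delta> e \<in> f ` verts \<Gamma>" using a rev by (metis imageI)
  qed
  have "inj_on h (arcs \<Gamma>)"
  proof (rule inj_onI)
    fix a b assume ab: "a \<in> arcs \<Gamma>" "b \<in> arcs \<Gamma>" "h a = h b"
    then have "f (tail \<Gamma> a) = f (tail \<Gamma> b)" using hom(3) by metis
    then show "a = b" using ab inj rev by (intro loc_inj) auto
  qed
  moreover have "e \<in> h ` arcs \<Gamma>" if "e \<in> arcs \<Delta>" for e
    using loc surj rev'(2) that by (metis (no_types, lifting) imageE imageI)
  moreover have "inj_on f (verts \<Gamma>)" using inj by (auto intro: inj_onI)
  ultimately show ?thesis using assms(3) hom surj unfolding graph_iso_def bij_betw_def by auto
qed

text \<open>Serves to recognise the quotient of the standard scaffolding as a tree. A cycle of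
  \<open>\<Delta>\<close> is the image under \<open>h\<close> of a list of arcs of
  \<open>\<Gamma>\<close>; injectivity of \<open>f\<close> makes this list a closed walk, and its
  vertices are distinct because their images are.\<close>

lemma tree_graph_iso:
  assumes iso: "(f, h) \<in> graph_iso \<Gamma> \<Delta>" and tree: "tree_graph \<Gamma>" and rg': "rev_graph \<Delta>"
  shows "tree_graph \<Delta>"
proof -
  note rg = tree_graph_rev[OF tree]
  note hom = graph_homD[OF graph_isoD(1)[OF iso]]
  have f: "inj_on f (verts \<Gamma>)" "verts \<Delta> = f ` verts \<Gamma>"
    and h: "inj_on h (arcs \<Gamma>)" "arcs \<Delta> = h ` arcs \<Gamma>"
    using graph_isoD[OF iso] by (auto simp: bij_betw_def)
  have f_eq: "f u = f v \<longleftrightarrow> u = v" if "u \<in> verts \<Gamma>" "v \<in> verts \<Gamma>" for u v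
    using f(1) that by (auto dest: inj_onD)
  interpret D: wf_digraph "digraph_of \<Gamma>" using rg by (simp add: rev_graph_def)
  interpret D': wf_digraph "digraph_of \<Delta>" using rg' by (simp add: rev_graph_def)
  have "connected_graph \<Delta>"
    unfolding connected_graph_iff
  proof (intro conjI allI impI)
    show "verts \<Delta> \<noteq> {}" using tree f by (auto simp: tree_graph_def connected_graph_iff)
  next
    fix C r assume r: "r \<in> verts \<Delta>" "r \<in> C" and C: "\<forall>a\<in>arcs \<Delta>. tail \<Delta> a \<in> C \<longrightarrow> head \<Delta> a \<in> C"
    obtain r' where r': "r' \<in> verts \<Gamma>" "r = f r'" using r f by auto
    have "f v \<in> C" if "v \<in> verts \<Gamma>" for v
    proof (rule connected_graph_induct[where P="\<lambda>v. f v \<in> C", OF _ r'(1) that])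
      show "connected_graph \<Gamma>" using tree by (simp add: tree_graph_def)
    next
      show "\<And>a. a \<in> arcs \<Gamma> \<Longrightarrow> f (tail \<Gamma> a) \<in> C \<Longrightarrow> f (head \<Gamma> a) \<in> C"
        using C hom by metis
    qed (use r r' in auto)
    then show "verts \<Delta> \<subseteq> C" using f by auto
  qed (rule rg')
  moreover have "loopfree_digraph (digraph_of \<Delta>)"
    using tree_graph_loopfree[OF tree] rev_graphD[OF rg] hom f_eq
    by unfold_locales (auto simp: h)
  moreover have "nomulti_digraph (digraph_of \<Delta>)"
    using rev_graphD(1,2)[OF rg] hom(1,3,4) f_eq
    by unfold_locales
      (auto simp: h arc_to_ends_def intro!: arg_cong[of _ _ h] tree_graph_nomulti[OF tree])
  moreover have False if c: "D'.cycle c" "3 \<le> length c" for c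
  proof -
    obtain w where w: "D'.awalk w c w" "distinct (tl (D'.awalk_verts w c))" "c \<noteq> []"
      using c unfolding D'.cycle_def by blast
    then have "c \<in> lists (h ` arcs \<Gamma>)" by (simp add: D'.awalk_def h lists_eq_set)
    then obtain p where p: "set p \<subseteq> arcs \<Gamma>" "c = map h p"
      unfolding lists_image by (auto simp: lists_eq_set)
    obtain u where u: "u \<in> verts \<Gamma>" "w = f u" using w f by (auto simp: D'.awalk_def)
    have cas: "D.cas v q v'" if "D'.cas (f v) (map h q) (f v')" "set q \<subseteq> arcs \<Gamma>"
        "v \<in> verts \<Gamma>" "v' \<in> verts \<Gamma>" for v q v'
      using that
    proof (induction q arbitrary: v)
      case (Cons a q)
      then show ?case using hom rev_graphD[OF rg] f_eq by auto
    qed (use f_eq in auto)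
    have walk: "D.awalk u p u" using w u p cas[of u p u] by (auto simp: D.awalk_def D'.awalk_def)
    have "tl (D'.awalk_verts w c) = map f (tl (D.awalk_verts u p))"
    proof -
      have "D.cas u p u" "D'.cas w c w" using walk w by (simp_all add: D.awalk_def D'.awalk_def)
      then show ?thesis using w(3) p hom(4)
        by (auto simp: D.awalk_verts_conv' D'.awalk_verts_conv')
    qed
    then have "distinct (tl (D.awalk_verts u p))" using w by (simp add: distinct_map)
    then have "D.cycle p" using walk w p by (auto simp: D.cycle_def)
    then show False using tree c p by (auto simp: tree_graph_def)
  qed
  ultimately show ?thesis unfolding tree_graph_def by auto
qed

section \<open>Automorphism groups of graphs and their transport along isomorphisms\<close>

lemma graph_aut_carrier_iff:
  "(\<alpha>, \<beta>) \<in> carrier (graph_aut \<Gamma>) \<longleftrightarrow>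
     \<alpha> \<in> Bij (verts \<Gamma>) \<and> \<beta> \<in> Bij (arcs \<Gamma>) \<and> (\<alpha>, \<beta>) \<in> graph_hom \<Gamma> \<Gamma>"
  by (auto simp: graph_aut_def)

lemma graph_aut_mult:
  assumes "x \<in> carrier (graph_aut \<Gamma>)" "y \<in> carrier (graph_aut \<Gamma>)"
  shows "x \<otimes>\<^bsub>graph_aut \<Gamma>\<^esub> y =
    (compose (verts \<Gamma>) (fst x) (fst y), compose (arcs \<Gamma>) (snd x) (snd y))"
  using assms by (cases x; cases y) (auto simp: graph_aut_def DirProd_def BijGroup_def)

lemma graph_aut_mult_apply:
  assumes "x \<in> carrier (graph_aut \<Gamma>)" "y \<in> carrier (graph_aut \<Gamma>)"
  shows "v \<in> verts \<Gamma> \<Longrightarrow> fst (x \<otimes>\<^bsub>graph_aut \<Gamma>\<^esub> y) v = fst x (fst y v)"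
    and "a \<in> arcs \<Gamma> \<Longrightarrow> snd (x \<otimes>\<^bsub>graph_aut \<Gamma>\<^esub> y) a = snd x (snd y a)"
  by (simp_all add: graph_aut_mult[OF assms] compose_eq)

lemma BijD:
  assumes "\<alpha> \<in> Bij X"
  shows "x \<in> X \<Longrightarrow> \<alpha> x \<in> X" "inj_on \<alpha> X" "\<alpha> ` X = X" "\<alpha> \<in> extensional X"
  using assms by (auto simp: Bij_def bij_betw_def)

lemma graph_aut_eqI:
  assumes x: "x \<in> carrier (graph_aut \<Gamma>)" and y: "y \<in> carrier (graph_aut \<Gamma>)"
    and "\<And>v. v \<in> verts \<Gamma> \<Longrightarrow> fst x v = fst y v" "\<And>a. a \<in> arcs \<Gamma> \<Longrightarrow> snd x a = snd y a"
  shows "x = y"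
proof -
  obtain \<alpha> \<beta> \<alpha>' \<beta>' where xy: "x = (\<alpha>, \<beta>)" "y = (\<alpha>', \<beta>')" by (cases x; cases y) auto
  then have "\<alpha> = \<alpha>'" "\<beta> = \<beta>'"
    using assms BijD(4) unfolding xy graph_aut_carrier_iff
    by (auto intro!: extensionalityI)
  then show ?thesis using xy by simp
qed

text \<open>Conjugation by an isomorphism \<open>(f, h)\<close>, carrying automorphisms of its
  target back to \<open>\<Gamma>\<close>. The restrictions keep the result extensional, as
  membership in \<open>graph_aut\<close> demands.\<close>

definition pull_aut ::
    "('v, 'a) rgraph \<Rightarrow> ('v \<Rightarrow> 'w) \<Rightarrow> ('a \<Rightarrow> 'b) \<Rightarrow> ('w \<Rightarrow> 'w) \<times> ('b \<Rightarrow> 'b) \<Rightarrow>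
      ('v \<Rightarrow> 'v) \<times> ('a \<Rightarrow> 'a)" where
  "pull_aut \<Gamma> f h x =
     (\<lambda>v\<in>verts \<Gamma>. inv_into (verts \<Gamma>) f (fst x (f v)), \<lambda>a\<in>arcs \<Gamma>. inv_into (arcs \<Gamma>) h (snd x (h a)))"

lemma conjugate_Bij:
  assumes f: "bij_betw f X Y" and \<alpha>: "\<alpha> \<in> Bij Y"
  shows "(\<lambda>v\<in>X. inv_into X f (\<alpha> (f v))) \<in> Bij X"
proof -
  have "bij_betw (inv_into X f \<circ> \<alpha> \<circ> f) X X"
    using f \<alpha> bij_betw_inv_into[OF f] by (auto simp: Bij_def intro: bij_betw_trans)
  then have "bij_betw (\<lambda>v\<in>X. inv_into X f (\<alpha> (f v))) X X"
    by (rule bij_betw_cong[THEN iffD1, rotated]) auto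
  then show ?thesis by (simp add: Bij_def)
qed

lemma pull_aut_apply:
  assumes iso: "(f, h) \<in> graph_iso \<Gamma> \<Delta>" and x: "x \<in> carrier (graph_aut \<Delta>)"
  shows "v \<in> verts \<Gamma> \<Longrightarrow> f (fst (pull_aut \<Gamma> f h x) v) = fst x (f v)"
    and "a \<in> arcs \<Gamma> \<Longrightarrow> h (snd (pull_aut \<Gamma> f h x) a) = snd x (h a)"
proof -
  obtain \<alpha> \<beta> where xe: "x = (\<alpha>, \<beta>)" by (cases x)
  note xc = x[unfolded xe graph_aut_carrier_iff]
  note i = graph_isoD[OF iso]
  { assume v: "v \<in> verts \<Gamma>"
    then have "\<alpha> (f v) \<in> f ` verts \<Gamma>" using xc i(2) BijD(1)[of \<alpha>] by (auto simp: bij_betw_def)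
    then show "f (fst (pull_aut \<Gamma> f h x) v) = fst x (f v)"
      using v by (simp add: pull_aut_def xe f_inv_into_f) }
  { assume a: "a \<in> arcs \<Gamma>"
    then have "\<beta> (h a) \<in> h ` arcs \<Gamma>" using xc i(3) BijD(1)[of \<beta>] by (auto simp: bij_betw_def)
    then show "h (snd (pull_aut \<Gamma> f h x) a) = snd x (h a)"
      using a by (simp add: pull_aut_def xe f_inv_into_f) }
qed

lemma pull_aut_closed:
  assumes iso: "(f, h) \<in> graph_iso \<Gamma> \<Delta>" and rg: "rev_graph \<Gamma>" and x: "x \<in> carrier (graph_aut \<Delta>)"
  shows "pull_aut \<Gamma> f h x \<in> carrier (graph_aut \<Gamma>)"
proof -
  obtain \<alpha> \<beta> where xe: "x = (\<alpha>, \<beta>)" by (cases x)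
  note xc = x[unfolded xe graph_aut_carrier_iff]
  note i = graph_isoD[OF iso]
  note hom = graph_homD[OF i(1)]
  have homx: "(\<alpha>, \<beta>) \<in> graph_hom \<Delta> \<Delta>" using xc by simp
  note homx = graph_homD[OF homx]
  obtain \<alpha>' \<beta>' where pe: "pull_aut \<Gamma> f h x = (\<alpha>', \<beta>')" by (cases "pull_aut \<Gamma> f h x")
  have bij: "\<alpha>' \<in> Bij (verts \<Gamma>)" "\<beta>' \<in> Bij (arcs \<Gamma>)"
    using conjugate_Bij[OF i(2), of \<alpha>] conjugate_Bij[OF i(3), of \<beta>] xc pe
    by (auto simp: pull_aut_def xe)
  note ap = pull_aut_apply[OF iso x, unfolded pe fst_conv snd_conv, unfolded xe fst_conv snd_conv]
  have "(\<alpha>', \<beta>') \<in> graph_hom \<Gamma> \<Gamma>"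
  proof (rule graph_homI[OF _ rg rg])
    show "\<alpha>' v \<in> verts \<Gamma>" if "v \<in> verts \<Gamma>" for v using that bij BijD(1) by metis
  next
    fix a assume a: "a \<in> arcs \<Gamma>"
    note r = rev_graphD[OF rg]
    have b: "\<beta>' a \<in> arcs \<Gamma>" "\<beta>' (arev \<Gamma> a) \<in> arcs \<Gamma>" "\<alpha>' (head \<Gamma> a) \<in> verts \<Gamma>"
      using a bij BijD(1) r by metis+
    have "f (head \<Gamma> (\<beta>' a)) = f (\<alpha>' (head \<Gamma> a))"
      using hom(4)[OF b(1)] hom(4)[OF a] hom(2)[OF a] ap(2)[OF a] ap(1)[of "head \<Gamma> a"] r(2)[OF a]
        homx(4)[of "h a"] by simp
    then have 1: "head \<Gamma> (\<beta>' a) = \<alpha>' (head \<Gamma> a)"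
      using i(2) b r(2)[OF b(1)] by (auto simp: bij_betw_def dest: inj_onD)
    have "h (arev \<Gamma> (\<beta>' a)) = h (\<beta>' (arev \<Gamma> a))"
      using hom(5)[OF b(1)] hom(5)[OF a] hom(2)[OF a] ap(2)[OF a] ap(2)[OF r(3)[OF a]]
        homx(5)[of "h a"] by simp
    then have 2: "arev \<Gamma> (\<beta>' a) = \<beta>' (arev \<Gamma> a)"
      using i(3) b r(3)[OF b(1)] by (auto simp: bij_betw_def dest: inj_onD)
    from 1 2 b show "\<beta>' a \<in> arcs \<Gamma> \<and> head \<Gamma> (\<beta>' a) = \<alpha>' (head \<Gamma> a) \<and> arev \<Gamma> (\<beta>' a) = \<beta>' (arev \<Gamma> a)"
      by simp
  qed
  then show ?thesis unfolding pe graph_aut_carrier_iff using bij by simp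
qed

lemma graph_aut_closed_apply:
  assumes "x \<in> carrier (graph_aut \<Gamma>)"
  shows "v \<in> verts \<Gamma> \<Longrightarrow> fst x v \<in> verts \<Gamma>" "a \<in> arcs \<Gamma> \<Longrightarrow> snd x a \<in> arcs \<Gamma>"
  using assms by (auto simp: graph_aut_def intro: BijD(1))

lemma graph_aut_mult_closed:
  assumes rg: "rev_graph \<Gamma>" and x: "x \<in> carrier (graph_aut \<Gamma>)" and y: "y \<in> carrier (graph_aut \<Gamma>)"
  shows "x \<otimes>\<^bsub>graph_aut \<Gamma>\<^esub> y \<in> carrier (graph_aut \<Gamma>)"
proof -
  obtain \<alpha> \<beta> \<alpha>' \<beta>' where xy: "x = (\<alpha>, \<beta>)" "y = (\<alpha>', \<beta>')" by (cases x; cases y) auto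
  note c = x[unfolded xy graph_aut_carrier_iff] y[unfolded xy graph_aut_carrier_iff]
  then have h: "(\<alpha>, \<beta>) \<in> graph_hom \<Gamma> \<Gamma>" "(\<alpha>', \<beta>') \<in> graph_hom \<Gamma> \<Gamma>" by auto
  note h = graph_homD[OF h(1)] graph_homD[OF h(2)]
  have "(compose (verts \<Gamma>) \<alpha> \<alpha>', compose (arcs \<Gamma>) \<beta> \<beta>') \<in> graph_hom \<Gamma> \<Gamma>"
    by (rule graph_homI[OF _ rg rg]) (use h rev_graphD[OF rg] in \<open>auto simp: compose_eq\<close>)
  then show ?thesis unfolding graph_aut_mult[OF x y] using c
    by (auto simp: xy graph_aut_carrier_iff intro: compose_Bij)
qed

lemma pull_aut_hom:
  assumes iso: "(f, h) \<in> graph_iso \<Gamma> \<Delta>" and rg: "rev_graph \<Gamma>" "rev_graph \<Delta>"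
  shows "pull_aut \<Gamma> f h \<in> hom (graph_aut \<Delta>) (graph_aut \<Gamma>)"
proof (rule homI)
  fix x y assume x: "x \<in> carrier (graph_aut \<Delta>)" and y: "y \<in> carrier (graph_aut \<Delta>)"
  note hom = graph_homD[OF graph_isoD(1)[OF iso]]
  let ?x = "pull_aut \<Gamma> f h x" and ?y = "pull_aut \<Gamma> f h y"
  let ?xy = "pull_aut \<Gamma> f h (x \<otimes>\<^bsub>graph_aut \<Delta>\<^esub> y)"
  note px = pull_aut_closed[OF iso rg(1) x] and py = pull_aut_closed[OF iso rg(1) y]
  note xy = graph_aut_mult_closed[OF rg(2) x y]
  note pxy = pull_aut_closed[OF iso rg(1) xy]
  show "?xy = ?x \<otimes>\<^bsub>graph_aut \<Gamma>\<^esub> ?y"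
  proof (rule graph_aut_eqI[OF pxy graph_aut_mult_closed[OF rg(1) px py]])
    fix v assume v: "v \<in> verts \<Gamma>"
    have "f (fst ?xy v) = f (fst ?x (fst ?y v))"
      using v hom(1)[OF v] graph_aut_closed_apply(1)[OF py v]
      by (simp add: pull_aut_apply[OF iso] x y xy graph_aut_mult_apply)
    moreover have "fst ?xy v \<in> verts \<Gamma>" "fst ?x (fst ?y v) \<in> verts \<Gamma>"
      using graph_aut_closed_apply(1) px py pxy v by metis+
    ultimately show "fst ?xy v = fst (?x \<otimes>\<^bsub>graph_aut \<Gamma>\<^esub> ?y) v"
      using graph_isoD(2)[OF iso] v
      by (auto simp: graph_aut_mult_apply px py bij_betw_def dest: inj_onD)
  next
    fix v assume v: "v \<in> arcs \<Gamma>"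
    have "h (snd ?xy v) = h (snd ?x (snd ?y v))"
      using v hom(2)[OF v] graph_aut_closed_apply(2)[OF py v]
      by (simp add: pull_aut_apply[OF iso] x y xy graph_aut_mult_apply)
    moreover have "snd ?xy v \<in> arcs \<Gamma>" "snd ?x (snd ?y v) \<in> arcs \<Gamma>"
      using graph_aut_closed_apply(2) px py pxy v by metis+
    ultimately show "snd ?xy v = snd (?x \<otimes>\<^bsub>graph_aut \<Gamma>\<^esub> ?y) v"
      using graph_isoD(3)[OF iso] v
      by (auto simp: graph_aut_mult_apply px py bij_betw_def dest: inj_onD)
  qed
qed (rule pull_aut_closed[OF iso rg(1)])

lemma pull_aut_inj:
  assumes iso: "(f, h) \<in> graph_iso \<Gamma> \<Delta>"
  shows "inj_on (pull_aut \<Gamma> f h) (carrier (graph_aut \<Delta>))"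
proof (rule inj_onI)
  fix x y assume xy: "x \<in> carrier (graph_aut \<Delta>)" "y \<in> carrier (graph_aut \<Delta>)"
    and eq: "pull_aut \<Gamma> f h x = pull_aut \<Gamma> f h y"
  show "x = y"
  proof (rule graph_aut_eqI[OF xy])
    fix v assume "v \<in> verts \<Delta>"
    then obtain u where "u \<in> verts \<Gamma>" "v = f u" using graph_isoD(2)[OF iso] by (auto simp: bij_betw_def)
    then show "fst x v = fst y v" using pull_aut_apply(1)[OF iso] xy eq by metis
  next
    fix v assume "v \<in> arcs \<Delta>"
    then obtain u where "u \<in> arcs \<Gamma>" "v = h u" using graph_isoD(3)[OF iso] by (auto simp: bij_betw_def)
    then show "snd x v = snd y v" using pull_aut_apply(2)[OF iso] xy eq by metis
  qed
qed

text \<open>Recognises a pair of maps as a transported automorphism from equivariance alone: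
  \<open>f\<close> and \<open>h\<close> are injective on the graph, and extensionality settles the
  values outside it.\<close>

lemma eq_pull_autI:
  assumes iso: "(f, h) \<in> graph_iso \<Gamma> \<Delta>" and rg: "rev_graph \<Gamma>"
    and x: "x \<in> carrier (graph_aut \<Delta>)" and "y \<in> extensional (verts \<Gamma>)" "z \<in> extensional (arcs \<Gamma>)"
    and "\<And>v. v \<in> verts \<Gamma> \<Longrightarrow> y v \<in> verts \<Gamma> \<and> f (y v) = fst x (f v)"
    and "\<And>a. a \<in> arcs \<Gamma> \<Longrightarrow> z a \<in> arcs \<Gamma> \<and> h (z a) = snd x (h a)"
  shows "(y, z) = pull_aut \<Gamma> f h x"
proof -
  have "fst (pull_aut \<Gamma> f h x) = y"
  proof (rule extensionalityI[of _ "verts \<Gamma>"])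
    fix v assume v: "v \<in> verts \<Gamma>"
    have "f (fst (pull_aut \<Gamma> f h x) v) = f (y v)" using pull_aut_apply(1)[OF iso x v] assms(6)[OF v] by simp
    moreover have "fst (pull_aut \<Gamma> f h x) v \<in> verts \<Gamma>"
      using pull_aut_closed[OF iso rg x] graph_aut_closed_apply(1) v by metis
    ultimately show "fst (pull_aut \<Gamma> f h x) v = y v"
      using graph_isoD(2)[OF iso] assms(6)[OF v] by (metis bij_betw_def inj_onD)
  qed (use assms in \<open>auto simp: pull_aut_def\<close>)
  moreover have "snd (pull_aut \<Gamma> f h x) = z"
  proof (rule extensionalityI[of _ "arcs \<Gamma>"])
    fix v assume v: "v \<in> arcs \<Gamma>"
    have "h (snd (pull_aut \<Gamma> f h x) v) = h (z v)" using pull_aut_apply(2)[OF iso x v] assms(7)[OF v] by simp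
    moreover have "snd (pull_aut \<Gamma> f h x) v \<in> arcs \<Gamma>"
      using pull_aut_closed[OF iso rg x] graph_aut_closed_apply(2) v by metis
    ultimately show "snd (pull_aut \<Gamma> f h x) v = z v"
      using graph_isoD(3)[OF iso] assms(7)[OF v] by (metis bij_betw_def inj_onD)
  qed (use assms in \<open>auto simp: pull_aut_def\<close>)
  ultimately show ?thesis by (metis prod.collapse)
qed

lemma graph_iso_inv:
  assumes iso: "(f, h) \<in> graph_iso \<Gamma> \<Delta>" and rg: "rev_graph \<Gamma>" "rev_graph \<Delta>"
  shows "(inv_into (verts \<Gamma>) f, inv_into (arcs \<Gamma>) h) \<in> graph_iso \<Delta> \<Gamma>"
proof -
  note i = graph_isoD[OF iso]
  note hom = graph_homD[OF i(1)]
  have f: "inv_into (verts \<Gamma>) f (f v) = v" if "v \<in> verts \<Gamma>" for v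
    using that i(2) by (auto simp: bij_betw_def)
  have h: "inv_into (arcs \<Gamma>) h (h v) = v" if "v \<in> arcs \<Gamma>" for v
    using that i(3) by (auto simp: bij_betw_def)
  have "(inv_into (verts \<Gamma>) f, inv_into (arcs \<Gamma>) h) \<in> graph_hom \<Delta> \<Gamma>"
  proof (rule graph_homI[OF _ rg(2,1)])
    show "inv_into (verts \<Gamma>) f v \<in> verts \<Gamma>" if "v \<in> verts \<Delta>" for v
      using that i(2) by (metis bij_betw_def inv_into_into)
  next
    fix b assume "b \<in> arcs \<Delta>"
    then obtain a where a: "a \<in> arcs \<Gamma>" "b = h a" using i(3) by (auto simp: bij_betw_def)
    then show "inv_into (arcs \<Gamma>) h b \<in> arcs \<Gamma> \<and>
         head \<Gamma> (inv_into (arcs \<Gamma>) h b) = inv_into (verts \<Gamma>) f (head \<Delta> b) \<and>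
         arev \<Gamma> (inv_into (arcs \<Gamma>) h b) = inv_into (arcs \<Gamma>) h (arev \<Delta> b)"
      using f h hom rev_graphD[OF rg(1) a(1)] by auto
  qed
  then show ?thesis using i unfolding graph_iso_def by (auto intro: bij_betw_inv_into)
qed

section \<open>The graph of group actions of an action on a tree\<close>

locale tree_action = group G for G :: "'g monoid" (structure) +
  fixes T :: "('v, 'e) rgraph"
    and \<rho> :: "'g \<Rightarrow> ('v \<Rightarrow> 'v) \<times> ('e \<Rightarrow> 'e)"
  assumes tree: "tree_graph T"
    and \<rho>_hom: "\<rho> \<in> hom G (graph_aut T)"
begin

section \<open>The action on vertices and arcs, its orbits and the quotient graph\<close>

definition va :: "'g \<Rightarrow> 'v \<Rightarrow> 'v" where "va g = fst (\<rho> g)"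
definition ea :: "'g \<Rightarrow> 'e \<Rightarrow> 'e" where "ea g = snd (\<rho> g)"

lemma T_rev: "rev_graph T"
  using tree by (rule tree_graph_rev)

lemmas T = rev_graphD[OF T_rev]

lemma \<rho>_closed: "g \<in> carrier G \<Longrightarrow> \<rho> g \<in> carrier (graph_aut T)"
  using \<rho>_hom by (rule hom_in_carrier)

lemma va_closed [simp]: "g \<in> carrier G \<Longrightarrow> v \<in> verts T \<Longrightarrow> va g v \<in> verts T"
  and ea_closed [simp]: "g \<in> carrier G \<Longrightarrow> e \<in> arcs T \<Longrightarrow> ea g e \<in> arcs T"
  unfolding va_def ea_def using graph_aut_closed_apply \<rho>_closed by metis+

lemma va_mult: "g \<in> carrier G \<Longrightarrow> h \<in> carrier G \<Longrightarrow> v \<in> verts T \<Longrightarrow> va (g \<otimes> h) v = va g (va h v)"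
  and ea_mult: "g \<in> carrier G \<Longrightarrow> h \<in> carrier G \<Longrightarrow> e \<in> arcs T \<Longrightarrow> ea (g \<otimes> h) e = ea g (ea h e)"
  unfolding va_def ea_def using hom_mult[OF \<rho>_hom] graph_aut_mult_apply \<rho>_closed by metis+

lemma ea_graph_hom: "g \<in> carrier G \<Longrightarrow> (va g, ea g) \<in> graph_hom T T"
  using \<rho>_closed[of g] by (cases "\<rho> g") (simp add: graph_aut_carrier_iff va_def ea_def)

lemma tail_ea: "g \<in> carrier G \<Longrightarrow> e \<in> arcs T \<Longrightarrow> tail T (ea g e) = va g (tail T e)"
  and head_ea: "g \<in> carrier G \<Longrightarrow> e \<in> arcs T \<Longrightarrow> head T (ea g e) = va g (head T e)"
  and arev_ea: "g \<in> carrier G \<Longrightarrow> e \<in> arcs T \<Longrightarrow> arev T (ea g e) = ea g (arev T e)"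
  using graph_homD[OF ea_graph_hom] by auto

lemma va_inj: "g \<in> carrier G \<Longrightarrow> v \<in> verts T \<Longrightarrow> w \<in> verts T \<Longrightarrow> va g v = va g w \<longleftrightarrow> v = w"
  and ea_inj: "g \<in> carrier G \<Longrightarrow> e \<in> arcs T \<Longrightarrow> e' \<in> arcs T \<Longrightarrow> ea g e = ea g e' \<longleftrightarrow> e = e'"
  using \<rho>_closed[of g] BijD(2)
  by (cases "\<rho> g", auto simp: graph_aut_carrier_iff va_def ea_def dest: inj_onD)+

text \<open>The neutral element acts by an idempotent injective map, hence by the identity.\<close>

lemma va_one [simp]: "v \<in> verts T \<Longrightarrow> va \<one> v = v"
  and ea_one [simp]: "e \<in> arcs T \<Longrightarrow> ea \<one> e = e"
  using va_mult[of \<one> \<one> v] va_inj[of \<one> "va \<one> v" v] ea_mult[of \<one> \<one> e] ea_inj[of \<one> "ea \<one> e" e] by auto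

lemma va_inv_eq: "g \<in> carrier G \<Longrightarrow> v \<in> verts T \<Longrightarrow> w \<in> verts T \<Longrightarrow> va (inv g) v = w \<longleftrightarrow> v = va g w"
  using va_mult[of g "inv g" v] va_mult[of "inv g" g w] by auto

lemma ea_inv_eq: "g \<in> carrier G \<Longrightarrow> v \<in> arcs T \<Longrightarrow> w \<in> arcs T \<Longrightarrow> ea (inv g) v = w \<longleftrightarrow> v = ea g w"
  using ea_mult[of g "inv g" v] ea_mult[of "inv g" g w] by auto

definition vorb :: "'v \<Rightarrow> 'v set" where "vorb v = (\<lambda>g. va g v) ` carrier G"
definition eorb :: "'e \<Rightarrow> 'e set" where "eorb e = (\<lambda>g. ea g e) ` carrier G"

lemma vorb_self: "v \<in> verts T \<Longrightarrow> v \<in> vorb v"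
  unfolding vorb_def by (rule image_eqI[of _ _ \<one>]) auto

lemma eorb_self: "e \<in> arcs T \<Longrightarrow> e \<in> eorb e"
  unfolding eorb_def by (rule image_eqI[of _ _ \<one>]) auto

lemma vorbE:
  assumes "w \<in> vorb v" "v \<in> verts T" obtains g where "g \<in> carrier G" "w = va g v" "w \<in> verts T"
  using assms va_closed unfolding vorb_def by blast

lemma eorbE:
  assumes "w \<in> eorb v" "v \<in> arcs T" obtains g where "g \<in> carrier G" "w = ea g v" "w \<in> arcs T"
  using assms ea_closed unfolding eorb_def by blast

lemma vorb_va [simp]:
  assumes g: "g \<in> carrier G" and v: "v \<in> verts T" shows "vorb (va g v) = vorb v"
proof -
  have "va h v \<in> vorb (va g v)" if "h \<in> carrier G" for h
    unfolding vorb_def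
    using that g v va_mult[of h "inv g" "va g v"] va_inv_eq[of g "va g v" v]
    by (intro image_eqI[of _ _ "h \<otimes> inv g"]) auto
  moreover have "va h (va g v) \<in> vorb v" if "h \<in> carrier G" for h
    unfolding vorb_def using that g v by (intro image_eqI[of _ _ "h \<otimes> g"]) (auto simp: va_mult)
  ultimately show ?thesis unfolding vorb_def by blast
qed

lemma eorb_ea [simp]:
  assumes g: "g \<in> carrier G" and v: "v \<in> arcs T" shows "eorb (ea g v) = eorb v"
proof -
  have "ea h v \<in> eorb (ea g v)" if "h \<in> carrier G" for h
    unfolding eorb_def
    using that g v ea_mult[of h "inv g" "ea g v"] ea_inv_eq[of g "ea g v" v]
    by (intro image_eqI[of _ _ "h \<otimes> inv g"]) auto
  moreover have "ea h (ea g v) \<in> eorb v" if "h \<in> carrier G" for h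
    unfolding eorb_def using that g v by (intro image_eqI[of _ _ "h \<otimes> g"]) (auto simp: ea_mult)
  ultimately show ?thesis unfolding eorb_def by blast
qed

lemma vorb_eq: "w \<in> vorb v \<Longrightarrow> v \<in> verts T \<Longrightarrow> vorb w = vorb v"
  by (elim vorbE) auto

lemma eorb_eq: "w \<in> eorb v \<Longrightarrow> v \<in> arcs T \<Longrightarrow> eorb w = eorb v"
  by (elim eorbE) auto

text \<open>The action commutes with \<open>tail T\<close>, \<open>head T\<close> and
  \<open>arev T\<close>, so the images of an arc orbit under these maps are again orbits and no
  representatives have to be chosen. An arc orbit containing the reverse of one of its members
  becomes a self-reverse arc.\<close>

definition B :: "('v set, 'e set) rgraph" where
  "B = \<lparr>verts = vorb ` verts T, arcs = eorb ` arcs T,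
        tail = (\<lambda>X. tail T ` X), head = (\<lambda>X. head T ` X), arev = (\<lambda>X. arev T ` X)\<rparr>"

lemma B_simps [simp]:
  "verts B = vorb ` verts T" "arcs B = eorb ` arcs T"
  by (simp_all add: B_def)

lemma B_eorb [simp]:
  assumes "e \<in> arcs T"
  shows "head B (eorb e) = vorb (head T e)" "tail B (eorb e) = vorb (tail T e)"
    "arev B (eorb e) = eorb (arev T e)"
  using assms by (auto simp: B_def eorb_def vorb_def image_image head_ea tail_ea arev_ea)

lemma B_rev: "rev_graph B"
  by (rule rev_graphI) (use T in auto)

lemma B_connected: "connected_graph B"
  unfolding connected_graph_iff
proof (intro conjI allI impI)
  show "verts B \<noteq> {}" using tree by (auto simp: tree_graph_def connected_graph_iff)
next
  fix C r assume "r \<in> verts B" "r \<in> C" and C: "\<forall>a\<in>arcs B. tail B a \<in> C \<longrightarrow> head B a \<in> C"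
  then obtain r' where r: "r' \<in> verts T" "vorb r' \<in> C" by auto
  have "vorb v \<in> C" if "v \<in> verts T" for v
  proof (rule connected_graph_induct[where P="\<lambda>v. vorb v \<in> C", OF _ r(1) that])
    show "connected_graph T" using tree by (simp add: tree_graph_def)
  qed (use r C in auto)
  then show "verts B \<subseteq> C" by auto
qed (rule B_rev)

end

text \<open>All choices made in the construction, gathered so that the later arguments can treat
  them as fixed. The maps \<open>vr\<close> and \<open>er\<close> pick orbit representatives,
  \<open>k\<close> connects the head of a representing arc with the representing vertex, and
  \<open>\<tau>\<close> reverses a representing arc where this is possible; these enter the graph of
  group actions. The maps \<open>m\<close> and \<open>n\<close> lead from vertices and edges to
  representatives and give the colouring of the standard scaffolding. Arc colours must agree on an
  arc and its reverse, so \<open>n\<close> is the same for both; for this reason it can only be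
  asked to carry \<open>e\<close> to the representing arc or to its reverse.\<close>

locale tree_action_reps = tree_action G T \<rho>
  for G :: "'g monoid" (structure) and T :: "('v, 'e) rgraph" and \<rho> +
  fixes vr :: "'v set \<Rightarrow> 'v" and er :: "'e set \<Rightarrow> 'e"
    and k \<tau> :: "'e set \<Rightarrow> 'g" and m :: "'v \<Rightarrow> 'g" and n :: "'e \<Rightarrow> 'g"
  assumes vr: "v \<in> verts T \<Longrightarrow> vr (vorb v) \<in> vorb v"
    and er: "e \<in> arcs T \<Longrightarrow> er (eorb e) \<in> eorb e"
    and er_arev: "e \<in> arcs T \<Longrightarrow> eorb (arev T e) \<noteq> eorb e \<Longrightarrow> er (eorb (arev T e)) = arev T (er (eorb e))"
    and k: "e \<in> arcs T \<Longrightarrow> k (eorb e) \<in> carrier G"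
      "e \<in> arcs T \<Longrightarrow> va (k (eorb e)) (head T (er (eorb e))) = vr (vorb (head T e))"
    and \<tau>: "e \<in> arcs T \<Longrightarrow> eorb (arev T e) = eorb e \<Longrightarrow> \<tau> (eorb e) \<in> carrier G"
      "e \<in> arcs T \<Longrightarrow> eorb (arev T e) = eorb e \<Longrightarrow> ea (\<tau> (eorb e)) (er (eorb e)) = arev T (er (eorb e))"
    and m: "v \<in> verts T \<Longrightarrow> m v \<in> carrier G" "v \<in> verts T \<Longrightarrow> va (m v) v = vr (vorb v)"
    and n: "e \<in> arcs T \<Longrightarrow> n e \<in> carrier G" "e \<in> arcs T \<Longrightarrow> n (arev T e) = n e"
      "e \<in> arcs T \<Longrightarrow> ea (n e) e \<in> {er (eorb e), arev T (er (eorb e))}"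
begin

section \<open>Stabilisers and the data of the graph of group actions\<close>

definition est :: "'e \<Rightarrow> 'g set" where "est e = {g \<in> carrier G. ea g e = e}"
definition vst :: "'v \<Rightarrow> 'g set" where "vst v = {g \<in> carrier G. va g v = v}"
definition ed :: "'e set \<Rightarrow> 'e set" where "ed a = {er a, arev T (er a)}"
text \<open>
  \<open>E a\<close> is the setwise stabiliser of the edge of \<open>er a\<close>. It is used in place of the arc stabiliser
  because, when the edge is inverted, the inversion agent has to permute the arc colours.
\<close>

definition E :: "'e set \<Rightarrow> 'g set" where "E a = {x \<in> carrier G. ea x (er a) \<in> ed a}"

text \<open>The first component of a vertex colour is always \<open>None\<close>, so these are the
  left translations of \<open>G\<close>, restricted to be extensional.\<close>

definition lv :: "'g \<Rightarrow> 'e option \<times> 'g \<Rightarrow> 'e option \<times> 'g" where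
  "lv g = (\<lambda>p\<in>{None} \<times> carrier G. (fst p, g \<otimes> snd p))"

definition le :: "'g set \<Rightarrow> 'g \<Rightarrow> 'g \<Rightarrow> 'g" where
  "le D g = (\<lambda>y\<in>D. g \<otimes> y)"

definition \<G> :: "('v set, 'e set, 'e option \<times> 'g, 'g) gga_data" where
  "\<G> = \<lparr>base = B, vset = (\<lambda>X. {None} \<times> carrier G), vgrp = (\<lambda>X. lv ` vst (vr X)),
         aset = E, agrp = (\<lambda>a. le (E a) ` est (er a)), aemb = (\<lambda>a y. (None, k a \<otimes> y)),
         inv_agent = (\<lambda>a. le (E a) (\<tau> a))\<rparr>"

lemma \<G>_simps [simp]:
  "base \<G> = B" "vset \<G> X = {None} \<times> carrier G" "vgrp \<G> X = lv ` vst (vr X)"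
  "aset \<G> a = E a" "agrp \<G> a = le (E a) ` est (er a)" "aemb \<G> a y = (None, k a \<otimes> y)"
  "inv_agent \<G> a = le (E a) (\<tau> a)"
  by (simp_all add: \<G>_def)

lemma er_arc [simp]: "e \<in> arcs T \<Longrightarrow> er (eorb e) \<in> arcs T"
  using er eorbE by metis

lemma eorb_er [simp]: "e \<in> arcs T \<Longrightarrow> eorb (er (eorb e)) = eorb e"
  using er eorb_eq by metis

lemma vr_vert [simp]: "v \<in> verts T \<Longrightarrow> vr (vorb v) \<in> verts T"
  using vr vorbE by metis

lemma vst_subgroup: "v \<in> verts T \<Longrightarrow> subgroup (vst v) G"
  by (rule subgroupI) (auto simp: vst_def va_mult va_inv_eq intro: exI[of _ \<one>])

lemma est_subgroup: "e \<in> arcs T \<Longrightarrow> subgroup (est e) G"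
  by (rule subgroupI) (auto simp: est_def ea_mult ea_inv_eq intro: exI[of _ \<one>])

lemma est_arev: "e \<in> arcs T \<Longrightarrow> est (arev T e) = est e"
  unfolding est_def using T arev_ea by (metis (lifting))

lemma ed_arcs: "e \<in> arcs T \<Longrightarrow> ed (eorb e) \<subseteq> arcs T"
  by (auto simp: ed_def T)

lemma E_carrier: "E a \<subseteq> carrier G"
  by (auto simp: E_def)

text \<open>Testing one arc of the edge is enough because the action commutes with reversal.\<close>

lemma E_iff: "e \<in> arcs T \<Longrightarrow> x \<in> E (eorb e) \<longleftrightarrow> x \<in> carrier G \<and> ea x ` ed (eorb e) = ed (eorb e)"
  using T by (auto simp: E_def ed_def arev_ea[symmetric])

lemma E_subgroup:
  assumes e: "e \<in> arcs T" shows "subgroup (E (eorb e)) G"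
proof (rule subgroupI)
  have one: "\<one> \<in> E (eorb e)" using e by (auto simp: E_def ed_def)
  then show "E (eorb e) \<noteq> {}" by auto
  fix x assume x: "x \<in> E (eorb e)"
  then have xc: "x \<in> carrier G" and xi: "ea x ` ed (eorb e) = ed (eorb e)" using E_iff[OF e] by auto
  have "ea (inv x) z \<in> ed (eorb e)" if z: "z \<in> ed (eorb e)" for z
  proof -
    obtain y where y: "y \<in> ed (eorb e)" "z = ea x y" using xi z by blast
    then have "ea (inv x) z = y" using ea_inv_eq[OF xc, of z y] ed_arcs[OF e] xc by auto
    then show ?thesis using y by simp
  qed
  then show "inv x \<in> E (eorb e)" using xc by (auto simp: E_def ed_def)
  fix y assume y: "y \<in> E (eorb e)"
  then have yc: "y \<in> carrier G" and yi: "ea y ` ed (eorb e) = ed (eorb e)" using E_iff[OF e] by auto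
  have "ea x (ea y z) \<in> ed (eorb e)" if "z \<in> ed (eorb e)" for z
    using xi yi that by blast
  then show "x \<otimes> y \<in> E (eorb e)" using xc yc e by (auto simp: E_def ea_mult ed_def)
qed (rule E_carrier)

lemma est_E: "est (er a) \<subseteq> E a"
  by (auto simp: est_def E_def ed_def)

lemma ed_arev: "e \<in> arcs T \<Longrightarrow> ed (eorb (arev T e)) = ed (eorb e)"
  using er_arev[of e] by (cases "eorb (arev T e) = eorb e") (auto simp: ed_def T)

lemma E_arev: "e \<in> arcs T \<Longrightarrow> E (eorb (arev T e)) = E (eorb e)"
  using T by (auto simp: E_iff ed_arev)

lemma est_er_arev: "e \<in> arcs T \<Longrightarrow> est (er (eorb (arev T e))) = est (er (eorb e))"
  using er_arev[of e] est_arev[of "er (eorb e)"] by (cases "eorb (arev T e) = eorb e") auto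

lemma \<tau>_E: "e \<in> arcs T \<Longrightarrow> eorb (arev T e) = eorb e \<Longrightarrow> \<tau> (eorb e) \<in> E (eorb e)"
  using \<tau> by (auto simp: E_def ed_def)

section \<open>Translations as permutations, and the axioms of a graph of group actions\<close>

lemma lv_hom: "lv \<in> hom G (BijGroup ({None} \<times> carrier G))"
proof -
  have mult: "lv (g \<otimes> h) = compose ({None} \<times> carrier G) (lv g) (lv h)"
    if "g \<in> carrier G" "h \<in> carrier G" for g h
    using that by (auto simp: lv_def compose_def m_assoc intro!: restrict_ext)
  have "lv g \<in> Bij ({None} \<times> carrier G)" if g: "g \<in> carrier G" for g
  proof -
    have "bij_betw (lv g) ({None} \<times> carrier G) ({None} \<times> carrier G)"
      by (rule bij_betw_byWitness[where f'="lv (inv g)"])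
        (use g in \<open>auto simp: lv_def m_assoc[symmetric]\<close>)
    then show ?thesis by (auto simp: Bij_def lv_def)
  qed
  then show ?thesis using mult by (auto intro!: homI simp: BijGroup_def)
qed

lemma le_hom:
  assumes D: "subgroup D G"
  shows "le D \<in> hom (G\<lparr>carrier := D\<rparr>) (BijGroup D)"
proof -
  note Dm = subgroup.m_closed[OF D] subgroup.m_inv_closed[OF D] subgroup.mem_carrier[OF D]
  have mult: "le D (g \<otimes> h) = compose D (le D g) (le D h)" if "g \<in> D" "h \<in> D" for g h
    using that Dm by (auto simp: le_def compose_def m_assoc intro!: restrict_ext)
  have "le D g \<in> Bij D" if g: "g \<in> D" for g
  proof -
    have "bij_betw (le D g) D D"
      by (rule bij_betw_byWitness[where f'="le D (inv g)"])
        (use g Dm in \<open>auto simp: le_def m_assoc[symmetric]\<close>)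
    then show ?thesis by (auto simp: Bij_def le_def)
  qed
  then show ?thesis using mult by (auto intro!: homI simp: BijGroup_def)
qed

lemma vgrp_perm: "v \<in> verts T \<Longrightarrow> perm_group (lv ` vst (vr (vorb v))) ({None} \<times> carrier G)"
proof -
  assume "v \<in> verts T"
  interpret l: group_hom G "BijGroup ({None} \<times> carrier G)" lv
    using lv_hom group_BijGroup is_group by (simp add: group_hom_def group_hom_axioms_def)
  show ?thesis unfolding perm_group_def
    using l.subgroup_img_is_subgroup[OF vst_subgroup] \<open>v \<in> verts T\<close> by auto
qed

lemma agrp_perm:
  assumes e: "e \<in> arcs T"
  shows "perm_group (le (E (eorb e)) ` est (er (eorb e))) (E (eorb e))"
proof -
  let ?E = "E (eorb e)"
  interpret l: group_hom "G\<lparr>carrier := ?E\<rparr>" "BijGroup ?E" "le ?E"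
    using le_hom[OF E_subgroup[OF e]] group_BijGroup subgroup_imp_group[OF E_subgroup[OF e]]
    by (simp add: group_hom_def group_hom_axioms_def)
  have "subgroup (est (er (eorb e))) (G\<lparr>carrier := ?E\<rparr>)"
    using e by (intro subgroup_incl E_subgroup est_subgroup est_E) auto
  then show ?thesis unfolding perm_group_def
    using l.subgroup_img_is_subgroup subgroup.one_closed[OF E_subgroup[OF e]] by auto
qed

text \<open>Conjugating by \<open>y \<mapsto> k y\<close> turns translation by \<open>h\<close> into
  translation by \<open>k h k^-1\<close>, which fixes the representing vertex if \<open>h\<close>
  fixes the representing arc. Conversely, an element of the vertex group preserving the coset
  \<open>k E\<close> has the form \<open>k h k^-1\<close>, where \<open>h\<close> preserves the edge
  and fixes the head of the representing arc. The two arcs of an edge have different heads, so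
  \<open>h\<close> fixes the arc, although \<open>E\<close> may also contain inversions.\<close>

lemma aemb_embedding:
  assumes e: "e \<in> arcs T"
  shows "perm_embedding (aemb \<G> (eorb e)) (le (E (eorb e)) ` est (er (eorb e))) (E (eorb e))
    (lv ` vst (vr (vorb (head T e)))) ({None} \<times> carrier G)"
proof -
  let ?a = "eorb e" and ?E = "E (eorb e)" and ?H = "est (er (eorb e))" and ?k = "k (eorb e)"
  let ?P = "aemb \<G> (eorb e)" let ?w = "vr (vorb (head T e))"
  note kc = k(1)[OF e]
  note Es = E_subgroup[OF e]
  note Em = subgroup.m_closed[OF Es] subgroup.m_inv_closed[OF Es] subgroup.mem_carrier[OF Es]
    subgroup.one_closed[OF Es]
  have inj: "inj_on ?P ?E" using kc Em(3) by (auto intro!: inj_onI)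
  have HE: "?H \<subseteq> ?E" by (rule est_E)
  define c where "c h = ?k \<otimes> h \<otimes> inv ?k" for h
  have c_vst: "c h \<in> vst ?w" if "h \<in> ?H" for h
  proof -
    have hc: "h \<in> carrier G" "ea h (er ?a) = er ?a" using that by (auto simp: est_def)
    have "va h (head T (er ?a)) = head T (er ?a)" using hc head_ea[of h "er ?a"] e by simp
    moreover have "va (inv ?k) ?w = head T (er ?a)"
      using va_inv_eq[OF kc, of ?w "head T (er ?a)"] k(2)[OF e] e T by simp
    ultimately show ?thesis using hc kc k(2)[OF e] e T by (simp add: vst_def c_def va_mult)
  qed
  have conj: "conj_perm ?P ?E (le ?E h) = restrict (lv (c h)) (?P ` ?E)" if h: "h \<in> ?H" for h
  proof (rule ext)
    fix x
    show "conj_perm ?P ?E (le ?E h) x = restrict (lv (c h)) (?P ` ?E) x"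
    proof (cases "x \<in> ?P ` ?E")
      case True
      then obtain y where y: "y \<in> ?E" "x = ?P y" by auto
      then have "inv_into ?E ?P x = y" using inv_into_f_f[OF inj] by (simp only:)
      then have "conj_perm ?P ?E (le ?E h) x = (None, ?k \<otimes> (h \<otimes> y))"
        using True y(1) by (simp add: conj_perm_def le_def)
      moreover have yh: "y \<in> carrier G" "h \<in> carrier G" using y(1) h Em(3) by (auto simp: est_def)
      then have "c h \<otimes> (?k \<otimes> y) = ?k \<otimes> (h \<otimes> (inv ?k \<otimes> ?k \<otimes> y))"
        using kc unfolding c_def by (simp only: m_assoc m_closed inv_closed)
      then have "c h \<otimes> (?k \<otimes> y) = ?k \<otimes> (h \<otimes> y)" using kc yh by simp
      ultimately show ?thesis using True y kc yh by (simp add: lv_def)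
    qed (simp add: conj_perm_def)
  qed
  have le_Bij: "le ?E h \<in> Bij ?E" if "h \<in> ?H" for h
    using hom_in_carrier[OF le_hom[OF Es], of h] HE that by (auto simp: BijGroup_def)
  have induced: "induced_perms (lv ` vst ?w) (?P ` ?E) = (\<lambda>h. conj_perm ?P ?E (le ?E h)) ` ?H"
  proof (intro equalityI subsetI)
    fix s assume "s \<in> induced_perms (lv ` vst ?w) (?P ` ?E)"
    then obtain g where g: "g \<in> vst ?w" "lv g ` ?P ` ?E = ?P ` ?E" "s = restrict (lv g) (?P ` ?E)"
      by (auto simp: induced_perms_def)
    have gc: "g \<in> carrier G" using g by (simp add: vst_def)
    define h where "h = inv ?k \<otimes> g \<otimes> ?k"
    have hc: "h \<in> carrier G" using gc kc by (simp add: h_def)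
    have g_eq: "g = c h" using gc kc by (simp add: h_def c_def m_assoc inv_solve_left)
        (simp add: m_assoc[symmetric])
    \<comment> \<open>Evaluating at the colour of the neutral element gives
      \<open>g k \<in> k E\<close>, that is, \<open>h \<in> E\<close>.\<close>
    have "lv g (?P \<one>) \<in> ?P ` ?E" using g(2) Em(4) by blast
    then obtain y where y: "y \<in> ?E" "g \<otimes> ?k = ?k \<otimes> y" using gc kc by (auto simp: lv_def)
    then have "h = y" using gc kc Em(3)[OF y(1)] by (simp add: h_def m_assoc) (simp add: m_assoc[symmetric])
    then have hE: "h \<in> ?E" using y by simp
    have "va h (head T (er ?a)) = head T (er ?a)"
      using gc kc g(1) e T k(2)[OF e] va_inv_eq[OF kc, of ?w "head T (er ?a)"]
      by (simp add: h_def va_mult vst_def)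
    then have "head T (ea h (er ?a)) = head T (er ?a)" using hc e by (simp add: head_ea)
    moreover have "ea h (er ?a) \<in> {er ?a, arev T (er ?a)}" using hE by (simp add: E_def ed_def)
    moreover have "head T (arev T (er ?a)) \<noteq> head T (er ?a)"
      using tree_graph_loopfree[OF tree] T e by simp
    ultimately have "h \<in> ?H" using hc by (auto simp: est_def)
    then show "s \<in> (\<lambda>h. conj_perm ?P ?E (le ?E h)) ` ?H"
      using conj g g_eq by auto
  next
    fix s assume "s \<in> (\<lambda>h. conj_perm ?P ?E (le ?E h)) ` ?H"
    then obtain h where h: "h \<in> ?H" "s = conj_perm ?P ?E (le ?E h)" by auto
    have "restrict (lv (c h)) (?P ` ?E) ` (?P ` ?E) = ?P ` ?E"
    proof -
      have "conj_perm ?P ?E (le ?E h) ` (?P ` ?E) = ?P ` (le ?E h) ` ?E"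
        using inj by (simp add: conj_perm_def image_image del: \<G>_simps)
      then show ?thesis using conj[OF h(1)] BijD(3)[OF le_Bij[OF h(1)]] by simp
    qed
    then show "s \<in> induced_perms (lv ` vst ?w) (?P ` ?E)"
      using c_vst[OF h(1)] conj[OF h(1)] h(2) unfolding induced_perms_def by auto
  qed
  have conj_inj: "inj_on (conj_perm ?P ?E) (le ?E ` ?H)"
  proof (rule inj_onI)
    fix s t assume st: "s \<in> le ?E ` ?H" "t \<in> le ?E ` ?H" "conj_perm ?P ?E s = conj_perm ?P ?E t"
    then have B: "s \<in> Bij ?E" "t \<in> Bij ?E" using le_Bij by auto
    show "s = t"
    proof (rule extensionalityI[of _ ?E])
      fix x assume x: "x \<in> ?E"
      then have "?P (s x) = ?P (t x)"
        using fun_cong[OF st(3), of "?P x"] inj by (simp add: conj_perm_def del: \<G>_simps)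
      then show "s x = t x" using inj x BijD(1) B by (metis inj_onD)
    qed (use B BijD(4) in auto)
  qed
  have conj_mult: "conj_perm ?P ?E (compose ?E s t) =
      compose (?P ` ?E) (conj_perm ?P ?E s) (conj_perm ?P ?E t)"
    if "s \<in> Bij ?E" "t \<in> Bij ?E" for s t
    using inj BijD(1)[OF that(2)]
    by (auto simp: conj_perm_def compose_def simp del: \<G>_simps intro!: restrict_ext)
  have conj_Bij: "conj_perm ?P ?E s \<in> Bij (?P ` ?E)" if s: "s \<in> Bij ?E" for s
  proof -
    have "bij_betw (conj_perm ?P ?E s) (?P ` ?E) (?P ` ?E)"
      unfolding bij_betw_def
    proof
      show "inj_on (conj_perm ?P ?E s) (?P ` ?E)"
      proof (rule inj_onI)
        fix x y assume xy: "x \<in> ?P ` ?E" "y \<in> ?P ` ?E" "conj_perm ?P ?E s x = conj_perm ?P ?E s y"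
        then obtain x' y' where x': "x' \<in> ?E" "y' \<in> ?E" "x = ?P x'" "y = ?P y'" by blast
        then have "?P (s x') = ?P (s y')" using xy inj by (simp add: conj_perm_def del: \<G>_simps)
        then have "x' = y'" using x' BijD(1,2)[OF s] inj by (metis inj_onD)
        then show "x = y" using x' by simp
      qed
      have "conj_perm ?P ?E s ` (?P ` ?E) = ?P ` s ` ?E"
        using inj by (simp add: conj_perm_def image_image del: \<G>_simps)
      then show "conj_perm ?P ?E s ` (?P ` ?E) = ?P ` ?E" using BijD(3)[OF s] by simp
    qed
    then show ?thesis by (simp add: Bij_def conj_perm_def)
  qed
  have "conj_perm ?P ?E \<in> iso ((BijGroup ?E)\<lparr>carrier := le ?E ` ?H\<rparr>)
      ((BijGroup (?P ` ?E))\<lparr>carrier := induced_perms (lv ` vst ?w) (?P ` ?E)\<rparr>)"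
    unfolding iso_def
  proof (intro CollectI conjI)
    show "conj_perm ?P ?E \<in> hom ((BijGroup ?E)\<lparr>carrier := le ?E ` ?H\<rparr>)
      ((BijGroup (?P ` ?E))\<lparr>carrier := induced_perms (lv ` vst ?w) (?P ` ?E)\<rparr>)"
      using le_Bij conj_mult conj_Bij by (intro homI) (auto simp: induced BijGroup_def simp del: \<G>_simps)
    show "bij_betw (conj_perm ?P ?E) (carrier ((BijGroup ?E)\<lparr>carrier := le ?E ` ?H\<rparr>))
      (carrier ((BijGroup (?P ` ?E))\<lparr>carrier := induced_perms (lv ` vst ?w) (?P ` ?E)\<rparr>))"
      using conj_inj by (simp add: bij_betw_def induced image_image del: \<G>_simps)
  qed
  moreover have "?P \<in> ?E \<rightarrow> {None} \<times> carrier G" using kc Em(3) by auto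
  ultimately show ?thesis unfolding perm_embedding_def using inj by blast
qed

text \<open>The element \<open>\<tau>\<close> swaps the two arcs of the edge, so its square fixes
  them. Conjugation by it preserves the arc stabiliser since an element fixing an arc fixes the
  reverse as well. The homomorphism \<open>le\<close> carries these facts from \<open>G\<close> to
  permutations.\<close>

lemma inv_agent_ok:
  assumes e: "e \<in> arcs T" and selfrev: "eorb (arev T e) = eorb e"
  defines "S \<equiv> BijGroup (E (eorb e))" and "h \<equiv> le (E (eorb e)) (\<tau> (eorb e))"
  shows "h \<in> carrier S"
    "(\<lambda>k. h \<otimes>\<^bsub>S\<^esub> k \<otimes>\<^bsub>S\<^esub> inv\<^bsub>S\<^esub> h) ` le (E (eorb e)) ` est (er (eorb e)) = le (E (eorb e)) ` est (er (eorb e))"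
    "h \<otimes>\<^bsub>S\<^esub> h \<in> le (E (eorb e)) ` est (er (eorb e))"
proof -
  let ?E = "E (eorb e)" and ?e = "er (eorb e)" and ?t = "\<tau> (eorb e)"
  note Es = E_subgroup[OF e]
  interpret l: group_hom "G\<lparr>carrier := ?E\<rparr>" S "le ?E"
    using le_hom[OF Es] group_BijGroup subgroup_imp_group[OF Es]
    by (simp add: group_hom_def group_hom_axioms_def S_def)
  note tE = \<tau>_E[OF e selfrev] and t = \<tau>[OF e selfrev]
  have t': "ea ?t (arev T ?e) = ?e"
    using t e T arev_ea[of ?t ?e] by simp
  show "h \<in> carrier S" using l.hom_closed tE by (simp add: h_def)
  have hH: "x \<in> ?E" if "x \<in> est ?e" for x using that est_E by blast
  have "h \<otimes>\<^bsub>S\<^esub> h = le ?E (?t \<otimes> ?t)" using l.hom_mult[of ?t ?t] tE by (simp add: h_def)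
  moreover have "?t \<otimes> ?t \<in> est ?e" using t t' e by (simp add: est_def ea_mult)
  ultimately show "h \<otimes>\<^bsub>S\<^esub> h \<in> le ?E ` est ?e" by simp
  define c where "c x = ?t \<otimes> x \<otimes> inv ?t" for x
  have ti: "inv ?t \<in> ?E" using Es tE by (rule subgroup.m_inv_closed)
  have tie: "ea (inv ?t) ?e = arev T ?e" "ea (inv ?t) (arev T ?e) = ?e"
    using t t' e T by (simp_all add: ea_inv_eq)
  have conj: "h \<otimes>\<^bsub>S\<^esub> le ?E x \<otimes>\<^bsub>S\<^esub> inv\<^bsub>S\<^esub> h = le ?E (c x)" if "x \<in> est ?e" for x
  proof -
    have "inv\<^bsub>S\<^esub> h = le ?E (inv ?t)"
      using l.hom_inv[of ?t] tE m_inv_consistent[OF Es tE] by (simp add: h_def)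
    then show ?thesis
      using l.hom_mult[of "?t" x] l.hom_mult[of "?t \<otimes> x" "inv ?t"] hH[OF that] tE ti
        subgroup.m_closed[OF Es tE hH[OF that]]
      by (simp add: h_def c_def)
  qed
  have cH: "c ` est ?e = est ?e"
  proof (intro equalityI subsetI)
    fix y assume "y \<in> c ` est ?e"
    then obtain x where x: "x \<in> carrier G" "ea x ?e = ?e" "y = c x" by (auto simp: est_def)
    then have "ea x (arev T ?e) = arev T ?e" using e by (simp add: arev_ea[symmetric])
    then show "y \<in> est ?e" using x t tie t' e T by (simp add: c_def est_def ea_mult)
  next
    fix y assume y: "y \<in> est ?e"
    then have yc: "y \<in> carrier G" by (simp add: est_def)
    have "ea y (arev T ?e) = arev T ?e" using y e by (simp add: est_def arev_ea[symmetric])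
    then have "inv ?t \<otimes> y \<otimes> ?t \<in> est ?e" using yc t tie t' e T by (simp add: est_def ea_mult)
    moreover have "c (inv ?t \<otimes> y \<otimes> ?t) = y"
      using yc t(1) by (simp add: c_def m_assoc) (simp add: m_assoc[symmetric])
    ultimately show "y \<in> c ` est ?e" by force
  qed
  have "(\<lambda>k. h \<otimes>\<^bsub>S\<^esub> k \<otimes>\<^bsub>S\<^esub> inv\<^bsub>S\<^esub> h) ` le ?E ` est ?e = le ?E ` c ` est ?e"
    unfolding image_image using conj by (intro image_cong) auto
  then show "(\<lambda>k. h \<otimes>\<^bsub>S\<^esub> k \<otimes>\<^bsub>S\<^esub> inv\<^bsub>S\<^esub> h) ` le ?E ` est ?e = le ?E ` est ?e"
    using cH by simp
qed

lemma \<G>_is_gga: "is_gga \<G>"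
  unfolding is_gga_def
proof (intro conjI ballI)
  show "connected_graph (base \<G>)" using B_connected by simp
  show "perm_group (vgrp \<G> v) (vset \<G> v)" if "v \<in> verts (base \<G>)" for v
    using that vgrp_perm by auto
  fix a assume "a \<in> arcs (base \<G>)"
  then obtain e where e: "e \<in> arcs T" "a = eorb e" by auto
  show "perm_group (agrp \<G> a) (aset \<G> a)" using e agrp_perm by simp
  show "agrp \<G> (arev (base \<G>) a) = agrp \<G> a" "aset \<G> (arev (base \<G>) a) = aset \<G> a"
    using e by (simp_all add: E_arev est_er_arev)
  show "perm_embedding (aemb \<G> a) (agrp \<G> a) (aset \<G> a)
          (vgrp \<G> (head (base \<G>) a)) (vset \<G> (head (base \<G>) a))"
    using aemb_embedding[OF e(1)] e by simp
  show "arev (base \<G>) a = a \<longrightarrow>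
           (let S = BijGroup (aset \<G> a); h = inv_agent \<G> a in
              h \<in> carrier S \<and>
              (\<lambda>k. h \<otimes>\<^bsub>S\<^esub> k \<otimes>\<^bsub>S\<^esub> inv\<^bsub>S\<^esub> h) ` agrp \<G> a = agrp \<G> a \<and>
              h \<otimes>\<^bsub>S\<^esub> h \<in> agrp \<G> a)"
    using inv_agent_ok[OF e(1)] e by (simp add: Let_def)
qed

text \<open>
  Every adhesion map of \<open>\<G>\<close>, twisted or not, is a left translation by some \<open>x\<close>; which of the
  two it is depends on whether \<open>x\<close> carries the head of the representing arc or the head of its
  reverse to the representing vertex.
\<close>

definition tr :: "'e set \<Rightarrow> 'g \<Rightarrow> 'g \<Rightarrow> 'e option \<times> 'g" where
  "tr a x = (\<lambda>y\<in>E a. (None, x \<otimes> y))"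

text \<open>The translations that occur are by \<open>g k\<close> with \<open>g\<close> in the
  stabiliser of the representing vertex. These are all elements carrying the head of the
  representing arc to that vertex, because any two such elements differ by an element of the
  stabiliser.\<close>

lemma adhesion_maps_eq:
  assumes e: "e \<in> arcs T"
  shows "adhesion_maps \<G> (eorb e) =
    {tr (eorb e) x | x. x \<in> carrier G \<and> va x (head T (er (eorb e))) = vr (vorb (head T e))}"
proof -
  let ?a = "eorb e" and ?k = "k (eorb e)" and ?w = "vr (vorb (head T e))" and ?v = "head T (er (eorb e))"
  note kc = k(1)[OF e]
  have v: "?v \<in> verts T" "?w \<in> verts T" using e T by auto
  have kw: "va (inv ?k) ?w = ?v" using va_inv_eq[OF kc v(2,1)] k(2)[OF e] by simp
  have eq: "compose (E ?a) (lv g) (aemb \<G> ?a) = tr ?a (g \<otimes> ?k)" if "g \<in> carrier G" for g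
    using that kc E_carrier[of ?a]
    by (auto simp: compose_def lv_def tr_def m_assoc intro!: restrict_ext)
  have "tr ?a x \<in> adhesion_maps \<G> ?a" if x: "x \<in> carrier G" "va x ?v = ?w" for x
  proof -
    have "x \<otimes> inv ?k \<in> vst ?w" using x kc kw v by (simp add: vst_def va_mult)
    moreover have "tr ?a x = compose (E ?a) (lv (x \<otimes> inv ?k)) (aemb \<G> ?a)"
      using eq[of "x \<otimes> inv ?k"] x kc by (simp add: m_assoc)
    ultimately show ?thesis using e by (auto simp: adhesion_maps_def)
  qed
  moreover have "\<exists>x. x \<in> carrier G \<and> va x ?v = ?w \<and> \<psi> = tr ?a x" if \<psi>: "\<psi> \<in> adhesion_maps \<G> ?a" for \<psi>
  proof -
    obtain g where g: "g \<in> vst ?w" "\<psi> = compose (E ?a) (lv g) (aemb \<G> ?a)"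
      using \<psi> e by (auto simp: adhesion_maps_def)
    then show ?thesis using eq[of g] kc v k(2)[OF e]
      by (intro exI[of _ "g \<otimes> ?k"]) (auto simp: vst_def va_mult)
  qed
  ultimately show ?thesis by blast
qed

text \<open>The twist multiplies by \<open>\<tau>\<close> from the right, and \<open>\<tau>\<close>
  exchanges the two ends of the representing edge; so the other end takes over the role of the
  head.\<close>

lemma twisted_adhesion_maps_eq:
  assumes e: "e \<in> arcs T" and selfrev: "eorb (arev T e) = eorb e"
  shows "twisted_adhesion_maps \<G> (eorb e) =
    {tr (eorb e) x | x. x \<in> carrier G \<and> va x (head T (arev T (er (eorb e)))) = vr (vorb (head T e))}"
proof -
  let ?a = "eorb e" and ?k = "k (eorb e)" and ?w = "vr (vorb (head T e))" and ?v = "head T (er (eorb e))"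
  let ?t = "\<tau> ?a" and ?v' = "head T (arev T (er (eorb e)))"
  note kc = k(1)[OF e]
  note tE = \<tau>_E[OF e selfrev] and t = \<tau>[OF e selfrev]
  have v: "?v \<in> verts T" "?w \<in> verts T" "?v' \<in> verts T" using e T by auto
  have kw: "va (inv ?k) ?w = ?v" using va_inv_eq[OF kc v(2,1)] k(2)[OF e] by simp
  have tv: "va ?t ?v = ?v'" using t e head_ea[of ?t "er ?a"] by simp
  have tv': "va ?t ?v' = ?v" using t e T head_ea[of ?t "arev T (er ?a)"] arev_ea[of ?t "er ?a"] by simp
  have tiv: "va (inv ?t) ?v = ?v'" using va_inv_eq[OF t(1) v(1,3)] tv' by simp
  have tm: "?t \<otimes> y \<in> E ?a" if "y \<in> E ?a" for y
    using that tE subgroup.m_closed[OF E_subgroup[OF e]] by simp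
  have eq: "compose (E ?a) (lv g) (compose (E ?a) (aemb \<G> ?a) (inv_agent \<G> ?a)) = tr ?a (g \<otimes> ?k \<otimes> ?t)"
    if "g \<in> carrier G" for g
    using that kc t(1) E_carrier[of ?a] tm
    by (auto simp: compose_def lv_def tr_def le_def m_assoc subset_iff intro!: restrict_ext)
  have "tr ?a x \<in> twisted_adhesion_maps \<G> ?a" if x: "x \<in> carrier G" "va x ?v' = ?w" for x
  proof -
    let ?g = "x \<otimes> inv ?t \<otimes> inv ?k"
    have "?g \<in> vst ?w" using x kc kw v t tiv by (simp add: vst_def va_mult)
    moreover have "?g \<otimes> ?k \<otimes> ?t = x" using x kc t by (simp add: m_assoc) 
    ultimately show ?thesis
      using e eq[of ?g] by (auto simp: twisted_adhesion_maps_def vst_def intro!: exI[of _ "lv ?g"])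
  qed
  moreover have "\<exists>x. x \<in> carrier G \<and> va x ?v' = ?w \<and> \<psi> = tr ?a x" if \<psi>: "\<psi> \<in> twisted_adhesion_maps \<G> ?a" for \<psi>
  proof -
    obtain g where g: "g \<in> vst ?w"
      "\<psi> = compose (E ?a) (lv g) (compose (E ?a) (aemb \<G> ?a) (inv_agent \<G> ?a))"
      using \<psi> e by (auto simp: twisted_adhesion_maps_def)
    then show ?thesis using eq[of g] kc v k(2)[OF e] t tv'
      by (intro exI[of _ "g \<otimes> ?k \<otimes> ?t"]) (auto simp: vst_def va_mult)
  qed
  ultimately show ?thesis by blast
qed

end

section \<open>The standard scaffolding\<close>

context tree_action_reps
begin

section \<open>Edges as cosets, and the standard graph\<close>

lemma edge_image:
  assumes e: "e \<in> arcs T" and x: "x \<in> carrier G" and y: "y \<in> ea x ` ed (eorb e)"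
  shows "ea x ` ed (eorb e) = {y, arev T y}"
  using assms by (auto simp: ed_def arev_ea T)

text \<open>The images are the left cosets \<open>x E\<close> and \<open>y E\<close>. They agree
  exactly if \<open>y^-1 x\<close> stabilises the representing edge, which is the orbit-stabiliser
  correspondence. All later comparisons of adhesion sets pass through this equivalence to a
  comparison of edges.\<close>

lemma tr_image_eq_iff:
  assumes e: "e \<in> arcs T" and x: "x \<in> carrier G" and y: "y \<in> carrier G"
  shows "tr (eorb e) x ` E (eorb e) = tr (eorb e) y ` E (eorb e) \<longleftrightarrow>
    ea x ` ed (eorb e) = ea y ` ed (eorb e)"
proof -
  let ?a = "eorb e"
  note Es = E_subgroup[OF e]
  have tr: "tr ?a z ` E ?a = Pair None ` (\<lambda>y. z \<otimes> y) ` E ?a" for z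
    by (auto simp: tr_def)
  have img: "ea (g \<otimes> h) ` ed ?a = ea g ` ea h ` ed ?a" if "g \<in> carrier G" "h \<in> carrier G" for g h
    unfolding image_image using that ed_arcs[OF e] by (intro image_cong) (auto simp: ea_mult)
  have *: "tr ?a x ` E ?a = tr ?a y ` E ?a \<longleftrightarrow> (\<lambda>z. x \<otimes> z) ` E ?a = (\<lambda>z. y \<otimes> z) ` E ?a"
    unfolding tr by (rule inj_image_eq_iff) (auto intro: injI)
  also have "\<dots> \<longleftrightarrow> ea x ` ed ?a = ea y ` ed ?a"
  proof
    assume eq: "(\<lambda>z. x \<otimes> z) ` E ?a = (\<lambda>z. y \<otimes> z) ` E ?a"
    have "x \<in> (\<lambda>z. x \<otimes> z) ` E ?a" using x subgroup.one_closed[OF Es] by (intro image_eqI[of _ _ \<one>]) auto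
    then obtain z where z: "z \<in> E ?a" "x = y \<otimes> z" unfolding eq by auto
    then show "ea x ` ed ?a = ea y ` ed ?a" using img[of y z] y E_iff[OF e, of z] by simp
  next
    assume eq: "ea x ` ed ?a = ea y ` ed ?a"
    have "ea \<one> ` ed ?a = (\<lambda>z. z) ` ed ?a" using ed_arcs[OF e] by (intro image_cong) auto
    then have "ea (inv y) ` ea y ` ed ?a = ed ?a" using img[of "inv y" y] y by simp
    then have z: "inv y \<otimes> x \<in> E ?a" using eq img[of "inv y" x] x y by (simp add: E_iff[OF e])
    then have z': "inv x \<otimes> y \<in> E ?a"
      using subgroup.m_inv_closed[OF Es z] x y by (simp add: inv_mult_group)
    have "x \<otimes> u = y \<otimes> ((inv y \<otimes> x) \<otimes> u)" "y \<otimes> u = x \<otimes> ((inv x \<otimes> y) \<otimes> u)" if "u \<in> E ?a" for u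
      using subgroup.mem_carrier[OF Es that] x y by (simp_all add: m_assoc[symmetric])
    then show "(\<lambda>z. x \<otimes> z) ` E ?a = (\<lambda>z. y \<otimes> z) ` E ?a"
      using subgroup.m_closed[OF Es z] subgroup.m_closed[OF Es z'] by (auto simp: image_iff) metis+
  qed
  finally show ?thesis .
qed

text \<open>The coset of the edge stabiliser that corresponds to the edge of \<open>e\<close>. It is
  the fibre over \<open>e\<close> of the arcs of the standard graph.\<close>

definition K :: "'e \<Rightarrow> 'g set" where
  "K e = {x \<in> carrier G. e \<in> ea x ` ed (eorb e)}"

text \<open>The \<open>G\<close>-component is constant along arcs, so the graph splits into layers,
  one for each \<open>x\<close>, and the arc \<open>e\<close> occurs in the layer of
  \<open>x\<close> precisely if \<open>x\<close> lies in the coset \<open>K e\<close>. It need not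
  be connected; only its quotient has to be.\<close>

definition std :: "('v \<times> 'e option \<times> 'g, 'e \<times> 'g) rgraph" where
  "std = \<lparr>verts = verts T \<times> {None} \<times> carrier G, arcs = {(e, x). e \<in> arcs T \<and> x \<in> K e},
          tail = (\<lambda>(e, x). (tail T e, None, x)), head = (\<lambda>(e, x). (head T e, None, x)),
          arev = (\<lambda>(e, x). (arev T e, x))\<rparr>"

lemma std_simps [simp]:
  "verts std = verts T \<times> {None} \<times> carrier G"
  "(e, x) \<in> arcs std \<longleftrightarrow> e \<in> arcs T \<and> x \<in> K e"
  "tail std (e, x) = (tail T e, None, x)" "head std (e, x) = (head T e, None, x)"
  "arev std (e, x) = (arev T e, x)"
  by (auto simp: std_def)

lemma K_carrier: "x \<in> K e \<Longrightarrow> x \<in> carrier G"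
  by (simp add: K_def)

lemma K_arev: "e \<in> arcs T \<Longrightarrow> K (arev T e) = K e"
proof -
  have "arev T f \<in> ea x ` ed (eorb (arev T f))"
    if "f \<in> arcs T" "x \<in> carrier G" "f \<in> ea x ` ed (eorb f)" for f x
    using edge_image[OF that] that by (simp add: ed_arev)
  from this[of e] this[of "arev T e"] show "e \<in> arcs T \<Longrightarrow> K (arev T e) = K e"
    using T by (auto simp: K_def)
qed

lemma std_rev: "rev_graph std"
  by (rule rev_graphI) (auto simp: T K_arev K_carrier)

text \<open>The diagonal action through which elements of \<open>G\<close> are realised in the
  universal group of any scaffolding.\<close>

definition std_act :: "'g \<Rightarrow> ('v \<times> 'e option \<times> 'g \<Rightarrow> 'v \<times> 'e option \<times> 'g) \<times> ('e \<times> 'g \<Rightarrow> 'e \<times> 'g)" where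
  "std_act g = (\<lambda>p\<in>verts std. (va g (fst p), None, g \<otimes> snd (snd p)), \<lambda>p\<in>arcs std. (ea g (fst p), g \<otimes> snd p))"

lemma K_ea:
  assumes "g \<in> carrier G" "e \<in> arcs T" "x \<in> K e" shows "g \<otimes> x \<in> K (ea g e)"
proof -
  obtain y where "y \<in> ed (eorb e)" "e = ea x y" "x \<in> carrier G" using assms by (auto simp: K_def)
  then show ?thesis using assms ed_arcs[of e] by (auto simp: K_def ea_mult intro!: image_eqI[of _ _ y])
qed

lemma std_act_aut:
  assumes g: "g \<in> carrier G" shows "std_act g \<in> carrier (graph_aut std)"
proof -
  have inv: "ea (inv g) (ea g e) = e" "ea g (ea (inv g) e) = e" if "e \<in> arcs T" for e
    using that g ea_inv_eq[of g "ea g e" e] ea_inv_eq[of g e "ea (inv g) e"] by auto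
  have inv': "va (inv g) (va g e) = e" "va g (va (inv g) e) = e" if "e \<in> verts T" for e
    using that g va_inv_eq[of g "va g e" e] va_inv_eq[of g e "va (inv g) e"] by auto
  have gx: "inv g \<otimes> (g \<otimes> x) = x" "g \<otimes> (inv g \<otimes> x) = x" if "x \<in> carrier G" for x
    using that g by (simp_all add: m_assoc[symmetric])
  have "bij_betw (fst (std_act g)) (verts std) (verts std)"
    by (rule bij_betw_byWitness[where f'="fst (std_act (inv g))"])
      (use g in \<open>auto simp: std_act_def inv' gx\<close>)
  moreover have "bij_betw (snd (std_act g)) (arcs std) (arcs std)"
    by (rule bij_betw_byWitness[where f'="snd (std_act (inv g))"])
      (use g K_ea[of g] K_ea[of "inv g"] in \<open>auto simp: std_act_def inv gx K_carrier\<close>)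
  moreover have "(fst (std_act g), snd (std_act g)) \<in> graph_hom std std"
    by (rule graph_homI[OF _ std_rev std_rev])
      (use g K_ea[of g] in \<open>auto simp: std_act_def head_ea arev_ea T K_arev K_carrier\<close>)
  ultimately show ?thesis
    unfolding graph_aut_carrier_iff[of "fst (std_act g)" "snd (std_act g)", unfolded prod.collapse]
    by (auto simp: Bij_def std_act_def)
qed

lemma n_edge: "e \<in> arcs T \<Longrightarrow> ea (n e) ` {e, arev T e} = ed (eorb e)"
  using n[of e] T[of e] arev_ea[of "n e" e] by (auto simp: ed_def T)

text \<open>Since \<open>n e\<close> moves the edge of \<open>e\<close> to the representing edge,
  left multiplication by it moves the coset \<open>K e\<close> onto \<open>E\<close>. This makes
  \<open>n e \<otimes> x\<close> a suitable colour for the arc \<open>(e, x)\<close>.\<close>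

lemma K_iff:
  assumes e: "e \<in> arcs T" and x: "x \<in> carrier G"
  shows "x \<in> K e \<longleftrightarrow> n e \<otimes> x \<in> E (eorb e)"
proof -
  have img: "ea (n e \<otimes> x) ` ed (eorb e) = ea (n e) ` ea x ` ed (eorb e)"
    unfolding image_image using x n(1)[OF e] ed_arcs[OF e] by (intro image_cong) (auto simp: ea_mult)
  have sub: "ea x ` ed (eorb e) \<subseteq> arcs T" "{e, arev T e} \<subseteq> arcs T"
    using x e T ed_arcs[OF e] by auto
  have inj: "inj_on (ea (n e)) (arcs T)" using ea_inj n(1)[OF e] by (auto intro: inj_onI)
  have "n e \<otimes> x \<in> E (eorb e) \<longleftrightarrow> ea (n e) ` ea x ` ed (eorb e) = ea (n e) ` {e, arev T e}"
    using x n(1)[OF e] by (simp only: E_iff[OF e] img n_edge[OF e] m_closed simp_thms)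
  also have "\<dots> \<longleftrightarrow> ea x ` ed (eorb e) = {e, arev T e}"
    using inj_on_image_eq_iff[OF inj sub] .
  also have "\<dots> \<longleftrightarrow> x \<in> K e"
    using edge_image[OF e x, of e] x by (auto simp: K_def)
  finally show ?thesis by simp
qed

text \<open>The first component is constant on a bundle, so the unions in the projections consist of
  a single orbit. The factor \<open>m w\<close> refers the colours over \<open>w\<close> to the
  representing vertex: the stabiliser of \<open>w\<close>, acting on the layers by left translation,
  acts on colours as the stabiliser of the representative.\<close>

definition S0 :: "('v \<times> 'e option \<times> 'g, 'e \<times> 'g, 'v set, 'e set, 'e option \<times> 'g, 'g) scaff_data" where
  "S0 = \<lparr>sgraph = std, srel = {(p, q). p \<in> verts std \<and> q \<in> verts std \<and> fst p = fst q},
         vproj = (\<lambda>V. \<Union>(vorb ` fst ` V)), aproj = (\<lambda>A. \<Union>(eorb ` fst ` A)),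
         vcol = (\<lambda>(w, c, x). (None, m w \<otimes> x)), acol = (\<lambda>(e, x). n e \<otimes> x)\<rparr>"

lemma S0_simps [simp]:
  "sgraph S0 = std" "srel S0 = {(p, q). p \<in> verts std \<and> q \<in> verts std \<and> fst p = fst q}"
  "vproj S0 V = \<Union>(vorb ` fst ` V)" "aproj S0 A = \<Union>(eorb ` fst ` A)"
  "vcol S0 (w, c, x) = (None, m w \<otimes> x)" "acol S0 (e, x) = n e \<otimes> x"
  by (simp_all add: S0_def)

section \<open>Bundles of the standard scaffolding and its quotient tree\<close>

definition VB :: "'v \<Rightarrow> ('v \<times> 'e option \<times> 'g) set" where "VB w = {w} \<times> {None} \<times> carrier G"
definition AB :: "'e \<Rightarrow> ('e \<times> 'g) set" where "AB e = {e} \<times> K e"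

lemma K_nonempty: "e \<in> arcs T \<Longrightarrow> inv (n e) \<in> K e"
  using n(1)[of e] subgroup.one_closed[OF E_subgroup[of e]] by (simp add: K_iff)

text \<open>Equivalent arcs lie over arcs of \<open>T\<close> with equal ends, and \<open>T\<close>
  has no multiple arcs.\<close>

lemma S0_arc_rel: "arc_rel S0 = {(p, q). p \<in> arcs std \<and> q \<in> arcs std \<and> fst p = fst q}"
  unfolding arc_rel_def
  by (auto simp: K_carrier T dest: tree_graph_nomulti[OF tree, rotated 2])

lemma S0_tree_verts: "verts (scaff_tree S0) = VB ` verts T"
proof -
  have "srel S0 `` {p} = VB (fst p)" if "p \<in> verts std" for p
    using that by (auto simp: VB_def)
  then have "verts (scaff_tree S0) = (\<lambda>p. VB (fst p)) ` verts std"
    unfolding scaff_tree_def quotient_def by (simp del: S0_simps(2) std_simps(1)) blast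
  also have "\<dots> = VB ` fst ` verts std" by (simp only: image_image)
  also have "fst ` verts std = verts T" by force
  finally show ?thesis .
qed

lemma S0_tree_arcs: "arcs (scaff_tree S0) = AB ` arcs T"
proof -
  have "arc_rel S0 `` {p} = AB (fst p)" if "p \<in> arcs std" for p
    using that by (cases p) (auto simp: AB_def S0_arc_rel)
  then have "arcs (scaff_tree S0) = (\<lambda>p. AB (fst p)) ` arcs std"
    unfolding scaff_tree_def quotient_def by simp blast
  also have "\<dots> = AB ` fst ` arcs std" by (simp only: image_image)
  also have "fst ` arcs std = arcs T" using K_nonempty by (force simp: std_def)
  finally show ?thesis .
qed

lemma S0_tree_head:
  assumes "e \<in> arcs T" shows "head (scaff_tree S0) (AB e) = VB (head T e)"
  using assms K_nonempty[OF assms] T K_carrier[of _ e]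
  by (auto simp: scaff_tree_def AB_def VB_def image_image)

lemma S0_tree_arev: "e \<in> arcs T \<Longrightarrow> arev (scaff_tree S0) (AB e) = AB (arev T e)"
  by (auto simp: scaff_tree_def AB_def K_arev image_iff)

lemma S0_tree_tail:
  assumes "e \<in> arcs T" shows "tail (scaff_tree S0) (AB e) = VB (tail T e)"
  using assms K_nonempty[OF assms] T K_carrier[of _ e]
  by (auto simp: scaff_tree_def AB_def VB_def image_image)

lemma VB_inj: "VB v = VB w \<longleftrightarrow> v = w"
proof
  have fst: "fst ` VB u = {u}" for u unfolding VB_def fst_image_times using one_closed by auto
  assume "VB v = VB w"
  then have "fst ` VB v = fst ` VB w" by (rule arg_cong)
  then show "v = w" unfolding fst by (rule singleton_inject)
qed (rule arg_cong)

lemma AB_inj: "e \<in> arcs T \<Longrightarrow> AB e = AB f \<longleftrightarrow> e = f"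
  using K_nonempty[of e] by (auto simp: AB_def)

lemma S0_proj: "vproj S0 (VB w) = vorb w" "e \<in> arcs T \<Longrightarrow> aproj S0 (AB e) = eorb e"
  using K_nonempty[of e] by (auto simp: VB_def AB_def)

lemma S0_tree_rev: "rev_graph (scaff_tree S0)"
  by (rule rev_graphI)
    (auto simp: S0_tree_arcs S0_tree_verts S0_tree_head S0_tree_arev S0_tree_tail T)

lemma S0_tree_iso: "(VB, AB) \<in> graph_iso T (scaff_tree S0)"
proof -
  have "(VB, AB) \<in> graph_hom T (scaff_tree S0)"
    by (rule graph_homI[OF _ T_rev S0_tree_rev])
      (auto simp: S0_tree_arcs S0_tree_verts S0_tree_head S0_tree_arev)
  then show ?thesis
    by (auto simp: graph_iso_def bij_betw_def S0_tree_arcs S0_tree_verts VB_inj AB_inj intro!: inj_onI)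
qed

section \<open>Legality of the standard colouring\<close>

lemma S0_acol_bij:
  assumes e: "e \<in> arcs T" shows "bij_betw (acol S0) (AB e) (E (eorb e))"
    and "y \<in> E (eorb e) \<Longrightarrow> inv_into (AB e) (acol S0) y = (e, inv (n e) \<otimes> y)"
proof -
  have 1: "(e, inv (n e) \<otimes> y) \<in> AB e" "acol S0 (e, inv (n e) \<otimes> y) = y" if "y \<in> E (eorb e)" for y
    using that n(1)[OF e] subgroup.mem_carrier[OF E_subgroup[OF e] that]
    by (auto simp: AB_def K_iff[OF e] m_assoc[symmetric])
  have inj: "inj_on (acol S0) (AB e)"
    using n(1)[OF e] K_carrier by (auto simp: AB_def intro!: inj_onI)
  have "acol S0 ` AB e \<subseteq> E (eorb e)" using iffD1[OF K_iff[OF e K_carrier[of _ e]]] by (auto simp: AB_def)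
  then show "bij_betw (acol S0) (AB e) (E (eorb e))"
    using inj 1 unfolding bij_betw_def by (metis image_eqI subsetI subset_antisym)
  show "y \<in> E (eorb e) \<Longrightarrow> inv_into (AB e) (acol S0) y = (e, inv (n e) \<otimes> y)"
    using inv_into_f_f[OF inj 1(1)] 1(2) by metis
qed

lemma S0_bundle_map:
  assumes e: "e \<in> arcs T"
  shows "bundle_map \<G> S0 (AB e) = tr (eorb e) (m (head T e) \<otimes> inv (n e))"
proof -
  have "m (head T e) \<otimes> (inv (n e) \<otimes> y) = m (head T e) \<otimes> inv (n e) \<otimes> y" if "y \<in> E (eorb e)" for y
    using n(1)[OF e] m(1)[of "head T e"] T[OF e] subgroup.mem_carrier[OF E_subgroup[OF e] that]
    by (simp add: m_assoc)
  then show ?thesis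
    unfolding bundle_map_def tr_def
    using S0_acol_bij(2)[OF e] by (auto simp: S0_proj(2)[OF e] simp del: S0_simps(4) intro!: restrict_ext)
qed

text \<open>The bundle map over \<open>e\<close> translates by an element carrying the head of
  \<open>n e\<close> applied to \<open>e\<close> to the representing vertex, so it is untwisted or
  twisted according to whether \<open>n e\<close> sends \<open>e\<close> to the representing arc or
  to its reverse. In a self-reverse orbit \<open>e\<close> and its reverse share \<open>n e\<close>,
  so one of them is of each kind. In any other orbit \<open>e\<close> cannot be sent to the reversed
  representative, which lies in a different orbit.\<close>

lemma S0_legal_arc:
  assumes e: "e \<in> arcs T"
  shows "if eorb (arev T e) \<noteq> eorb e then bundle_map \<G> S0 (AB e) \<in> adhesion_maps \<G> (eorb e)
    else bundle_map \<G> S0 (AB e) \<in> adhesion_maps \<G> (eorb e) \<and>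
           bundle_map \<G> S0 (AB (arev T e)) \<in> twisted_adhesion_maps \<G> (eorb e) \<or>
         bundle_map \<G> S0 (AB (arev T e)) \<in> adhesion_maps \<G> (eorb e) \<and>
           bundle_map \<G> S0 (AB e) \<in> twisted_adhesion_maps \<G> (eorb e)"
proof -
  have *: "m (head T f) \<otimes> inv (n f) \<in> carrier G \<and>
      va (m (head T f) \<otimes> inv (n f)) (head T i) = vr (vorb (head T f))"
    if f: "f \<in> arcs T" and i: "i = ea (n f) f" for f i
  proof -
    have "va (inv (n f)) (head T i) = head T f"
      using f n(1)[OF f] T by (simp add: va_inv_eq i head_ea)
    then show ?thesis using f n(1)[OF f] m[of "head T f"] T by (simp add: va_mult i)
  qed
  let ?e = "er (eorb e)"
  note T' = T(3)[OF e]
  show ?thesis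
  proof (cases "eorb (arev T e) = eorb e")
    case True
    have er': "eorb (arev T e) = eorb e" "eorb (arev T (arev T e)) = eorb (arev T e)"
      using True e T by auto
    have hd: "vorb (head T (arev T e)) = vorb (head T e)"
      using B_eorb(1)[OF T'] B_eorb(1)[OF e] True by simp
    have "ea (n e) e = ?e \<or> ea (n e) e = arev T ?e" using n(3)[OF e] by simp
    then show ?thesis
    proof
      assume 1: "ea (n e) e = ?e"
      then have 2: "ea (n (arev T e)) (arev T e) = arev T ?e"
        using n[OF e] e by (simp add: arev_ea[symmetric])
      have "bundle_map \<G> S0 (AB e) \<in> adhesion_maps \<G> (eorb e)"
        unfolding adhesion_maps_eq[OF e] S0_bundle_map[OF e] using *[OF e 1[symmetric]] by blast
      moreover have "bundle_map \<G> S0 (AB (arev T e)) \<in> twisted_adhesion_maps \<G> (eorb e)"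
        unfolding twisted_adhesion_maps_eq[OF e True] S0_bundle_map[OF T'] True
        using *[OF T' 2[symmetric]] unfolding hd by blast
      ultimately show ?thesis using True by simp
    next
      assume 1: "ea (n e) e = arev T ?e"
      then have 2: "ea (n (arev T e)) (arev T e) = ?e"
        using n[OF e] e T by (simp add: arev_ea[symmetric])
      have "bundle_map \<G> S0 (AB e) \<in> twisted_adhesion_maps \<G> (eorb e)"
        unfolding twisted_adhesion_maps_eq[OF e True] S0_bundle_map[OF e]
        using *[OF e 1[symmetric]] by blast
      moreover have "bundle_map \<G> S0 (AB (arev T e)) \<in> adhesion_maps \<G> (eorb e)"
        unfolding adhesion_maps_eq[OF e] S0_bundle_map[OF T'] True
        using *[OF T' 2[symmetric]] unfolding hd by blast
      ultimately show ?thesis using True by simp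
    qed
  next
    case False
    have "eorb (ea (n e) e) = eorb e" using n(1)[OF e] e by simp
    moreover have "eorb (arev T ?e) = eorb (arev T e)"
      using B_eorb(3)[of ?e] B_eorb(3)[OF e] e by simp
    ultimately have 1: "ea (n e) e = ?e" using n(3)[OF e] False by auto
    have "bundle_map \<G> S0 (AB e) \<in> adhesion_maps \<G> (eorb e)"
      unfolding adhesion_maps_eq[OF e] S0_bundle_map[OF e] using *[OF e 1[symmetric]] by blast
    then show ?thesis using False by simp
  qed
qed

lemma S0_unique_arc:
  assumes w: "w \<in> verts T" and e0: "e0 \<in> arcs T" and hd: "vorb (head T e0) = vorb w"
    and Z: "Z \<in> adhesion_sets \<G> (eorb e0)"
  shows "\<exists>!A. A \<in> arcs (scaff_tree S0) \<and> head (scaff_tree S0) A = VB w \<and> aproj S0 A = eorb e0 \<and>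
    bundle_map \<G> S0 A ` aset \<G> (eorb e0) = Z"
proof -
  let ?a = "eorb e0" and ?e = "er (eorb e0)"
  obtain x where x: "x \<in> carrier G" "va x (head T ?e) = vr (vorb w)" "Z = tr ?a x ` E ?a"
    using Z hd by (auto simp: adhesion_sets_def adhesion_maps_eq[OF e0])
  note mc = m(1)[OF w]
  have ev: "?e \<in> arcs T" using e0 by simp
  \<comment> \<open>The adhesion set is the coset of \<open>x\<close>, hence stands for an edge at
    the representing vertex; \<open>inv (m w)\<close> moves that edge to \<open>w\<close>.\<close>
  define e where "e = ea (inv (m w) \<otimes> x) ?e"
  have e: "e \<in> arcs T" using ev x mc by (simp add: e_def)
  have eo: "eorb e = ?a" using ev x mc e0 by (simp add: e_def)
  have he: "head T e = w"
    using ev x mc w m(2)[OF w] T by (simp add: e_def head_ea va_mult va_inv_eq)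
  have me: "ea (m w) e = ea x ?e"
    using ev x mc ea_inv_eq[OF mc, of "ea x ?e" e] e by (simp add: e_def ea_mult)
  \<comment> \<open>Equality of cosets means that \<open>e\<close> and \<open>f\<close> span the
    same edge; since both have head \<open>w\<close>, they then coincide.\<close>
  have key: "bundle_map \<G> S0 (AB f) ` E ?a = Z \<longleftrightarrow> f = e"
    if f: "f \<in> arcs T" "head T f = w" "eorb f = ?a" for f
  proof -
    have "bundle_map \<G> S0 (AB f) ` E ?a = Z \<longleftrightarrow> ea (m w \<otimes> inv (n f)) ` ed ?a = ea x ` ed ?a"
      unfolding S0_bundle_map[OF f(1)] x(3) f(2,3)
      using tr_image_eq_iff[OF e0 _ x(1)] mc n(1)[OF f(1)] by simp
    also have "ea x ` ed ?a = ea (m w) ` {e, arev T e}"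
      using me x mc e ev by (auto simp: ed_def arev_ea[symmetric])
    also have "ea (m w \<otimes> inv (n f)) ` ed ?a = ea (m w) ` {f, arev T f}"
    proof -
      have "ea (m w \<otimes> inv (n f)) (ea (n f) g) = ea (m w) g" if "g \<in> arcs T" for g
        using that mc n(1)[OF f(1)] by (simp add: ea_mult[symmetric] m_assoc)
      then show ?thesis using f T by (simp add: n_edge[OF f(1), unfolded f(3), symmetric])
    qed
    also have "ea (m w) ` {f, arev T f} = ea (m w) ` {e, arev T e} \<longleftrightarrow> {f, arev T f} = {e, arev T e}"
      by (rule inj_on_image_eq_iff[of _ "arcs T"]) (use ea_inj mc f e T in \<open>auto intro: inj_onI\<close>)
    also have "\<dots> \<longleftrightarrow> f = e"
      using tree_graph_loopfree[OF tree e] T[OF e] he f(2) by (auto simp: doubleton_eq_iff)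
    finally show ?thesis .
  qed
  show ?thesis
  proof (rule ex1I[of _ "AB e"])
    show "AB e \<in> arcs (scaff_tree S0) \<and> head (scaff_tree S0) (AB e) = VB w \<and>
        aproj S0 (AB e) = eorb e0 \<and> bundle_map \<G> S0 (AB e) ` aset \<G> (eorb e0) = Z"
      using e he eo key[OF e he eo] S0_proj(2)[OF e] by (simp add: S0_tree_arcs S0_tree_head del: S0_simps)
  next
    fix A assume A: "A \<in> arcs (scaff_tree S0) \<and> head (scaff_tree S0) A = VB w \<and>
        aproj S0 A = eorb e0 \<and> bundle_map \<G> S0 A ` aset \<G> (eorb e0) = Z"
    then obtain f where f: "f \<in> arcs T" "A = AB f" by (auto simp: S0_tree_arcs)
    then have "head T f = w" "eorb f = ?a"
      using A S0_tree_head[OF f(1)] S0_proj(2)[OF f(1)] by (simp_all add: VB_inj del: S0_simps)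
    then show "A = AB e" using key[OF f(1)] A f by simp
  qed
qed

text \<open>Guarantees that the assertion about all scaffoldings is not vacuous.\<close>

lemma S0_is_scaffolding: "is_scaffolding \<G> S0"
  unfolding is_scaffolding_def
proof (intro conjI ballI)
  show "rev_graph (sgraph S0)" using std_rev by simp
  show "equiv (verts (sgraph S0)) (srel S0)"
    by (rule equivI) (auto simp: refl_on_def sym_def trans_def)
  show "tree_graph (scaff_tree S0)" using tree_graph_iso[OF S0_tree_iso tree S0_tree_rev] .
  show "(tail (sgraph S0) a, head (sgraph S0) a) \<notin> srel S0" if "a \<in> arcs (sgraph S0)" for a
    using that tree_graph_loopfree[OF tree] by (cases a) auto
  show "(vproj S0, aproj S0) \<in> graph_hom (scaff_tree S0) (base \<G>)"
  proof (rule graph_homI[OF _ S0_tree_rev])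
    show "rev_graph (base \<G>)" using B_rev by simp
    show "vproj S0 V \<in> verts (base \<G>)" if "V \<in> verts (scaff_tree S0)" for V
      using that S0_proj(1) by (auto simp: S0_tree_verts simp del: S0_simps)
    fix A assume "A \<in> arcs (scaff_tree S0)"
    then obtain e where "e \<in> arcs T" "A = AB e" by (auto simp: S0_tree_arcs)
    then show "aproj S0 A \<in> arcs (base \<G>) \<and>
        head (base \<G>) (aproj S0 A) = vproj S0 (head (scaff_tree S0) A) \<and>
        arev (base \<G>) (aproj S0 A) = aproj S0 (arev (scaff_tree S0) A)"
      using T by (simp add: S0_proj S0_tree_head S0_tree_arev del: S0_simps)
  qed
  show "legal_colouring \<G> S0"
    unfolding legal_colouring_def
  proof (intro conjI ballI impI)
    fix V assume "V \<in> verts (scaff_tree S0)"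
    then obtain w where w: "w \<in> verts T" "V = VB w" by (auto simp: S0_tree_verts)
    have "bij_betw (vcol S0) (VB w) ({None} \<times> carrier G)"
      by (rule bij_betw_byWitness[where f'="\<lambda>p. (w, None, inv (m w) \<otimes> snd p)"])
        (use m(1)[OF w(1)] in \<open>auto simp: VB_def m_assoc[symmetric]\<close>)
    then show "bij_betw (vcol S0) V (vset \<G> (vproj S0 V))" using w by simp
  next
    fix A assume "A \<in> arcs (scaff_tree S0)"
    then obtain e where e: "e \<in> arcs T" "A = AB e" by (auto simp: S0_tree_arcs)
    show "bij_betw (acol S0) A (aset \<G> (aproj S0 A))"
      using S0_acol_bij(1)[OF e(1)] e S0_proj(2)[OF e(1)] by (simp del: S0_simps)
    show "let a = aproj S0 A;
            \<psi> = bundle_map \<G> S0 A;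
            \<psi>' = bundle_map \<G> S0 (arev (scaff_tree S0) A)
        in if arev (base \<G>) a \<noteq> a then \<psi> \<in> adhesion_maps \<G> a
           else \<psi> \<in> adhesion_maps \<G> a \<and> \<psi>' \<in> twisted_adhesion_maps \<G> a \<or>
                \<psi>' \<in> adhesion_maps \<G> a \<and> \<psi> \<in> twisted_adhesion_maps \<G> a"
      using S0_legal_arc[OF e(1)] e
      by (simp add: Let_def S0_proj(2)[OF e(1)] S0_tree_arev del: S0_simps)
  next
    show "acol S0 (arev (sgraph S0) b) = acol S0 b" if "b \<in> arcs (sgraph S0)" for b
      using that n(2) by (cases b) auto
  next
    fix V b Z
    assume "V \<in> verts (scaff_tree S0)" and b: "b \<in> arcs (base \<G>)" "head (base \<G>) b = vproj S0 V"
      and Z: "Z \<in> adhesion_sets \<G> b"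
    then obtain w where w: "w \<in> verts T" "V = VB w" by (auto simp: S0_tree_verts)
    obtain e where e: "e \<in> arcs T" "b = eorb e" using b by auto
    show "\<exists>!A. A \<in> arcs (scaff_tree S0) \<and> head (scaff_tree S0) A = V \<and> aproj S0 A = b \<and>
                bundle_map \<G> S0 A ` aset \<G> b = Z"
      using S0_unique_arc[OF w(1) e(1) _ Z[unfolded e(2)]] b(2) e w S0_proj(1)[of w]
      by (simp del: S0_simps)
  qed
qed

end

section \<open>Rigidity of scaffoldings\<close>

locale scaffolding = tree_action_reps G T \<rho> vr er k \<tau> m n
  for G :: "'g monoid" (structure) and T :: "('v, 'e) rgraph" and \<rho> vr er k \<tau> m n +
  fixes S :: "('s, 't, 'v set, 'e set, 'e option \<times> 'g, 'g) scaff_data"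
  assumes scaff: "is_scaffolding \<G> S"
begin

section \<open>Bundles, colours and bundle maps of an arbitrary scaffolding\<close>

abbreviation "\<Sigma> \<equiv> sgraph S"
abbreviation "T' \<equiv> scaff_tree S"

definition vb :: "'s \<Rightarrow> 's set" where "vb s = srel S `` {s}"
definition ab :: "'t \<Rightarrow> 't set" where "ab b = arc_rel S `` {b}"

lemma \<Sigma>_rev: "rev_graph \<Sigma>"
  and srel_equiv: "equiv (verts \<Sigma>) (srel S)"
  and T'_tree: "tree_graph T'"
  and proj_hom: "(vproj S, aproj S) \<in> graph_hom T' B"
  and legal: "legal_colouring \<G> S"
  using scaff by (auto simp: is_scaffolding_def)

lemmas \<Sigma> = rev_graphD[OF \<Sigma>_rev]
lemmas T'_rev = tree_graph_rev[OF T'_tree]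
lemmas T' = rev_graphD[OF T'_rev]
lemmas proj = graph_homD[OF proj_hom]

lemma arc_rel_equiv: "equiv (arcs \<Sigma>) (arc_rel S)"
proof (rule equivI)
  note srel = srel_equiv[THEN equiv_class_eq_iff]
  show "arc_rel S \<subseteq> arcs \<Sigma> \<times> arcs \<Sigma>" by (auto simp: arc_rel_def)
  show "refl_on (arcs \<Sigma>) (arc_rel S)"
    by (auto simp: refl_on_def arc_rel_def \<Sigma> srel)
  show "sym (arc_rel S)" "trans (arc_rel S)"
    by (auto simp: sym_def trans_def arc_rel_def srel)
qed

lemma vb_eq: "s \<in> verts \<Sigma> \<Longrightarrow> s' \<in> verts \<Sigma> \<Longrightarrow> vb s = vb s' \<longleftrightarrow> (s, s') \<in> srel S"
  unfolding vb_def by (rule eq_equiv_class_iff[OF srel_equiv])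

lemma ab_eq: "b \<in> arcs \<Sigma> \<Longrightarrow> b' \<in> arcs \<Sigma> \<Longrightarrow> ab b = ab b' \<longleftrightarrow> (b, b') \<in> arc_rel S"
  unfolding ab_def by (rule eq_equiv_class_iff[OF arc_rel_equiv])

lemma vb_iff: "s \<in> verts \<Sigma> \<Longrightarrow> s' \<in> vb s \<longleftrightarrow> s' \<in> verts \<Sigma> \<and> vb s' = vb s"
  using vb_eq srel_equiv unfolding vb_def by (auto simp: equiv_class_eq_iff)

lemma ab_iff: "b \<in> arcs \<Sigma> \<Longrightarrow> b' \<in> ab b \<longleftrightarrow> b' \<in> arcs \<Sigma> \<and> ab b' = ab b"
  using ab_eq arc_rel_equiv unfolding ab_def by (auto simp: equiv_class_eq_iff)

lemma ab_vb:
  assumes "b \<in> arcs \<Sigma>" "b' \<in> arcs \<Sigma>"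
  shows "ab b = ab b' \<longleftrightarrow> vb (tail \<Sigma> b) = vb (tail \<Sigma> b') \<and> vb (head \<Sigma> b) = vb (head \<Sigma> b')"
  using assms by (simp add: ab_eq vb_eq \<Sigma> arc_rel_def)

lemma T'_verts: "verts T' = vb ` verts \<Sigma>" and T'_arcs: "arcs T' = ab ` arcs \<Sigma>"
  by (auto simp: scaff_tree_def quotient_def vb_def ab_def)

lemma vb_class: "X \<subseteq> verts \<Sigma> \<Longrightarrow> s \<in> X \<Longrightarrow> (\<And>x. x \<in> X \<Longrightarrow> vb x = vb s) \<Longrightarrow> srel S `` X = vb s"
  unfolding vb_def by blast

lemma T'_ab:
  assumes b: "b \<in> arcs \<Sigma>"
  shows "head T' (ab b) = vb (head \<Sigma> b)" "tail T' (ab b) = vb (tail \<Sigma> b)"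
    "arev T' (ab b) = ab (arev \<Sigma> b)"
proof -
  have bb: "b \<in> ab b" using ab_iff[OF b] b by simp
  have mem: "c \<in> arcs \<Sigma>" "vb (tail \<Sigma> c) = vb (tail \<Sigma> b)" "vb (head \<Sigma> c) = vb (head \<Sigma> b)"
    if "c \<in> ab b" for c
    using that ab_iff[OF b] ab_vb[of c b] b by auto
  have "srel S `` (head \<Sigma> ` ab b) = vb (head \<Sigma> b)"
    by (rule vb_class; use mem bb \<Sigma>(1,2) in blast)
  moreover have "srel S `` (tail \<Sigma> ` ab b) = vb (tail \<Sigma> b)"
    by (rule vb_class; use mem bb \<Sigma>(1,2) in blast)
  moreover have "arev \<Sigma> ` ab b = ab (arev \<Sigma> b)"
  proof (intro equalityI subsetI)
    fix c assume "c \<in> arev \<Sigma> ` ab b"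
    then obtain d where "d \<in> ab b" "c = arev \<Sigma> d" by auto
    then show "c \<in> ab (arev \<Sigma> b)"
      using mem[of d] \<Sigma>[of d] \<Sigma>[OF b] by (simp only: ab_iff ab_vb simp_thms)
  next
    fix c assume c: "c \<in> ab (arev \<Sigma> b)"
    then have "arev \<Sigma> c \<in> ab b" using \<Sigma> b by (auto simp: ab_iff ab_vb)
    moreover have "c = arev \<Sigma> (arev \<Sigma> c)" using c \<Sigma> b by (auto simp: ab_iff)
    ultimately show "c \<in> arev \<Sigma> ` ab b" by (rule rev_image_eqI)
  qed
  ultimately show "head T' (ab b) = vb (head \<Sigma> b)" "tail T' (ab b) = vb (tail \<Sigma> b)"
    "arev T' (ab b) = ab (arev \<Sigma> b)"
    by (simp_all add: scaff_tree_def)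
qed

lemma vb_self: "s \<in> verts \<Sigma> \<Longrightarrow> s \<in> vb s"
  by (simp add: vb_iff)

lemma ab_self: "b \<in> arcs \<Sigma> \<Longrightarrow> b \<in> ab b"
  by (simp add: ab_iff)

lemma vcol_bij: "s \<in> verts \<Sigma> \<Longrightarrow> bij_betw (vcol S) (vb s) ({None} \<times> carrier G)"
  using legal unfolding legal_colouring_def by (auto simp: T'_verts)

lemma acol_bij: "b \<in> arcs \<Sigma> \<Longrightarrow> bij_betw (acol S) (ab b) (E (aproj S (ab b)))"
  using legal unfolding legal_colouring_def by (auto simp: T'_arcs)

lemma acol_arev: "b \<in> arcs \<Sigma> \<Longrightarrow> acol S (arev \<Sigma> b) = acol S b"
  using legal unfolding legal_colouring_def by auto

definition c :: "'s \<Rightarrow> 'g" where "c s = snd (vcol S s)"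

lemma vcol_c: "s \<in> verts \<Sigma> \<Longrightarrow> vcol S s = (None, c s)"
  and c_closed [simp]: "s \<in> verts \<Sigma> \<Longrightarrow> c s \<in> carrier G"
proof -
  assume s: "s \<in> verts \<Sigma>"
  then have "vcol S s \<in> {None} \<times> carrier G" using bij_betwE[OF vcol_bij] vb_self by blast
  then show "vcol S s = (None, c s)" "c s \<in> carrier G" by (auto simp: c_def)
qed

lemma c_inj: "s \<in> verts \<Sigma> \<Longrightarrow> s' \<in> verts \<Sigma> \<Longrightarrow> vb s = vb s' \<Longrightarrow> c s = c s' \<Longrightarrow> s = s'"
  using vcol_bij[of s] vb_self[of s] vb_self[of s'] vcol_c[of s] vcol_c[of s']
  unfolding bij_betw_def by (metis inj_onD)

lemma c_surj:
  assumes "s \<in> verts \<Sigma>" "x \<in> carrier G"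
  obtains s' where "s' \<in> verts \<Sigma>" "vb s' = vb s" "c s' = x"
proof -
  have "(None, x) \<in> vcol S ` vb s" using vcol_bij[OF assms(1)] assms(2) by (simp add: bij_betw_def)
  then obtain s' where "s' \<in> vb s" "vcol S s' = (None, x)" by auto
  then show ?thesis using that[of s'] assms(1) vb_iff by (simp add: c_def)
qed

lemma aproj_arcE:
  assumes "A \<in> arcs T'" obtains e where "e \<in> arcs T" "aproj S A = eorb e"
  using proj(2)[OF assms] by auto

lemma vproj_vertE:
  assumes "V \<in> verts T'" obtains v where "v \<in> verts T" "vproj S V = vorb v"
  using proj(1)[OF assms] by auto

lemma acol_E: "b \<in> arcs \<Sigma> \<Longrightarrow> acol S b \<in> E (aproj S (ab b))"
  using acol_bij[of b] ab_self[of b] by (auto simp: bij_betw_def)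

lemma bundle_map_acol:
  assumes "b \<in> arcs \<Sigma>"
  shows "bundle_map \<G> S (ab b) (acol S b) = (None, c (head \<Sigma> b))"
proof -
  have "inv_into (ab b) (acol S) (acol S b) = b"
    using acol_bij[OF assms] ab_self[OF assms] by (auto simp: bij_betw_def)
  then show ?thesis using assms acol_E[OF assms] vcol_c \<Sigma> by (simp add: bundle_map_def)
qed

text \<open>\<open>xx A\<close> is the element by which the bundle map of \<open>A\<close> translates.\<close>

definition xx :: "'t set \<Rightarrow> 'g" where "xx A = snd (bundle_map \<G> S A \<one>)"

lemma tr_one: "e \<in> arcs T \<Longrightarrow> x \<in> carrier G \<Longrightarrow> snd (tr (eorb e) x \<one>) = x"
  using subgroup.one_closed[OF E_subgroup[of e]] by (simp add: tr_def)

text \<open>The arc \<open>i\<close> absorbs the distinction between adhesion maps and twisted ones: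
  it is the representing arc if the bundle map of \<open>A\<close> is taken as the untwisted one,
  and the reverse of the representing arc otherwise. Either way the translations of \<open>A\<close>
  and of its reverse send the two ends of \<open>i\<close> to the representing vertices of the ends
  of \<open>A\<close>.\<close>

lemma arc_data:
  assumes A: "A \<in> arcs T'"
  shows "bundle_map \<G> S A = tr (aproj S A) (xx A)" "xx A \<in> carrier G"
    "\<exists>i\<in>ed (aproj S A). eorb i = aproj S A \<and> va (xx A) (head T i) = vr (vproj S (head T' A)) \<and>
       va (xx (arev T' A)) (head T (arev T i)) = vr (vproj S (tail T' A))"
proof -
  obtain e where e: "e \<in> arcs T" "aproj S A = eorb e" using aproj_arcE[OF A] .
  note A' = T'(3)[OF A]
  have e': "aproj S (arev T' A) = eorb (arev T e)" "arev T e \<in> arcs T"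
    using proj(5)[OF A] e T by auto
  have hd: "vproj S (head T' A) = vorb (head T e)" "vproj S (tail T' A) = vorb (tail T e)"
    using proj(3,4)[OF A] e by auto
  let ?e = "er (eorb e)" and ?\<psi> = "bundle_map \<G> S A" and ?\<psi>' = "bundle_map \<G> S (arev T' A)"
  note L = legal[unfolded legal_colouring_def Let_def, THEN conjunct2, THEN conjunct2, THEN conjunct2, THEN conjunct1]
  have "\<exists>x x' i. i \<in> ed (eorb e) \<and> x \<in> carrier G \<and> x' \<in> carrier G \<and>
      ?\<psi> = tr (eorb e) x \<and> ?\<psi>' = tr (eorb (arev T e)) x' \<and> eorb i = eorb e \<and>
      va x (head T i) = vr (vorb (head T e)) \<and> va x' (head T (arev T i)) = vr (vorb (tail T e))"
  proof (cases "eorb (arev T e) = eorb e")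
    case False
    then have 1: "?\<psi> \<in> adhesion_maps \<G> (eorb e)" using bspec[OF L A] e False by simp
    have 2: "?\<psi>' \<in> adhesion_maps \<G> (eorb (arev T e))" using bspec[OF L A'] e' False T(4)[OF e(1)] by simp
    obtain x x' where "x \<in> carrier G" "x' \<in> carrier G" "?\<psi> = tr (eorb e) x"
      "?\<psi>' = tr (eorb (arev T e)) x'" "va x (head T ?e) = vr (vorb (head T e))"
      "va x' (head T (arev T ?e)) = vr (vorb (tail T e))"
      using 1 2 unfolding adhesion_maps_eq[OF e(1)] adhesion_maps_eq[OF e'(2)]
        er_arev[OF e(1) False] T(5)[OF e(1)] by blast
    then show ?thesis
      by (intro exI[of _ x] exI[of _ x'] exI[of _ ?e]) (auto simp: ed_def e(1))
  next
    case True
    have oe: "eorb (arev T ?e) = eorb e"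
      using B_eorb(3)[of ?e] B_eorb(3)[OF e(1)] True e(1) by simp
    have hd': "vorb (tail T e) = vorb (head T e)"
      using B_eorb(1)[OF e'(2)] B_eorb(1)[OF e(1)] True T(5)[OF e(1)] by simp
    have "?\<psi> \<in> adhesion_maps \<G> (eorb e) \<and> ?\<psi>' \<in> twisted_adhesion_maps \<G> (eorb e) \<or>
        ?\<psi>' \<in> adhesion_maps \<G> (eorb e) \<and> ?\<psi> \<in> twisted_adhesion_maps \<G> (eorb e)"
      using bspec[OF L A] e True by simp
    then show ?thesis
    proof
      assume "?\<psi> \<in> adhesion_maps \<G> (eorb e) \<and> ?\<psi>' \<in> twisted_adhesion_maps \<G> (eorb e)"
      then obtain x x' where "x \<in> carrier G" "x' \<in> carrier G" "?\<psi> = tr (eorb e) x" "?\<psi>' = tr (eorb e) x'"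
        "va x (head T ?e) = vr (vorb (head T e))" "va x' (head T (arev T ?e)) = vr (vorb (head T e))"
        unfolding adhesion_maps_eq[OF e(1)] twisted_adhesion_maps_eq[OF e(1) True] by blast
      then show ?thesis unfolding True hd' by (intro exI[of _ x] exI[of _ x'] exI[of _ ?e]) (auto simp: ed_def e(1))
    next
      assume "?\<psi>' \<in> adhesion_maps \<G> (eorb e) \<and> ?\<psi> \<in> twisted_adhesion_maps \<G> (eorb e)"
      then obtain x x' where "x \<in> carrier G" "x' \<in> carrier G" "?\<psi> = tr (eorb e) x" "?\<psi>' = tr (eorb e) x'"
        "va x' (head T ?e) = vr (vorb (head T e))" "va x (head T (arev T ?e)) = vr (vorb (head T e))"
        unfolding adhesion_maps_eq[OF e(1)] twisted_adhesion_maps_eq[OF e(1) True] by blast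
      then show ?thesis unfolding True hd' using e(1)
        by (intro exI[of _ x] exI[of _ x'] exI[of _ "arev T ?e"]) (auto simp: ed_def T oe)
    qed
  qed
  then obtain x x' i where *: "i \<in> ed (eorb e)" "x \<in> carrier G" "x' \<in> carrier G"
      "?\<psi> = tr (eorb e) x" "?\<psi>' = tr (eorb (arev T e)) x'" "eorb i = eorb e"
      "va x (head T i) = vr (vorb (head T e))" "va x' (head T (arev T i)) = vr (vorb (tail T e))"
    by blast
  have "xx A = x" "xx (arev T' A) = x'" using * tr_one e e' by (auto simp: xx_def)
  then show "?\<psi> = tr (aproj S A) (xx A)" "xx A \<in> carrier G"
    "\<exists>i\<in>ed (aproj S A). eorb i = aproj S A \<and> va (xx A) (head T i) = vr (vproj S (head T' A)) \<and>
       va (xx (arev T' A)) (head T (arev T i)) = vr (vproj S (tail T' A))"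
    using * e hd by auto
qed

lemma c_head: "b \<in> arcs \<Sigma> \<Longrightarrow> c (head \<Sigma> b) = xx (ab b) \<otimes> acol S b"
  using bundle_map_acol[of b] arc_data(1)[of "ab b"] acol_E[of b] by (auto simp: tr_def T'_arcs)

text \<open>
  In the standard scaffolding adjacent vertices have the same \<open>G\<close>-component. A general scaffolding
  becomes standard after dividing the colours in the bundle \<open>V\<close> by \<open>\<gamma> V\<close>; adjacency prescribes how
  \<open>\<gamma>\<close> varies along arcs, so \<open>\<gamma>\<close> is a potential of a cocycle on the tree.
\<close>

definition \<gamma> :: "'s set \<Rightarrow> 'g" where
  "\<gamma> = (SOME \<gamma>. (\<forall>V\<in>verts T'. \<gamma> V \<in> carrier G) \<and>
     (\<forall>A\<in>arcs T'. \<gamma> (head T' A) = (xx A \<otimes> inv (xx (arev T' A))) \<otimes> \<gamma> (tail T' A)))"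

lemma \<gamma>_closed [simp]: "V \<in> verts T' \<Longrightarrow> \<gamma> V \<in> carrier G"
  and \<gamma>_head: "A \<in> arcs T' \<Longrightarrow> \<gamma> (head T' A) = (xx A \<otimes> inv (xx (arev T' A))) \<otimes> \<gamma> (tail T' A)"
proof -
  have "\<exists>\<gamma>. (\<forall>V\<in>verts T'. \<gamma> V \<in> carrier G) \<and>
     (\<forall>A\<in>arcs T'. \<gamma> (head T' A) = (xx A \<otimes> inv (xx (arev T' A))) \<otimes> \<gamma> (tail T' A))"
  proof -
    obtain \<gamma> where "\<And>V. V \<in> verts T' \<Longrightarrow> \<gamma> V \<in> carrier G"
      "\<And>A. A \<in> arcs T' \<Longrightarrow> \<gamma> (head T' A) = (xx A \<otimes> inv (xx (arev T' A))) \<otimes> \<gamma> (tail T' A)"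
      by (rule tree_potential[OF T'_tree is_group, of "\<lambda>A. xx A \<otimes> inv (xx (arev T' A))"])
        (use arc_data(2) T' in \<open>auto simp: inv_mult_group\<close>)
    then show ?thesis by blast
  qed
  from someI_ex[OF this, folded \<gamma>_def]
  show "V \<in> verts T' \<Longrightarrow> \<gamma> V \<in> carrier G"
    "A \<in> arcs T' \<Longrightarrow> \<gamma> (head T' A) = (xx A \<otimes> inv (xx (arev T' A))) \<otimes> \<gamma> (tail T' A)"
    by blast+
qed

text \<open>After normalisation by \<open>\<gamma>\<close>, an arc of \<open>A\<close> with colour
  \<open>y\<close> has ends with \<open>G\<close>-component \<open>z A \<otimes> y\<close>. The
  cocycle defining \<open>\<gamma>\<close> is chosen precisely so that \<open>z\<close> does not
  depend on the orientation. It takes the place of \<open>inv (n e)\<close> in the standard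
  scaffolding.\<close>

definition z :: "'t set \<Rightarrow> 'g" where "z A = inv (\<gamma> (head T' A)) \<otimes> xx A"

lemma z_closed [simp]: "A \<in> arcs T' \<Longrightarrow> z A \<in> carrier G"
  using arc_data(2) T' by (simp add: z_def)

lemma z_arev: assumes A: "A \<in> arcs T'" shows "z (arev T' A) = z A"
proof -
  let ?A = "arev T' A"
  note c = arc_data(2)[OF A] arc_data(2)[OF T'(3)[OF A]] \<gamma>_closed[OF T'(1)[OF A]]
  have "inv (\<gamma> (head T' A)) = inv (\<gamma> (tail T' A)) \<otimes> (xx ?A \<otimes> inv (xx A))"
    unfolding \<gamma>_head[OF A] using c by (simp add: inv_mult_group)
  then have "z A = inv (\<gamma> (tail T' A)) \<otimes> xx ?A" unfolding z_def using c by (simp add: m_assoc)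
  then show ?thesis using T'(5)[OF A] by (simp add: z_def)
qed

text \<open>In the standard scaffolding \<open>m\<close> is a possible potential, and with this
  choice \<open>F\<close> would send the bundle over \<open>w\<close> to \<open>w\<close>.\<close>

definition F :: "'s set \<Rightarrow> 'v" where "F V = va (inv (\<gamma> V)) (vr (vproj S V))"

text \<open>The element \<open>z A\<close> determines only an edge of \<open>T\<close>; the case
  distinction selects the orientation matching \<open>F\<close>, which may be either one because of
  twisted bundle maps.\<close>

definition FA :: "'t set \<Rightarrow> 'e" where
  "FA A = (let e = ea (z A) (er (aproj S A)) in if head T e = F (head T' A) then e else arev T e)"

lemma vr_vproj: "V \<in> verts T' \<Longrightarrow> vr (vproj S V) \<in> verts T"
  by (elim vproj_vertE) simp

lemma F_closed [simp]: "V \<in> verts T' \<Longrightarrow> F V \<in> verts T"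
  by (simp add: F_def vr_vproj)

lemma vorb_F: "V \<in> verts T' \<Longrightarrow> vorb (F V) = vproj S V"
proof -
  assume V: "V \<in> verts T'"
  then obtain v where "v \<in> verts T" "vproj S V = vorb v" by (rule vproj_vertE)
  then show ?thesis using V vorb_eq[OF vr] by (simp add: F_def)
qed

lemma va_\<gamma>_F: "V \<in> verts T' \<Longrightarrow> va (\<gamma> V) (F V) = vr (vproj S V)"
  using va_inv_eq[of "\<gamma> V" "vr (vproj S V)" "F V"] vr_vproj by (simp add: F_def)

text \<open>Apply \<open>z A\<close> to the arc \<open>i\<close> of \<open>arc_data\<close>. The
  head comes out right by the definition of \<open>z\<close>, the tail because \<open>z\<close> is
  also given by the data of the reverse arc. The image of \<open>i\<close> is then the orientation
  selected in \<open>FA\<close>, the opposite one being excluded by the absence of loops.\<close>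

lemma FA_props:
  assumes A: "A \<in> arcs T'"
  shows "FA A \<in> arcs T" "FA A \<in> ea (z A) ` ed (aproj S A)" "head T (FA A) = F (head T' A)"
    "tail T (FA A) = F (tail T' A)" "eorb (FA A) = aproj S A"
proof -
  obtain e where e: "e \<in> arcs T" "aproj S A = eorb e" using aproj_arcE[OF A] .
  let ?e = "er (eorb e)"
  obtain i where i: "i \<in> ed (eorb e)" "eorb i = eorb e" "va (xx A) (head T i) = vr (vproj S (head T' A))"
    "va (xx (arev T' A)) (head T (arev T i)) = vr (vproj S (tail T' A))"
    using arc_data(3)[OF A] e by auto
  have ia: "i \<in> arcs T" using i ed_arcs[OF e(1)] by auto
  note A' = T'(3)[OF A]
  note c = arc_data(2)[OF A] arc_data(2)[OF A'] z_closed[OF A] \<gamma>_closed[OF T'(1)[OF A]] \<gamma>_closed[OF T'(2)[OF A]]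
  have h: "head T (ea (z A) i) = F (head T' A)"
    using ia c i T by (simp add: head_ea z_def va_mult F_def)
  have "z A = inv (\<gamma> (tail T' A)) \<otimes> xx (arev T' A)"
    using z_arev[OF A] T'(5)[OF A] by (simp add: z_def)
  then have "head T (ea (z A) (arev T i)) = va (inv (\<gamma> (tail T' A))) (va (xx (arev T' A)) (head T (arev T i)))"
    using ia c(2,3,4) T by (simp add: head_ea va_mult)
  then have "head T (ea (z A) (arev T i)) = F (tail T' A)" unfolding i F_def .
  then have t: "tail T (ea (z A) i) = F (tail T' A)"
    using ia c T by (simp add: arev_ea[symmetric])
  have FA: "FA A = ea (z A) i"
  proof (cases "i = ?e")
    case True
    then show ?thesis using h e by (simp add: FA_def)
  next
    case False
    then have i': "i = arev T ?e" using i by (auto simp: ed_def)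
    then have "arev T (ea (z A) ?e) = ea (z A) i" using c e by (simp add: arev_ea)
    moreover have "head T (ea (z A) ?e) \<noteq> F (head T' A)"
    proof
      assume *: "head T (ea (z A) ?e) = F (head T' A)"
      have "tail T (ea (z A) i) = head T (ea (z A) ?e)"
        using i' c e T by (simp add: head_ea tail_ea)
      then show False using * h tree_graph_loopfree[OF tree, of "ea (z A) i"] ia c by simp
    qed
    ultimately show ?thesis by (simp add: FA_def e(2))
  qed
  show "FA A \<in> arcs T" "FA A \<in> ea (z A) ` ed (aproj S A)" "head T (FA A) = F (head T' A)"
    "tail T (FA A) = F (tail T' A)" "eorb (FA A) = aproj S A"
    using FA h t ia c i e by auto
qed

lemma FA_edge: "A \<in> arcs T' \<Longrightarrow> ea (z A) ` ed (aproj S A) = {FA A, arev T (FA A)}"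
proof -
  assume A: "A \<in> arcs T'"
  obtain e where e: "e \<in> arcs T" "aproj S A = eorb e" using aproj_arcE[OF A] .
  show ?thesis using edge_image[OF e(1) z_closed[OF A], of "FA A"] FA_props(2)[OF A] e(2) by simp
qed

lemma F_hom: "(F, FA) \<in> graph_hom T' T"
proof (rule graph_homI[OF _ T'_rev T_rev])
  fix A assume A: "A \<in> arcs T'"
  note A' = T'(3)[OF A] and FA = FA_props[OF A]
  note FA' = FA_props[OF A']
  show "FA A \<in> arcs T \<and> head T (FA A) = F (head T' A) \<and> arev T (FA A) = FA (arev T' A)"
    using FA FA' T'[OF A] T[OF FA(1)] by (auto intro!: tree_graph_nomulti[OF tree])
qed simp

text \<open>By the last axiom of a legal colouring the morphism is bijective on the arcs into each
  vertex, and between trees this suffices. An arc \<open>e\<close> ending at \<open>F V\<close> is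
  translated into an adhesion set, and the unique arc bundle belonging to that set is the one sent
  to \<open>e\<close>.\<close>

lemma F_iso: "(F, FA) \<in> graph_iso T' T"
proof (rule tree_covering_iso[OF T'_tree tree F_hom])
  fix V e assume V: "V \<in> verts T'" and e: "e \<in> arcs T" and he: "head T e = F V"
  let ?a = "eorb e"
  note \<gamma>V = \<gamma>_closed[OF V]
  have hd: "head B ?a = vproj S V" using e he vorb_F[OF V] by simp
  obtain g where g: "g \<in> carrier G" "e = ea g (er ?a)"
    using eorbE[of e "er ?a"] eorb_self[OF e] e by auto
  \<comment> \<open>Here \<open>g\<close> moves the representing arc to \<open>e\<close>, and
    \<open>\<gamma> V\<close> moves the head \<open>F V\<close> of \<open>e\<close> to the
    representing vertex; so translation by the product is an adhesion map.\<close>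
  let ?t = "\<gamma> V \<otimes> g"
  have t: "?t \<in> carrier G" using g \<gamma>V by simp
  have "va ?t (head T (er ?a)) = va (\<gamma> V) (head T e)"
    using g(1) \<gamma>V e T head_ea[OF g(1), of "er ?a"] by (simp add: va_mult g(2)[symmetric])
  then have "va ?t (head T (er ?a)) = vr (vorb (head T e))"
    using va_\<gamma>_F[OF V] he vorb_F[OF V] by simp
  then have "tr ?a ?t \<in> adhesion_maps \<G> ?a" using t unfolding adhesion_maps_eq[OF e] by blast
  then have Z: "tr ?a ?t ` E ?a \<in> adhesion_sets \<G> ?a" by (auto simp: adhesion_sets_def)
  have ed_img: "ea (\<gamma> V \<otimes> x) ` ed ?a = ea (\<gamma> V) ` ea x ` ed ?a" if "x \<in> carrier G" for x
    unfolding image_image using that \<gamma>V ed_arcs[OF e] by (intro image_cong) (auto simp: ea_mult)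
  have eg: "ea g ` ed ?a = {e, arev T e}"
    using g by (intro edge_image[OF e]) (auto simp: ed_def)
  have key: "bundle_map \<G> S A ` E ?a = tr ?a ?t ` E ?a \<longleftrightarrow> FA A = e"
    if A: "A \<in> arcs T'" "head T' A = V" "aproj S A = ?a" for A
  proof -
    have xz: "xx A = \<gamma> V \<otimes> z A"
      using A \<gamma>V arc_data(2)[OF A(1)] by (simp add: z_def m_assoc[symmetric])
    have "bundle_map \<G> S A ` E ?a = tr ?a ?t ` E ?a \<longleftrightarrow> ea (xx A) ` ed ?a = ea ?t ` ed ?a"
      using arc_data(1,2)[OF A(1)] tr_image_eq_iff[OF e _ t] A(3) by simp
    also have "\<dots> \<longleftrightarrow> ea (\<gamma> V) ` ea (z A) ` ed ?a = ea (\<gamma> V) ` ea g ` ed ?a"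
      unfolding xz using ed_img[OF g(1)] ed_img[OF z_closed[OF A(1)]] by simp
    also have "\<dots> \<longleftrightarrow> ea (z A) ` ed ?a = ea g ` ed ?a"
      by (rule inj_on_image_eq_iff[of _ "arcs T"])
        (use ea_inj \<gamma>V g(1) z_closed[OF A(1)] ed_arcs[OF e] in \<open>auto intro: inj_onI\<close>)
    also have "\<dots> \<longleftrightarrow> {FA A, arev T (FA A)} = {e, arev T e}"
      using FA_edge[OF A(1)] A(3) eg by simp
    also have "\<dots> \<longleftrightarrow> FA A = e"
      using tree_graph_loopfree[OF tree e] T[OF e] he FA_props(3)[OF A(1)] A(2)
      by (auto simp: doubleton_eq_iff)
    finally show ?thesis .
  qed
  have "\<exists>!A. A \<in> arcs T' \<and> head T' A = V \<and> aproj S A = ?a \<and> bundle_map \<G> S A ` E ?a = tr ?a ?t ` E ?a"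
    using legal V e Z hd unfolding legal_colouring_def by simp
  moreover have "A \<in> arcs T' \<and> head T' A = V \<and> aproj S A = ?a \<and> bundle_map \<G> S A ` E ?a = tr ?a ?t ` E ?a \<longleftrightarrow>
      A \<in> arcs T' \<and> head T' A = V \<and> FA A = e" for A
    using key FA_props(5) by blast
  ultimately show "\<exists>!A. A \<in> arcs T' \<and> head T' A = V \<and> FA A = e" by simp
qed

lemma F_inj: "V \<in> verts T' \<Longrightarrow> W \<in> verts T' \<Longrightarrow> F V = F W \<longleftrightarrow> V = W"
  and FA_inj: "A \<in> arcs T' \<Longrightarrow> A' \<in> arcs T' \<Longrightarrow> FA A = FA A' \<longleftrightarrow> A = A'"
  using graph_isoD(2,3)[OF F_iso] by (auto simp: bij_betw_def dest: inj_onD)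

section \<open>Identification with the standard graph\<close>

definition \<epsilon> :: "'s \<Rightarrow> 'g" where "\<epsilon> s = inv (\<gamma> (vb s)) \<otimes> c s"

definition \<theta>v :: "'s \<Rightarrow> 'v \<times> 'e option \<times> 'g" where "\<theta>v s = (F (vb s), None, \<epsilon> s)"
definition \<theta>a :: "'t \<Rightarrow> 'e \<times> 'g" where "\<theta>a b = (FA (ab b), z (ab b) \<otimes> acol S b)"

lemma vb_vert [simp]: "s \<in> verts \<Sigma> \<Longrightarrow> vb s \<in> verts T'"
  by (simp add: T'_verts)

lemma ab_arc [simp]: "b \<in> arcs \<Sigma> \<Longrightarrow> ab b \<in> arcs T'"
  by (simp add: T'_arcs)

lemma \<epsilon>_closed [simp]: "s \<in> verts \<Sigma> \<Longrightarrow> \<epsilon> s \<in> carrier G"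
  by (simp add: \<epsilon>_def)

lemma c_eq: "s \<in> verts \<Sigma> \<Longrightarrow> c s = \<gamma> (vb s) \<otimes> \<epsilon> s"
  by (simp add: \<epsilon>_def m_assoc[symmetric])

lemma acol_carrier [simp]: "b \<in> arcs \<Sigma> \<Longrightarrow> acol S b \<in> carrier G"
  using acol_E E_carrier by blast

lemma \<epsilon>_head: "b \<in> arcs \<Sigma> \<Longrightarrow> \<epsilon> (head \<Sigma> b) = z (ab b) \<otimes> acol S b"
  using \<Sigma> T'_ab arc_data(2)[of "ab b"] T'(2)[of "ab b"] c_head[of b]
  by (simp add: \<epsilon>_def z_def m_assoc)

lemma \<epsilon>_tail: "b \<in> arcs \<Sigma> \<Longrightarrow> \<epsilon> (tail \<Sigma> b) = \<epsilon> (head \<Sigma> b)"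
  using \<epsilon>_head[of b] \<epsilon>_head[of "arev \<Sigma> b"] \<Sigma> T'_ab(3)[of b] z_arev[of "ab b"] acol_arev[of b] by simp

text \<open>On vertices this combines the bijection \<open>F\<close> of bundles with the colour
  bijection in each bundle. On arcs the point is that left multiplication by \<open>z A\<close> maps
  the colour set of the bundle \<open>A\<close> onto the coset \<open>K (FA A)\<close>, as
  \<open>z A\<close> carries the representing edge to the edge of \<open>FA A\<close>.\<close>

lemma \<theta>_iso: "(\<theta>v, \<theta>a) \<in> graph_iso \<Sigma> std"
proof -
  have K: "z A \<otimes> y \<in> K (FA A) \<longleftrightarrow> y \<in> E (aproj S A)" if A: "A \<in> arcs T'" and y: "y \<in> carrier G" for A y
  proof -
    obtain e where e: "e \<in> arcs T" "aproj S A = eorb e" using aproj_arcE[OF A] .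
    have img: "ea (z A \<otimes> y) ` ed (eorb e) = ea (z A) ` ea y ` ed (eorb e)"
      unfolding image_image using y z_closed[OF A] ed_arcs[OF e(1)]
      by (intro image_cong) (auto simp: ea_mult)
    have "z A \<otimes> y \<in> K (FA A) \<longleftrightarrow> ea (z A \<otimes> y) ` ed (eorb e) = {FA A, arev T (FA A)}"
      using edge_image[OF e(1), of "z A \<otimes> y" "FA A"] y z_closed[OF A] FA_props(5)[OF A] e(2)
      by (auto simp: K_def)
    also have "\<dots> \<longleftrightarrow> ea (z A) ` ea y ` ed (eorb e) = ea (z A) ` ed (eorb e)"
      unfolding img using FA_edge[OF A] e(2) by simp
    also have "\<dots> \<longleftrightarrow> ea y ` ed (eorb e) = ed (eorb e)"
      by (rule inj_on_image_eq_iff[of _ "arcs T"])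
        (use ea_inj z_closed[OF A] y ed_arcs[OF e(1)] in \<open>auto intro: inj_onI\<close>)
    also have "\<dots> \<longleftrightarrow> y \<in> E (aproj S A)" using y E_iff[OF e(1)] e(2) by simp
    finally show ?thesis .
  qed
  have hom: "(\<theta>v, \<theta>a) \<in> graph_hom \<Sigma> std"
  proof (rule graph_homI[OF _ \<Sigma>_rev std_rev])
    show "\<theta>v s \<in> verts std" if "s \<in> verts \<Sigma>" for s using that by (simp add: \<theta>v_def)
  next
    fix b assume b: "b \<in> arcs \<Sigma>"
    show "\<theta>a b \<in> arcs std \<and> head std (\<theta>a b) = \<theta>v (head \<Sigma> b) \<and> arev std (\<theta>a b) = \<theta>a (arev \<Sigma> b)"
      using b K[of "ab b" "acol S b"] acol_E[OF b] FA_props[of "ab b"] \<epsilon>_head[OF b] T'_ab[OF b]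
        graph_homD(5)[OF F_hom, of "ab b"] z_arev[of "ab b"] acol_arev[OF b]
      by (simp add: \<theta>a_def \<theta>v_def)
  qed
  have "inj_on \<theta>v (verts \<Sigma>)"
  proof (rule inj_onI)
    fix s s' assume s: "s \<in> verts \<Sigma>" "s' \<in> verts \<Sigma>" "\<theta>v s = \<theta>v s'"
    then have "vb s = vb s'" "\<epsilon> s = \<epsilon> s'" using F_inj[of "vb s" "vb s'"] by (simp_all add: \<theta>v_def)
    then show "s = s'" using s c_eq c_inj by metis
  qed
  moreover have "p \<in> \<theta>v ` verts \<Sigma>" if p: "p \<in> verts std" for p
  proof -
    obtain w x where p': "p = (w, None, x)" "w \<in> verts T" "x \<in> carrier G" using p by (cases p) auto
    have "w \<in> (\<lambda>s. F (vb s)) ` verts \<Sigma>"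
      using graph_isoD(2)[OF F_iso] p'(2) by (simp add: bij_betw_def T'_verts image_image)
    then obtain s where s: "s \<in> verts \<Sigma>" "F (vb s) = w" by blast
    obtain s' where s': "s' \<in> verts \<Sigma>" "vb s' = vb s" "c s' = \<gamma> (vb s) \<otimes> x"
      using c_surj[OF s(1), of "\<gamma> (vb s) \<otimes> x"] s p' by auto
    then have "\<theta>v s' = p" using s p' by (simp add: \<theta>v_def \<epsilon>_def m_assoc[symmetric])
    then show ?thesis using s' by blast
  qed
  ultimately have bv: "bij_betw \<theta>v (verts \<Sigma>) (verts std)"
    using graph_homD(1)[OF hom] unfolding bij_betw_def by blast
  have "inj_on \<theta>a (arcs \<Sigma>)"
  proof (rule inj_onI)
    fix b b' assume b: "b \<in> arcs \<Sigma>" "b' \<in> arcs \<Sigma>" "\<theta>a b = \<theta>a b'"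
    then have 1: "ab b = ab b'" using FA_inj[of "ab b" "ab b'"] by (simp add: \<theta>a_def)
    then have "acol S b = acol S b'" using b by (simp add: \<theta>a_def)
    then show "b = b'" using acol_bij[OF b(1)] ab_self[OF b(1)] ab_self[OF b(2)] 1
      by (auto simp: bij_betw_def dest: inj_onD)
  qed
  moreover have "p \<in> \<theta>a ` arcs \<Sigma>" if p: "p \<in> arcs std" for p
  proof -
    obtain e x where p': "p = (e, x)" "e \<in> arcs T" "x \<in> K e" using p by (cases p) auto
    have "e \<in> (\<lambda>b. FA (ab b)) ` arcs \<Sigma>"
      using graph_isoD(3)[OF F_iso] p'(2) by (simp add: bij_betw_def T'_arcs image_image)
    then obtain b where b: "b \<in> arcs \<Sigma>" "FA (ab b) = e" by blast
    let ?y = "inv (z (ab b)) \<otimes> x"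
    have x: "x \<in> carrier G" "x = z (ab b) \<otimes> ?y"
      using K_carrier[OF p'(3)] b by (simp_all add: m_assoc[symmetric])
    then have "?y \<in> E (aproj S (ab b))" using K[of "ab b" ?y] b p' by simp
    then have "?y \<in> acol S ` ab b" using acol_bij[OF b(1)] by (simp add: bij_betw_def)
    then obtain b' where "b' \<in> ab b" "acol S b' = ?y" by auto
    then have "b' \<in> arcs \<Sigma>" "\<theta>a b' = p" using b ab_iff[OF b(1)] x p' by (auto simp: \<theta>a_def)
    then show ?thesis by blast
  qed
  ultimately have "bij_betw \<theta>a (arcs \<Sigma>) (arcs std)"
    using graph_homD(2)[OF hom] unfolding bij_betw_def by blast
  with bv hom show ?thesis by (simp add: graph_iso_def)
qed

section \<open>The universal group and its image on the tree\<close>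

lemma universalD:
  assumes u: "(p, q) \<in> carrier (universal_group \<G> S)"
  shows "(p, q) \<in> carrier (graph_aut \<Sigma>)"
    "s \<in> verts \<Sigma> \<Longrightarrow> p s \<in> verts \<Sigma>" "b \<in> arcs \<Sigma> \<Longrightarrow> q b \<in> arcs \<Sigma>"
    "b \<in> arcs \<Sigma> \<Longrightarrow> head \<Sigma> (q b) = p (head \<Sigma> b)" "b \<in> arcs \<Sigma> \<Longrightarrow> tail \<Sigma> (q b) = p (tail \<Sigma> b)"
    "s \<in> verts \<Sigma> \<Longrightarrow> s' \<in> verts \<Sigma> \<Longrightarrow> vb (p s) = vb (p s') \<longleftrightarrow> vb s = vb s'"
    "s \<in> verts \<Sigma> \<Longrightarrow> vproj S (vb (p s)) = vproj S (vb s)"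
    "V \<in> verts T' \<Longrightarrow> local_perm \<G> S p V \<in> lv ` vst (vr (vproj S V))"
proof -
  show a: "(p, q) \<in> carrier (graph_aut \<Sigma>)" using u by (simp add: universal_group_def)
  then have h: "(p, q) \<in> graph_hom \<Sigma> \<Sigma>" by (simp add: graph_aut_carrier_iff)
  note h = graph_homD[OF h]
  show p: "p s \<in> verts \<Sigma>" if "s \<in> verts \<Sigma>" for s using h(1)[OF that] .
  show "b \<in> arcs \<Sigma> \<Longrightarrow> q b \<in> arcs \<Sigma>" "b \<in> arcs \<Sigma> \<Longrightarrow> head \<Sigma> (q b) = p (head \<Sigma> b)"
    "b \<in> arcs \<Sigma> \<Longrightarrow> tail \<Sigma> (q b) = p (tail \<Sigma> b)"
    using h by auto
  show "s \<in> verts \<Sigma> \<Longrightarrow> s' \<in> verts \<Sigma> \<Longrightarrow> vb (p s) = vb (p s') \<longleftrightarrow> vb s = vb s'"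
    using u p vb_eq by (simp add: universal_group_def)
  show "s \<in> verts \<Sigma> \<Longrightarrow> vproj S (vb (p s)) = vproj S (vb s)"
    using u by (simp add: universal_group_def vb_def)
  show "V \<in> verts T' \<Longrightarrow> local_perm \<G> S p V \<in> lv ` vst (vr (vproj S V))"
    using u by (simp add: universal_group_def)
qed

lemma tree_perm_apply:
  assumes u: "(p, q) \<in> carrier (universal_group \<G> S)"
  shows "s \<in> verts \<Sigma> \<Longrightarrow> p ` vb s = vb (p s)" "b \<in> arcs \<Sigma> \<Longrightarrow> q ` ab b = ab (q b)"
proof -
  note U = universalD[OF u]
  have surj: "p ` verts \<Sigma> = verts \<Sigma>" "q ` arcs \<Sigma> = arcs \<Sigma>"
    using U(1) BijD(3) by (auto simp: graph_aut_carrier_iff)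
  { assume s: "s \<in> verts \<Sigma>"
    have "t \<in> p ` vb s \<longleftrightarrow> t \<in> vb (p s)" for t
    proof
      assume "t \<in> p ` vb s"
      then show "t \<in> vb (p s)" using U(2,6) s by (auto simp: vb_iff)
    next
      assume t: "t \<in> vb (p s)"
      then have "t \<in> p ` verts \<Sigma>" and tp: "vb t = vb (p s)"
        using vb_iff[OF U(2)[OF s]] surj by auto
      then obtain s' where s': "s' \<in> verts \<Sigma>" "t = p s'" by blast
      then have "s' \<in> vb s" using tp U(6)[OF s'(1) s] s by (simp add: vb_iff)
      then show "t \<in> p ` vb s" using s' by blast
    qed
    then show "p ` vb s = vb (p s)" by blast }
  { assume b: "b \<in> arcs \<Sigma>"
    have q: "ab (q b') = ab (q b) \<longleftrightarrow> ab b' = ab b" if "b' \<in> arcs \<Sigma>" for b'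
      using that b U(3-5) by (simp add: ab_vb U(6) \<Sigma>(1,2))
    have "t \<in> q ` ab b \<longleftrightarrow> t \<in> ab (q b)" for t
    proof
      assume "t \<in> q ` ab b"
      then obtain b' where b': "b' \<in> ab b" "t = q b'" by blast
      then have "b' \<in> arcs \<Sigma>" "ab b' = ab b" using ab_iff[OF b] by blast+
      then show "t \<in> ab (q b)" using ab_iff[OF U(3)[OF b]] U(3) q b'(2) by blast
    next
      assume t: "t \<in> ab (q b)"
      then have "t \<in> q ` arcs \<Sigma>" and tp: "ab t = ab (q b)"
        using ab_iff[OF U(3)[OF b]] surj by auto
      then obtain b' where b': "b' \<in> arcs \<Sigma>" "t = q b'" by blast
      then have "b' \<in> ab b" using tp q[OF b'(1)] b by (simp add: ab_iff)
      then show "t \<in> q ` ab b" using b' by blast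
    qed
    then show "q ` ab b = ab (q b)" by blast }
qed

text \<open>Without multiple arcs an automorphism of the tree is determined by its effect on
  vertices, so only these have to be compared.\<close>

lemma tree_perm_eqI:
  assumes u: "(p, q) \<in> carrier (universal_group \<G> S)" and g: "g \<in> carrier G"
    and F: "\<And>s. s \<in> verts \<Sigma> \<Longrightarrow> F (vb (p s)) = va g (F (vb s))"
  shows "tree_perm S (p, q) = pull_aut T' F FA (\<rho> g)"
proof -
  note U = universalD[OF u] and P = tree_perm_apply[OF u]
  have FA: "FA (ab (q b)) = ea g (FA (ab b))" if b: "b \<in> arcs \<Sigma>" for b
  proof -
    have "head T (FA (ab (q b))) = va g (head T (FA (ab b)))"
      using F[of "head \<Sigma> b"] b U(3,4) FA_props(3)[of "ab (q b)"] FA_props(3)[of "ab b"] T'_ab \<Sigma> by simp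
    moreover have "tail T (FA (ab (q b))) = va g (tail T (FA (ab b)))"
      using F[of "tail \<Sigma> b"] b U(3,5) FA_props(4)[of "ab (q b)"] FA_props(4)[of "ab b"] T'_ab \<Sigma> by simp
    ultimately show ?thesis
      using b U(3) FA_props(1)[of "ab (q b)"] FA_props(1)[of "ab b"] g
      by (intro tree_graph_nomulti[OF tree]) (auto simp: head_ea tail_ea)
  qed
  show ?thesis
    unfolding tree_perm_def fst_conv snd_conv
  proof (rule eq_pull_autI[OF F_iso T'_rev \<rho>_closed[OF g]])
    fix V assume "V \<in> verts T'"
    then obtain s where "s \<in> verts \<Sigma>" "V = vb s" by (auto simp: T'_verts)
    then show "(\<lambda>V\<in>verts T'. p ` V) V \<in> verts T' \<and> F ((\<lambda>V\<in>verts T'. p ` V) V) = fst (\<rho> g) (F V)"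
      using P(1) F U(2) by (simp add: va_def)
  next
    fix A assume "A \<in> arcs T'"
    then obtain b where "b \<in> arcs \<Sigma>" "A = ab b" by (auto simp: T'_arcs)
    then show "(\<lambda>A\<in>arcs T'. q ` A) A \<in> arcs T' \<and> FA ((\<lambda>A\<in>arcs T'. q ` A) A) = snd (\<rho> g) (FA A)"
      using P(2) FA U(3) by (simp add: ea_def)
  qed auto
qed

text \<open>The diagonal action of \<open>g\<close> on the standard graph is transported to
  \<open>\<Sigma>\<close>. Going from the bundle \<open>V\<close> to its image \<open>W\<close>, it
  acts on colours as left translation by
  \<open>\<gamma> W \<otimes> g \<otimes> inv (\<gamma> V)\<close>. This element fixes the
  representing vertex, since \<open>\<gamma> V\<close> and \<open>\<gamma> W\<close> carry
  \<open>F V\<close> and \<open>F W\<close> to it and \<open>g\<close> carries \<open>F V\<close> to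
  \<open>F W\<close>; hence the transported automorphism is acceptable.\<close>

lemma realise:
  assumes g: "g \<in> carrier G"
  shows "\<exists>u\<in>carrier (universal_group \<G> S). tree_perm S u = pull_aut T' F FA (\<rho> g)"
proof -
  obtain p q where pq: "pull_aut \<Sigma> \<theta>v \<theta>a (std_act g) = (p, q)" by (cases "pull_aut \<Sigma> \<theta>v \<theta>a (std_act g)")
  note act = std_act_aut[OF g]
  have aut: "(p, q) \<in> carrier (graph_aut \<Sigma>)"
    using pull_aut_closed[OF \<theta>_iso \<Sigma>_rev act] pq by simp
  note ap = pull_aut_apply[OF \<theta>_iso act, unfolded pq fst_conv snd_conv]
  have cl: "s \<in> verts \<Sigma> \<Longrightarrow> p s \<in> verts \<Sigma>" "b \<in> arcs \<Sigma> \<Longrightarrow> q b \<in> arcs \<Sigma>" for s b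
    using graph_aut_closed_apply[OF aut] by auto
  have F: "F (vb (p s)) = va g (F (vb s))" "\<epsilon> (p s) = g \<otimes> \<epsilon> s" if "s \<in> verts \<Sigma>" for s
    using ap(1)[OF that] that by (simp_all add: \<theta>v_def std_act_def)
  have FA: "FA (ab (q b)) = ea g (FA (ab b))" if b: "b \<in> arcs \<Sigma>" for b
    using ap(2)[OF b] b graph_homD(2)[OF graph_isoD(1)[OF \<theta>_iso] b] by (simp add: \<theta>a_def std_act_def)
  have "local_perm \<G> S p V \<in> lv ` vst (vr (vproj S V))" if V: "V \<in> verts T'" for V
  proof -
    obtain s where s: "s \<in> verts \<Sigma>" "V = vb s" using V by (auto simp: T'_verts)
    let ?W = "vb (p s)"
    have W: "?W \<in> verts T'" using cl s by simp
    define l where "l = \<gamma> ?W \<otimes> g \<otimes> inv (\<gamma> V)"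
    have lc: "l \<in> carrier G" using W V g by (simp add: l_def)
    have vp: "vproj S ?W = vproj S V"
      using vorb_F[OF W] vorb_F[OF V] F(1)[OF s(1)] g s by simp
    have "va l (vr (vproj S V)) = va (\<gamma> ?W) (va g (F V))"
      using V W g vr_vproj[OF V] by (simp add: l_def va_mult F_def)
    also have "\<dots> = vr (vproj S V)" using F(1)[OF s(1)] s va_\<gamma>_F[OF W] vp by simp
    finally have "l \<in> vst (vr (vproj S V))" using lc by (simp add: vst_def)
    moreover have "local_perm \<G> S p V = lv l"
    proof -
      have "vcol S (p (inv_into V (vcol S) y)) = (None, l \<otimes> snd y)" if y: "y \<in> {None} \<times> carrier G" for y
      proof -
        let ?t = "inv_into V (vcol S) y"
        have b: "vcol S ` V = {None} \<times> carrier G" using vcol_bij[OF s(1)] s by (simp add: bij_betw_def)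
        have "?t \<in> V" using inv_into_into[of y "vcol S" V] y b by simp
        then have t: "?t \<in> verts \<Sigma>" "vb ?t = V" using vb_iff[OF s(1)] s by auto
        have "vcol S ?t = y" using f_inv_into_f[of y "vcol S" V] y b by simp
        then have ct: "c ?t = snd y" by (simp add: c_def)
        have "F (vb (p ?t)) = F ?W" using F(1) t s by simp
        then have vt: "vb (p ?t) = ?W" using F_inj[of "vb (p ?t)" ?W] cl t s by simp
        have "c (p ?t) = \<gamma> ?W \<otimes> (g \<otimes> \<epsilon> ?t)" using c_eq[of "p ?t"] cl t vt F(2)[OF t(1)] by simp
        also have "\<dots> = l \<otimes> snd y"
          using t ct W g \<open>V \<in> verts T'\<close> y by (auto simp: \<epsilon>_def l_def m_assoc)
        finally show ?thesis using vcol_c[of "p ?t"] cl t by simp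
      qed
      then show ?thesis unfolding local_perm_def lv_def \<G>_simps by (intro restrict_ext) auto
    qed
    ultimately show ?thesis by simp
  qed
  moreover have "(p x, p y) \<in> srel S \<longleftrightarrow> (x, y) \<in> srel S" if "x \<in> verts \<Sigma>" "y \<in> verts \<Sigma>" for x y
    using vb_eq[of "p x" "p y"] vb_eq[of x y] F_inj[of "vb (p x)" "vb (p y)"] F_inj[of "vb x" "vb y"]
      va_inj[OF g, of "F (vb x)" "F (vb y)"] F(1) cl that by simp
  moreover have "vproj S (srel S `` {p x}) = vproj S (srel S `` {x})" if "x \<in> verts \<Sigma>" for x
    using vorb_F[of "vb x"] vorb_F[of "vb (p x)"] F(1) cl that g by (simp add: vb_def[symmetric])
  moreover have "aproj S (arc_rel S `` {q b}) = aproj S (arc_rel S `` {b})" if "b \<in> arcs \<Sigma>" for b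
    using FA_props(1,5)[of "ab b"] FA_props(5)[of "ab (q b)"] FA cl that g
    by (simp add: ab_def[symmetric])
  ultimately have u: "(p, q) \<in> carrier (universal_group \<G> S)"
    using aut by (simp add: universal_group_def)
  then show ?thesis using tree_perm_eqI[OF u g] F(1) by blast
qed

text \<open>In normalised coordinates a local permutation becomes left translation by an element
  \<open>\<eta>\<close>. The normalised coordinate agrees at both ends of an arc, before and after
  applying the automorphism; cancelling it shows that \<open>\<eta>\<close> agrees there too. Its
  constant value is the element of \<open>G\<close> sought.\<close>

lemma unrealise:
  assumes u: "(p, q) \<in> carrier (universal_group \<G> S)"
  shows "\<exists>g\<in>carrier G. tree_perm S (p, q) = pull_aut T' F FA (\<rho> g)"
proof -
  note U = universalD[OF u]
  define l where "l V = (SOME l. l \<in> vst (vr (vproj S V)) \<and> local_perm \<G> S p V = lv l)" for V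
  have l: "l V \<in> vst (vr (vproj S V))" "local_perm \<G> S p V = lv (l V)" if "V \<in> verts T'" for V
  proof -
    have "\<exists>l. l \<in> vst (vr (vproj S V)) \<and> local_perm \<G> S p V = lv l" using U(8)[OF that] by auto
    from someI_ex[OF this] show "l V \<in> vst (vr (vproj S V))" "local_perm \<G> S p V = lv (l V)"
      unfolding l_def by auto
  qed
  have lc: "l V \<in> carrier G" if "V \<in> verts T'" for V using l(1)[OF that] by (simp add: vst_def)
  have cp: "c (p s) = l (vb s) \<otimes> c s" if s: "s \<in> verts \<Sigma>" for s
  proof -
    have "inv_into (vb s) (vcol S) (vcol S s) = s"
      using vcol_bij[OF s] vb_self[OF s] by (simp add: bij_betw_def)
    moreover have "local_perm \<G> S p (vb s) (None, c s) = (None, l (vb s) \<otimes> c s)"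
      using l(2)[of "vb s"] s by (simp add: lv_def)
    ultimately show ?thesis
      using s vcol_c[OF s] vcol_c[OF U(2)[OF s]] by (simp add: local_perm_def)
  qed
  define \<eta> where "\<eta> s = inv (\<gamma> (vb (p s))) \<otimes> l (vb s) \<otimes> \<gamma> (vb s)" for s
  have \<eta>c: "\<eta> s \<in> carrier G" if "s \<in> verts \<Sigma>" for s using that lc U(2) by (simp add: \<eta>_def)
  have \<epsilon>p: "\<epsilon> (p s) = \<eta> s \<otimes> \<epsilon> s" if s: "s \<in> verts \<Sigma>" for s
    using cp[OF s] c_eq[OF s] s lc U(2)[OF s] by (simp add: \<epsilon>_def[of "p s"] \<eta>_def m_assoc)
  have \<eta>_arc: "\<eta> (head \<Sigma> b) = \<eta> (tail \<Sigma> b)" if b: "b \<in> arcs \<Sigma>" for b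
  proof -
    have "\<eta> (head \<Sigma> b) \<otimes> \<epsilon> (head \<Sigma> b) = \<eta> (tail \<Sigma> b) \<otimes> \<epsilon> (head \<Sigma> b)"
      using \<epsilon>p[of "head \<Sigma> b"] \<epsilon>p[of "tail \<Sigma> b"] \<epsilon>_tail[OF b] \<epsilon>_tail[OF U(3)[OF b]] U(4,5)[OF b] \<Sigma>(1,2)[OF b]
      by simp
    then show ?thesis using \<eta>c \<Sigma>(1,2)[OF b] by simp
  qed
  \<comment> \<open>As \<open>\<Sigma>\<close> may be disconnected, constancy cannot be propagated
    along its arcs alone; it has to be propagated along the quotient tree, for which
    \<open>\<eta>\<close> must depend only on the bundle.\<close>
  have \<eta>_vb: "\<eta> s = \<eta> s'" if "s \<in> verts \<Sigma>" "s' \<in> verts \<Sigma>" "vb s = vb s'" for s s'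
    using that(3) U(6)[OF that(1,2)] by (simp add: \<eta>_def)
  obtain r where r: "r \<in> verts \<Sigma>"
    using T'_tree by (auto simp: tree_graph_def connected_graph_iff T'_verts)
  have const: "\<forall>s\<in>verts \<Sigma>. vb s = V \<longrightarrow> \<eta> s = \<eta> r" if "V \<in> verts T'" for V
  proof (rule connected_graph_induct[where P="\<lambda>V. \<forall>s\<in>verts \<Sigma>. vb s = V \<longrightarrow> \<eta> s = \<eta> r" and r="vb r"])
    show "connected_graph T'" using T'_tree by (simp add: tree_graph_def)
    show "vb r \<in> verts T'" "V \<in> verts T'" using r that by auto
    show "\<forall>s\<in>verts \<Sigma>. vb s = vb r \<longrightarrow> \<eta> s = \<eta> r" using \<eta>_vb r by blast
  next
    fix A assume "A \<in> arcs T'" and IH: "\<forall>s\<in>verts \<Sigma>. vb s = tail T' A \<longrightarrow> \<eta> s = \<eta> r"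
    then obtain b where b: "b \<in> arcs \<Sigma>" "A = ab b" by (auto simp: T'_arcs)
    have "\<eta> (tail \<Sigma> b) = \<eta> r" using IH b T'_ab(2) \<Sigma>(1) by simp
    then have "\<eta> (head \<Sigma> b) = \<eta> r" using \<eta>_arc[OF b(1)] by simp
    then show "\<forall>s\<in>verts \<Sigma>. vb s = head T' A \<longrightarrow> \<eta> s = \<eta> r"
      using \<eta>_vb b T'_ab(1) \<Sigma>(2) by metis
  qed
  have "F (vb (p s)) = va (\<eta> r) (F (vb s))" if s: "s \<in> verts \<Sigma>" for s
  proof -
    let ?V = "vb s" and ?W = "vb (p s)"
    have V: "?V \<in> verts T'" "?W \<in> verts T'" using s U(2) by auto
    have "va (\<eta> s) (F ?V) = va (inv (\<gamma> ?W)) (va (l ?V) (vr (vproj S ?V)))"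
      using V lc va_\<gamma>_F[OF V(1)] vr_vproj[OF V(1)] by (simp add: \<eta>_def va_mult)
    also have "\<dots> = F ?W" using l(1)[OF V(1)] U(7)[OF s] by (simp add: vst_def F_def)
    finally show ?thesis using const s V by simp
  qed
  then show ?thesis using tree_perm_eqI[OF u \<eta>c[OF r]] \<eta>c[OF r] by blast
qed

lemma tree_image_carrier: "carrier (tree_image \<G> S) = (\<lambda>g. pull_aut T' F FA (\<rho> g)) ` carrier G"
proof -
  have "tree_perm S ` carrier (universal_group \<G> S) = (\<lambda>g. pull_aut T' F FA (\<rho> g)) ` carrier G"
  proof (intro equalityI subsetI)
    fix x assume "x \<in> tree_perm S ` carrier (universal_group \<G> S)"
    then obtain p q where "(p, q) \<in> carrier (universal_group \<G> S)" "x = tree_perm S (p, q)" by auto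
    then show "x \<in> (\<lambda>g. pull_aut T' F FA (\<rho> g)) ` carrier G" using unrealise by blast
  next
    fix x assume "x \<in> (\<lambda>g. pull_aut T' F FA (\<rho> g)) ` carrier G"
    then obtain g where g: "g \<in> carrier G" "x = pull_aut T' F FA (\<rho> g)" by blast
    then obtain u where "u \<in> carrier (universal_group \<G> S)" "tree_perm S u = x" using realise by metis
    then show "x \<in> tree_perm S ` carrier (universal_group \<G> S)" by blast
  qed
  then show ?thesis by (simp add: tree_image_def)
qed

text \<open>Faithfulness of the action enters here: it makes the homomorphism from \<open>G\<close>
  onto the image of the universal group injective.\<close>

lemma tree_image_isomorphic:
  assumes inj: "inj_on \<rho> (carrier G)"
  shows "isomorphic_graph_actions G T \<rho> (tree_image \<G> S) T' (\<lambda>u. u)"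
proof -
  let ?\<phi> = "\<lambda>g. pull_aut T' F FA (\<rho> g)"
  have "?\<phi> \<in> hom G (graph_aut T')"
    using hom_in_carrier[OF pull_aut_hom[OF F_iso T'_rev T_rev]] \<rho>_closed hom_mult[OF \<rho>_hom]
      hom_mult[OF pull_aut_hom[OF F_iso T'_rev T_rev]]
    by (intro homI) simp_all
  then have "?\<phi> \<in> hom G (tree_image \<G> S)"
    unfolding hom_def using tree_image_carrier by (auto simp: tree_image_def)
  moreover have "inj_on ?\<phi> (carrier G)"
    using inj pull_aut_inj[OF F_iso] \<rho>_closed by (auto simp: inj_on_def)
  ultimately have \<phi>: "?\<phi> \<in> iso G (tree_image \<G> S)"
    by (simp add: iso_def bij_betw_def tree_image_carrier)
  let ?f = "inv_into (verts T') F" and ?h = "inv_into (arcs T') FA"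
  have Ff: "F (?f v) = v" "?f v \<in> verts T'" if "v \<in> verts T" for v
    using that graph_isoD(2)[OF F_iso] f_inv_into_f[of v F "verts T'"] inv_into_into[of v F "verts T'"]
    by (simp_all add: bij_betw_def)
  have Fh: "FA (?h e) = e" "?h e \<in> arcs T'" if "e \<in> arcs T" for e
    using that graph_isoD(3)[OF F_iso] f_inv_into_f[of e FA "arcs T'"] inv_into_into[of e FA "arcs T'"]
    by (simp_all add: bij_betw_def)
  have "fst (?\<phi> g) (?f v) = ?f (fst (\<rho> g) v)" if "v \<in> verts T" for g v
    using Ff[OF that] by (simp add: pull_aut_def)
  moreover have "snd (?\<phi> g) (?h e) = ?h (snd (\<rho> g) e)" if "e \<in> arcs T" for g e
    using Fh[OF that] by (simp add: pull_aut_def)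
  ultimately show ?thesis
    unfolding isomorphic_graph_actions_def
    using \<phi> graph_iso_inv[OF F_iso T'_rev T_rev]
    by (intro exI[of _ ?\<phi>] exI[of _ ?f] exI[of _ ?h]) auto
qed

end

section \<open>Orbit representatives\<close>

context tree_action
begin

text \<open>One orbit is selected from each pair of mutually reverse orbits; it receives an
  arbitrary member as representative and the other orbit the reverse of that member. In a
  self-reverse orbit both members of the pair coincide.\<close>

lemma arc_reps:
  "\<exists>er. \<forall>e\<in>arcs T. er (eorb e) \<in> eorb e \<and>
     (eorb (arev T e) \<noteq> eorb e \<longrightarrow> er (eorb (arev T e)) = arev T (er (eorb e)))"
proof -
  define P where "P X = (SOME Y. Y \<in> {X, arev B X})" for X
  define s where "s X = (SOME e. e \<in> X)" for X :: "'e set"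
  define er where "er X = (if X = (SOME Y. Y \<in> {X, arev B X}) then s X else arev T (s (arev B X)))" for X
  have s: "s (eorb e) \<in> eorb e" if "e \<in> arcs T" for e
    unfolding s_def using eorb_self[OF that] by (rule someI)
  have P: "(SOME Y. Y \<in> {X, arev B X}) \<in> {X, arev B X}" for X
    by (rule someI[of _ X]) simp
  have rev_mem: "arev T f \<in> eorb e" if "e \<in> arcs T" "f \<in> eorb (arev T e)" for e f
    using that T arev_ea by (elim eorbE) (auto simp: eorb_def)
  show ?thesis
  proof (intro exI[of _ er] ballI conjI impI)
    fix e assume e: "e \<in> arcs T"
    then show "er (eorb e) \<in> eorb e"
      using s[OF e] rev_mem[OF e s] T by (simp add: er_def)
    assume ne: "eorb (arev T e) \<noteq> eorb e"
    \<comment> \<open>Both orbits span the same unordered pair, so the choice operator selects the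
      same orbit for both.\<close>
    have sw: "{eorb (arev T e), arev B (eorb (arev T e))} = {eorb e, arev B (eorb e)}"
      using e T by auto
    have "s (eorb (arev T e)) \<in> arcs T" "s (eorb e) \<in> arcs T"
      using s e T by (metis eorbE)+
    then show "er (eorb (arev T e)) = arev T (er (eorb e))"
      using P[of "eorb e"] ne e T unfolding er_def sw by (auto simp: T)
  qed
qed

lemma ex_reps: "\<exists>vr er k \<tau> m n. tree_action_reps G T \<rho> vr er k \<tau> m n"
proof -
  define vr where "vr X = (SOME v. v \<in> X)" for X :: "'v set"
  have vr: "vr (vorb v) \<in> vorb v" if "v \<in> verts T" for v
    unfolding vr_def using vorb_self[OF that] by (rule someI)
  obtain er where er: "\<And>e. e \<in> arcs T \<Longrightarrow> er (eorb e) \<in> eorb e"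
    "\<And>e. e \<in> arcs T \<Longrightarrow> eorb (arev T e) \<noteq> eorb e \<Longrightarrow> er (eorb (arev T e)) = arev T (er (eorb e))"
    using arc_reps by blast
  have er_arc: "er (eorb e) \<in> arcs T" "eorb (er (eorb e)) = eorb e" if "e \<in> arcs T" for e
    using er(1)[OF that] that eorb_eq by (auto elim: eorbE)
  have trans_v: "\<exists>g\<in>carrier G. va g v = vr (vorb w)" if "v \<in> verts T" "w \<in> verts T" "vorb v = vorb w" for v w
    using vorbE[OF vr[OF that(1)] that(1)] that(3) by metis
  have trans_e: "\<exists>g\<in>carrier G. ea g e = f" if "e \<in> arcs T" "f \<in> eorb e" for e f
    using that by (auto simp: eorb_def)
  have "\<exists>g. g \<in> carrier G \<and> va g (head T (er X)) = vr (head B X)" if X: "X \<in> arcs B" for X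
  proof -
    obtain e where e: "e \<in> arcs T" "X = eorb e" using X by auto
    then have "vorb (head T (er X)) = vorb (head T e)"
      using B_eorb(1)[OF e(1)] B_eorb(1)[OF er_arc(1)[OF e(1)]] er_arc(2)[OF e(1)] by simp
    then show ?thesis using trans_v[of "head T (er X)" "head T e"] e er_arc T by auto
  qed
  then obtain k where k: "\<And>X. X \<in> arcs B \<Longrightarrow> k X \<in> carrier G \<and> va (k X) (head T (er X)) = vr (head B X)"
    by metis
  have "\<exists>g. g \<in> carrier G \<and> ea g (er X) = arev T (er X)" if X: "X \<in> arcs B" "arev B X = X" for X
  proof -
    obtain e where e: "e \<in> arcs T" "X = eorb e" using X(1) by auto
    then have "eorb (arev T (er X)) = eorb (er X)"
      using B_eorb(3)[OF er_arc(1)[OF e(1)]] er_arc(2)[OF e(1)] X(2) e by simp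
    then have "arev T (er X) \<in> eorb (er X)" using eorb_self[of "arev T (er X)"] T er_arc e by simp
    then show ?thesis using trans_e[of "er X" "arev T (er X)"] er_arc e by auto
  qed
  then obtain \<tau> where \<tau>: "\<And>X. X \<in> arcs B \<Longrightarrow> arev B X = X \<Longrightarrow> \<tau> X \<in> carrier G \<and> ea (\<tau> X) (er X) = arev T (er X)"
    by metis
  have "\<exists>g. g \<in> carrier G \<and> va g v = vr (vorb v)" if "v \<in> verts T" for v
    using trans_v[OF that that] by auto
  then obtain m where m: "\<And>v. v \<in> verts T \<Longrightarrow> m v \<in> carrier G \<and> va (m v) v = vr (vorb v)" by metis
  \<comment> \<open>Choosing for the unordered pair \<open>{e, arev T e}\<close> instead of for
    \<open>e\<close> makes the result invariant under reversal.\<close>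
  define N where "N Y = (SOME g. g \<in> carrier G \<and> (\<forall>e\<in>Y. ea g e \<in> {er (eorb e), arev T (er (eorb e))}))" for Y
  have N: "N {e, arev T e} \<in> carrier G \<and>
      (\<forall>f\<in>{e, arev T e}. ea (N {e, arev T e}) f \<in> {er (eorb f), arev T (er (eorb f))})" if e: "e \<in> arcs T" for e
  proof -
    obtain g where g: "g \<in> carrier G" "ea g e = er (eorb e)" using trans_e[OF e er(1)[OF e]] by auto
    then have 1: "ea g (arev T e) = arev T (er (eorb e))" using arev_ea[OF g(1) e] by simp
    have "ea g (arev T e) \<in> {er (eorb (arev T e)), arev T (er (eorb (arev T e)))}"
      using er(2)[OF e] 1 by (cases "eorb (arev T e) = eorb e") auto
    then have "g \<in> carrier G \<and> (\<forall>f\<in>{e, arev T e}. ea g f \<in> {er (eorb f), arev T (er (eorb f))})"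
      using g by simp
    then show ?thesis unfolding N_def by (rule someI)
  qed
  have "tree_action_reps G T \<rho> vr er k \<tau> m (\<lambda>e. N {e, arev T e})"
  proof (unfold_locales)
    show "N {arev T e, arev T (arev T e)} = N {e, arev T e}" if "e \<in> arcs T" for e
      using T(4)[OF that] by (simp add: insert_commute)
  qed (use vr er k \<tau> m N in auto)
  then show ?thesis by blast
qed

end

theorem corollary8p3:
  fixes G :: "'g monoid"
    and T :: "('v, 'e) rgraph"
    and \<rho> :: "'g \<Rightarrow> ('v \<Rightarrow> 'v) \<times> ('e \<Rightarrow> 'e)"
  assumes "tree_graph T"
    and "acts_faithfully_on_graph G T \<rho>"
  shows "\<exists>\<G> :: ('v set, 'e set, 'e option \<times> 'g, 'g) gga_data.
           is_gga \<G> \<and>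
           (\<exists>S :: ('v \<times> 'e option \<times> 'g, 'e \<times> 'g,
                  'v set, 'e set, 'e option \<times> 'g, 'g) scaff_data. is_scaffolding \<G> S) \<and>
           (\<forall>S :: ('s, 't, 'v set, 'e set, 'e option \<times> 'g, 'g) scaff_data.
              is_scaffolding \<G> S \<longrightarrow>
              isomorphic_graph_actions G T \<rho> (tree_image \<G> S) (scaff_tree S) (\<lambda>u. u))"
proof -
  have G: "group G" and \<rho>: "\<rho> \<in> hom G (graph_aut T)" and inj: "inj_on \<rho> (carrier G)"
    using assms(2) by (auto simp: acts_faithfully_on_graph_def acts_on_graph_def)
  interpret tree_action G T \<rho>
    using G \<rho> assms(1) by (simp add: tree_action_def tree_action_axioms_def)
  obtain vr er k \<tau> m n where "tree_action_reps G T \<rho> vr er k \<tau> m n" using ex_reps by blast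
  then interpret tree_action_reps G T \<rho> vr er k \<tau> m n .
  have "isomorphic_graph_actions G T \<rho> (tree_image \<G> S) (scaff_tree S) (\<lambda>u. u)"
    if "is_scaffolding \<G> S" for S :: "('s, 't, 'v set, 'e set, 'e option \<times> 'g, 'g) scaff_data"
  proof -
    interpret scaffolding G T \<rho> vr er k \<tau> m n S by unfold_locales (rule that)
    show ?thesis using inj by (rule tree_image_isomorphic)
  qed
  then show ?thesis using \<G>_is_gga S0_is_scaffolding by blast
qed

end
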